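(* The following three categorical equivalences hold. (In each composite below, $S \circ T$ denotes "first $S$, then $T$"; all categories and functors are as defined in the context.) (1) The category $\mathbf{Classification}$ of classifications and functional infomorphisms is equivalent to the category $\mathbf{Concept\ Lattice}$ of concept lattices and concept lattice morphisms, via the concept lattice functor $\mathbf{L} : \mathbf{Classification} \to \mathbf{Concept\ Lattice}$ and the classification functor $\mathbf{C} : \mathbf{Concept\ Lattice} \to \mathbf{Classification}$, which are generalized inverses: $\mathbf{L} \circ \mathbf{C} = \mathrm{Id}_{\mathbf{Classification}}$ (equality) and $\mathbf{C} \circ \mathbf{L} \cong \mathrm{Id}_{\mathbf{Concept\ Lattice}}$ (natural isomorphism). (2) The category $\mathbf{Bond}$ of classifications and bonds is equivalent to the category $\mathbf{Complete\ Adjoint}$ of complete lattices and adjoint pairs of monotonic functions, via the complete adjoint functor $\mathbf{A} : \mathbf{Bond} \to \mathbf{Complete\ Adjoint}$ and the bond functor $\mathbf{B} : \mathbf{Complete\ Adjoint} \to \mathbf{Bond}$, which are generalized inverses: $\mathbf{A} \circ \mathbf{B} \cong \mathrm{Id}_{\mathbf{Bond}}$ and $\mathbf{B} \circ \mathbf{A} \cong \mathrm{Id}_{\mathbf{Complete\ Adjoint}}$ (natural isomorphisms). (3) The category $\mathbf{Bonding\ Pair}$ of classifications and bonding pairs is equivalent to the category $\mathbf{Complete\ Lattice}$ of complete lattices and complete homomorphisms, via the complete lattice functor $\mathbf{A}^2 : \mathbf{Bonding\ Pair} \to \mathbf{Complete\ Lattice}$ and the bonding pair functor $\mathbf{B}^2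 : \mathbf{Complete\ Lattice} \to \mathbf{Bonding\ Pair}$, which are generalized inverses: $\mathbf{A}^2 \circ \mathbf{B}^2 \cong \mathrm{Id}_{\mathbf{Bonding\ Pair}}$ and $\mathbf{B}^2 \circ \mathbf{A}^2 \cong \mathrm{Id}_{\mathbf{Complete\ Lattice}}$ (natural isomorphisms).
   Context: **Classifications and formal concepts.** A classification $A = \langle \mathrm{inst}(A), \mathrm{typ}(A), \vDash_A\rangle$ consists of a set $\mathrm{inst}(A)$ of instances, a set $\mathrm{typ}(A)$ of types, and a binary relation $\vDash_A \subseteq \mathrm{inst}(A)\times \mathrm{typ}(A)$. For any binary relation $R \subseteq I \times T$ (in particular for $\vDash_A$, where one writes $A$ for $R$) define the derivation operators: $X^R = \{t \in T \mid x R t \text{ for all } x \in X\}$ for $X \subseteq I$, and $\Gamma^R = \{i \in I \mid i R t \text{ for all } t \in \Gamma\}$ for $\Gamma \subseteq T$. Iterated exponents are applied left to right, e.g. $X^{RS} = (X^R)^S$. An extent of $A$ is a set of the form $\Gamma^A$ with $\Gamma \subseteq \mathrm{typ}(A)$; an intent of $A$ is a set of the form $X^A$ with $X \subseteq \mathrm{inst}(A)$. A formal concept of $A$ is a pair $(X,\Gamma)$ with $X \subseteq \mathrm{inst}(A)$, $\Gamma \subseteq \mathrm{typ}(A)$, $X = \Gamma^A$ and $\Gamma = X^A$. The set $L(A)$ of formal concepts, ordered by $(X_1,\Gamma_1) \le (X_2,\Gamma_2)$ iff $X_1 \subseteq X_2$ (equivalently $\Gamma_1 \supseteq \Gamma_2$),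 is a complete lattice. Define $\iota_A : \mathrm{inst}(A) \to L(A)$, $\iota_A(a) = (\{a\}^{AA}, \{a\}^A)$ and $\tau_A : \mathrm{typ}(A) \to L(A)$, $\tau_A(\alpha) = (\{\alpha\}^A, \{\alpha\}^{AA})$. **Adjoint pairs.** For posets $P,Q$, an adjoint pair $\langle \varphi,\psi\rangle : P \rightleftharpoons Q$ consists of monotonic functions $\psi : P \to Q$ (right adjoint, forward direction) and $\varphi : Q \to P$ (left adjoint) with $\varphi(q) \le_P p$ iff $q \le_Q \psi(p)$ for all $p \in P$, $q \in Q$. Adjoint pairs compose componentwise (right adjoints in the forward direction, left adjoints in the reverse direction). **$\mathbf{Classification}$.** Objects: classifications. A morphism (functional infomorphism) $\langle f,g\rangle : A \rightleftharpoons B$ consists of functions $f : \mathrm{inst}(B) \to \mathrm{inst}(A)$ and $g : \mathrm{typ}(A) \to \mathrm{typ}(B)$ such that $f(b) \vDash_A \alpha$ iff $b \vDash_B g(\alpha)$ for all $b \in \mathrm{inst}(B)$, $\alpha \in \mathrm{typ}(A)$. Composition and identities are componentwise. **$\mathbf{Concept\ Lattice}$.** Objects: concept lattices $\langle L, \mathrm{inst}(L), \mathrm{typ}(L), \iota_L, \tau_L\rangle$, where $L$ is a complete lattice, $\mathrm{inst}(L)$ and $\mathrm{typ}(L)$ are sets, and $\iota_L : \mathrm{inst}(L) \to L$, $\tau_L : \mathrm{typ}(L) \to L$ are functions such that $\iota_L[\mathrm{inst}(L)]$ is join-dense in $L$ (every element of $L$ is a join of a subset of it) and $\tau_L[\mathrm{typ}(L)]$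 is meet-dense in $L$ (every element of $L$ is a meet of a subset of it). A morphism $\langle \varphi,\psi,f,g\rangle$ from $L$ to $K$ consists of functions $f : \mathrm{inst}(K) \to \mathrm{inst}(L)$, $g : \mathrm{typ}(L) \to \mathrm{typ}(K)$ and an adjoint pair $\langle\varphi,\psi\rangle : L \rightleftharpoons K$ such that $\psi(\tau_L(\alpha)) = \tau_K(g(\alpha))$ for all $\alpha \in \mathrm{typ}(L)$ and $\varphi(\iota_K(b)) = \iota_L(f(b))$ for all $b \in \mathrm{inst}(K)$. Composition and identities are componentwise. **Functors $\mathbf{L}$ and $\mathbf{C}$.** $\mathbf{L}(A) = \langle L(A), \mathrm{inst}(A), \mathrm{typ}(A), \iota_A, \tau_A\rangle$, and for $\langle f,g\rangle : A \rightleftharpoons B$, $\mathbf{L}(\langle f,g\rangle) = \langle \varphi,\psi,f,g\rangle$, where $\psi : L(A) \to L(B)$ is $\psi(X,\Gamma) = (f^{-1}[X], (f^{-1}[X])^B)$ and $\varphi : L(B) \to L(A)$ is $\varphi(Y,\Delta) = ((g^{-1}[\Delta])^A, g^{-1}[\Delta])$. $\mathbf{C}(\langle L, \mathrm{inst}(L), \mathrm{typ}(L), \iota_L,\tau_L\rangle) = \langle \mathrm{inst}(L), \mathrm{typ}(L), \vDash_L\rangle$, where $a \vDash_L \alpha$ iff $\iota_L(a) \le_L \tau_L(\alpha)$, and $\mathbf{C}(\langle\varphi,\psi,f,g\rangle) = \langle f,g\rangle$. **$\mathbf{Bond}$.** Objects: classifications. A morphism (bond) $F : A \to B$ is a relation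 $F \subseteq \mathrm{inst}(B) \times \mathrm{typ}(A)$ such that for each $b \in \mathrm{inst}(B)$ the row $bF = \{\alpha \mid bF\alpha\}$ is an intent of $A$, and for each $\alpha \in \mathrm{typ}(A)$ the column $F\alpha = \{b \mid bF\alpha\}$ is an extent of $B$. The composite of $F : A \to B$ and $G : B \to C$ is $F \circ G = \{(c,\alpha) \in \mathrm{inst}(C)\times\mathrm{typ}(A) \mid (cG)^B \subseteq F\alpha\}$, a bond $A \to C$. The identity bond at $A$ is $\vDash_A$. **$\mathbf{Complete\ Adjoint}$.** Objects: complete lattices. Morphisms $L \to K$: adjoint pairs $\langle\varphi,\psi\rangle : L \rightleftharpoons K$. **Functors $\mathbf{A}$ and $\mathbf{B}$.** $\mathbf{A}(A) = L(A)$, and for a bond $F : A \to B$, $\mathbf{A}(F) = \langle\varphi_F,\psi_F\rangle : L(A) \rightleftharpoons L(B)$ with $\psi_F(X,\Gamma) = (\Gamma^F, \Gamma^{FB})$ and $\varphi_F(Y,\Delta) = (Y^{FA}, Y^F)$. $\mathbf{B}(L) = \langle L, L, \le_L\rangle$, and for $\langle\varphi,\psi\rangle : L \rightleftharpoons K$, $\mathbf{B}(\langle\varphi,\psi\rangle)$ is the bond $\{(y,x) \in K\times L \mid \varphi(y) \le_L x\} = \{(y,x) \mid y \le_K \psi(x)\}$ from $\mathbf{B}(L)$ to $\mathbf{B}(K)$. **$\mathbf{Bonding\ Pair}$.** Objects: classifications. A morphism (bonding pair) $\langle F,G\rangle : A \rightleftharpoons B$ consists of bonds $F : A \to B$ and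 $G : B \to A$ such that for every formal concept $(X,\Gamma) \in L(A)$ one has $\Gamma^F = X^{GB}$ and $X^G = \Gamma^{FB}$. The composite of $\langle F,G\rangle : A \rightleftharpoons B$ and $\langle M,N\rangle : B \rightleftharpoons C$ is $\langle F\circ M, N\circ G\rangle$ (bond composition); the identity at $A$ is $\langle \vDash_A, \vDash_A\rangle$. **$\mathbf{Complete\ Lattice}$.** Objects: complete lattices. Morphisms: complete homomorphisms, i.e. functions $\psi : L \to K$ preserving all joins and all meets. Such a $\psi$ has a left adjoint $\varphi : K \to L$ ($\varphi(y) \le x$ iff $y \le \psi(x)$) and a right adjoint $\theta : K \to L$ ($\psi(x) \le y$ iff $x \le \theta(y)$). **Functors $\mathbf{A}^2$ and $\mathbf{B}^2$.** $\mathbf{A}^2(A) = L(A)$, and for a bonding pair $\langle F,G\rangle : A \rightleftharpoons B$, $\mathbf{A}^2(\langle F,G\rangle) = \psi_F = \varphi_G : L(A) \to L(B)$ (these two functions coincide for bonding pairs), where $\psi_F$ is the right adjoint in $\mathbf{A}(F)$ and $\varphi_G$ is the left adjoint in $\mathbf{A}(G)$. $\mathbf{B}^2(L) = \langle L,L,\le_L\rangle$, and for a complete homomorphism $\psi : L \to K$ with left adjoint $\varphi$ and right adjoint $\theta$, $\mathbf{B}^2(\psi) = \langle \mathbf{B}(\langle\varphi,\psi\rangle), \mathbf{B}(\langle\psi,\theta\rangle)\rangle$, where $\langle\psi,\theta\rangle : K \rightleftharpoons L$ is the adjoint pair with left adjoint $\psi$ and right adjoint $\theta$. *)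

theory Defs
  imports "HOL-Algebra.Galois_Connection"
begin

section \<open>Categories, functors, natural isomorphisms\<close>

text \<open>
  All compositions are in diagrammatic order: the value of \<open>Comp C a b c f g\<close> is
  ``first \<open>f : a \<rightarrow> b\<close>, then \<open>g : b \<rightarrow> c\<close>''. Arrows do not carry their domain and
  codomain, so these are arguments of \<open>Comp\<close> and of the arrow part of a functor.
\<close>

record ('o, 'a) cat =
  Obj :: "'o set"
  Hom :: "'o \<Rightarrow> 'o \<Rightarrow> 'a set"
  Ident :: "'o \<Rightarrow> 'a"
  Comp :: "'o \<Rightarrow> 'o \<Rightarrow> 'o \<Rightarrow> 'a \<Rightarrow> 'a \<Rightarrow> 'a"

definition category :: "('o, 'a) cat \<Rightarrow> bool" where
  "category C \<longleftrightarrow>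
     (\<forall>a\<in>Obj C. Ident C a \<in> Hom C a a) \<and>
     (\<forall>a\<in>Obj C. \<forall>b\<in>Obj C. \<forall>c\<in>Obj C. \<forall>f\<in>Hom C a b. \<forall>g\<in>Hom C b c.
        Comp C a b c f g \<in> Hom C a c) \<and>
     (\<forall>a\<in>Obj C. \<forall>b\<in>Obj C. \<forall>f\<in>Hom C a b.
        Comp C a a b (Ident C a) f = f \<and> Comp C a b b f (Ident C b) = f) \<and>
     (\<forall>a\<in>Obj C. \<forall>b\<in>Obj C. \<forall>c\<in>Obj C. \<forall>d\<in>Obj C.
        \<forall>f\<in>Hom C a b. \<forall>g\<in>Hom C b c. \<forall>h\<in>Hom C c d.
        Comp C a c d (Comp C a b c f g) h = Comp C a b d f (Comp C b c d g h))"

definition full_subcategory :: "('o, 'a) cat \<Rightarrow> ('o \<Rightarrow> bool) \<Rightarrow> ('o, 'a) cat" where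
  "full_subcategory C P = C\<lparr>Obj := {a \<in> Obj C. P a}\<rparr>"

record ('o, 'a, 'p, 'b) func =
  fobj :: "'o \<Rightarrow> 'p"
  farr :: "'o \<Rightarrow> 'o \<Rightarrow> 'a \<Rightarrow> 'b"

definition is_functor :: "('o, 'a) cat \<Rightarrow> ('p, 'b) cat \<Rightarrow> ('o, 'a, 'p, 'b) func \<Rightarrow> bool" where
  "is_functor C D F \<longleftrightarrow>
     (\<forall>a\<in>Obj C. fobj F a \<in> Obj D) \<and>
     (\<forall>a\<in>Obj C. \<forall>b\<in>Obj C. \<forall>f\<in>Hom C a b. farr F a b f \<in> Hom D (fobj F a) (fobj F b)) \<and>
     (\<forall>a\<in>Obj C. farr F a a (Ident C a) = Ident D (fobj F a)) \<and>
     (\<forall>a\<in>Obj C. \<forall>b\<in>Obj C. \<forall>c\<in>Obj C. \<forall>f\<in>Hom C a b. \<forall>g\<in>Hom C b c.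
        farr F a c (Comp C a b c f g) =
        Comp D (fobj F a) (fobj F b) (fobj F c) (farr F a b f) (farr F b c g))"

definition id_func :: "('o, 'a, 'o, 'a) func" where
  "id_func = \<lparr>fobj = (\<lambda>a. a), farr = (\<lambda>a b f. f)\<rparr>"

definition func_comp :: "('o, 'a, 'p, 'b) func \<Rightarrow> ('p, 'b, 'q, 'c) func \<Rightarrow> ('o, 'a, 'q, 'c) func"
    (infixl \<open>;;\<close> 55) where
  "F ;; G = \<lparr>fobj = (\<lambda>a. fobj G (fobj F a)),
             farr = (\<lambda>a b f. farr G (fobj F a) (fobj F b) (farr F a b f))\<rparr>"

definition functors_equal_on ::
    "('o, 'a) cat \<Rightarrow> ('o, 'a, 'p, 'b) func \<Rightarrow> ('o, 'a, 'p, 'b) func \<Rightarrow> bool" where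
  "functors_equal_on C F G \<longleftrightarrow>
     (\<forall>a\<in>Obj C. fobj F a = fobj G a) \<and>
     (\<forall>a\<in>Obj C. \<forall>b\<in>Obj C. \<forall>f\<in>Hom C a b. farr F a b f = farr G a b f)"

text \<open>
  A classification \<open>A\<close> over HOL types \<open>'i, 't\<close> and the classification of its concept lattice
  are objects over different HOL types. The hom sets, identities and composition of each category
  below are therefore defined for objects over arbitrary, possibly distinct, HOL types, and
  ``isomorphism'' and ``natural isomorphism'' are defined so that the two objects
  (the values of the two functors) may have different HOL types. The constants \<open>hom12\<close>,
  \<open>comp121\<close>, \dots{} are always instances of one polymorphic constant; if the HOL types agree, the
  definitions are the usual ones (\<open>isomorphism\<close> and \<open>naturally_isomorphic\<close> below).
\<close>

definition het_isomorphism ::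
    "('o1 \<Rightarrow> 'o2 \<Rightarrow> 'm set) \<Rightarrow> ('o2 \<Rightarrow> 'o1 \<Rightarrow> 'n set) \<Rightarrow> ('o1 \<Rightarrow> 'a) \<Rightarrow> ('o2 \<Rightarrow> 'b) \<Rightarrow>
     ('o1 \<Rightarrow> 'o2 \<Rightarrow> 'o1 \<Rightarrow> 'm \<Rightarrow> 'n \<Rightarrow> 'a) \<Rightarrow> ('o2 \<Rightarrow> 'o1 \<Rightarrow> 'o2 \<Rightarrow> 'n \<Rightarrow> 'm \<Rightarrow> 'b) \<Rightarrow>
     'o1 \<Rightarrow> 'o2 \<Rightarrow> 'm \<Rightarrow> bool" where
  "het_isomorphism hom12 hom21 id1 id2 comp121 comp212 x y m \<longleftrightarrow>
     m \<in> hom12 x y \<and>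
     (\<exists>n\<in>hom21 y x. comp121 x y x m n = id1 x \<and> comp212 y x y n m = id2 y)"

definition het_naturally_isomorphic ::
    "('o1 \<Rightarrow> 'o2 \<Rightarrow> 'm \<Rightarrow> bool) \<Rightarrow>
     ('o1 \<Rightarrow> 'o1 \<Rightarrow> 'o2 \<Rightarrow> 'a \<Rightarrow> 'm \<Rightarrow> 'm) \<Rightarrow> ('o1 \<Rightarrow> 'o2 \<Rightarrow> 'o2 \<Rightarrow> 'm \<Rightarrow> 'b \<Rightarrow> 'm) \<Rightarrow>
     ('o, 'c) cat \<Rightarrow> ('o, 'c, 'o1, 'a) func \<Rightarrow> ('o, 'c, 'o2, 'b) func \<Rightarrow> bool" where
  "het_naturally_isomorphic isom comp112 comp122 C F G \<longleftrightarrow>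
     (\<exists>\<eta>. (\<forall>a\<in>Obj C. isom (fobj F a) (fobj G a) (\<eta> a)) \<and>
          (\<forall>a\<in>Obj C. \<forall>b\<in>Obj C. \<forall>f\<in>Hom C a b.
             comp112 (fobj F a) (fobj F b) (fobj G b) (farr F a b f) (\<eta> b) =
             comp122 (fobj F a) (fobj G a) (fobj G b) (\<eta> a) (farr G a b f)))"

definition isomorphism :: "('o, 'a) cat \<Rightarrow> 'o \<Rightarrow> 'o \<Rightarrow> 'a \<Rightarrow> bool" where
  "isomorphism C = het_isomorphism (Hom C) (Hom C) (Ident C) (Ident C) (Comp C) (Comp C)"

definition naturally_isomorphic ::
    "('o, 'a) cat \<Rightarrow> ('p, 'b) cat \<Rightarrow> ('o, 'a, 'p, 'b) func \<Rightarrow> ('o, 'a, 'p, 'b) func \<Rightarrow> bool" where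
  "naturally_isomorphic C D F G \<longleftrightarrow>
     het_naturally_isomorphic (isomorphism D) (Comp D) (Comp D) C F G"

definition equivalence_via ::
    "('o, 'a) cat \<Rightarrow> ('p, 'b) cat \<Rightarrow> ('o, 'a, 'p, 'b) func \<Rightarrow> ('p, 'b, 'o, 'a) func \<Rightarrow> bool" where
  "equivalence_via C D F G \<longleftrightarrow>
     category C \<and> category D \<and> is_functor C D F \<and> is_functor D C G \<and>
     naturally_isomorphic C C (F ;; G) id_func \<and>
     naturally_isomorphic D D (G ;; F) id_func"


section \<open>Classifications and formal concepts\<close>

record ('i, 't) classification =
  Inst :: "'i set"
  Typ :: "'t set"
  Sat :: "('i \<times> 't) set"

definition is_classification :: "('i, 't) classification \<Rightarrow> bool" where
  "is_classification A \<longleftrightarrow> Sat A \<subseteq> Inst A \<times> Typ A"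

text \<open>The derivations \<open>X\<^sup>R \<subseteq> T\<close> and \<open>\<Gamma>\<^sup>R \<subseteq> I\<close> for a relation \<open>R \<subseteq> I \<times> T\<close>.\<close>

definition typ_deriv :: "'t set \<Rightarrow> ('i \<times> 't) set \<Rightarrow> 'i set \<Rightarrow> 't set" where
  "typ_deriv T R X = {t \<in> T. \<forall>x\<in>X. (x, t) \<in> R}"

definition inst_deriv :: "'i set \<Rightarrow> ('i \<times> 't) set \<Rightarrow> 't set \<Rightarrow> 'i set" where
  "inst_deriv I R \<Gamma> = {i \<in> I. \<forall>t\<in>\<Gamma>. (i, t) \<in> R}"

abbreviation intent_of :: "('i, 't) classification \<Rightarrow> 'i set \<Rightarrow> 't set" where
  "intent_of A X \<equiv> typ_deriv (Typ A) (Sat A) X"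

abbreviation extent_of :: "('i, 't) classification \<Rightarrow> 't set \<Rightarrow> 'i set" where
  "extent_of A \<Gamma> \<equiv> inst_deriv (Inst A) (Sat A) \<Gamma>"

definition is_intent :: "('i, 't) classification \<Rightarrow> 't set \<Rightarrow> bool" where
  "is_intent A \<Gamma> \<longleftrightarrow> (\<exists>X\<subseteq>Inst A. \<Gamma> = intent_of A X)"

definition is_extent :: "('i, 't) classification \<Rightarrow> 'i set \<Rightarrow> bool" where
  "is_extent A X \<longleftrightarrow> (\<exists>\<Gamma>\<subseteq>Typ A. X = extent_of A \<Gamma>)"

type_synonym ('i, 't) concept = "'i set \<times> 't set"

definition concepts :: "('i, 't) classification \<Rightarrow> ('i, 't) concept set" where
  "concepts A = {(X, \<Gamma>). X \<subseteq> Inst A \<and> \<Gamma> \<subseteq> Typ A \<and> X = extent_of A \<Gamma> \<and> \<Gamma> = intent_of A X}"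

definition lattice_of :: "('i, 't) classification \<Rightarrow> ('i, 't) concept gorder" where
  "lattice_of A = \<lparr>carrier = concepts A, eq = (=), le = (\<lambda>c d. fst c \<subseteq> fst d)\<rparr>"

definition iota_of :: "('i, 't) classification \<Rightarrow> 'i \<Rightarrow> ('i, 't) concept" where
  "iota_of A = (\<lambda>a\<in>Inst A. (extent_of A (intent_of A {a}), intent_of A {a}))"

definition tau_of :: "('i, 't) classification \<Rightarrow> 't \<Rightarrow> ('i, 't) concept" where
  "tau_of A = (\<lambda>\<alpha>\<in>Typ A. (extent_of A {\<alpha>}, intent_of A (extent_of A {\<alpha>})))"


section \<open>The category Classification\<close>

text \<open>
  Functions between sets are elements of \<open>\<rightarrow>\<^sub>E\<close> throughout (undefined outside the domain), so that
  equality of morphisms is equality of functions on their domains.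
\<close>

definition infomorphisms ::
    "('i, 't) classification \<Rightarrow> ('j, 's) classification \<Rightarrow> (('j \<Rightarrow> 'i) \<times> ('t \<Rightarrow> 's)) set" where
  "infomorphisms A B = {(f, g). f \<in> Inst B \<rightarrow>\<^sub>E Inst A \<and> g \<in> Typ A \<rightarrow>\<^sub>E Typ B \<and>
     (\<forall>b\<in>Inst B. \<forall>\<alpha>\<in>Typ A. (f b, \<alpha>) \<in> Sat A \<longleftrightarrow> (b, g \<alpha>) \<in> Sat B)}"

definition info_id :: "('i, 't) classification \<Rightarrow> ('i \<Rightarrow> 'i) \<times> ('t \<Rightarrow> 't)" where
  "info_id A = (\<lambda>a\<in>Inst A. a, \<lambda>\<alpha>\<in>Typ A. \<alpha>)"

definition info_comp ::
    "('i1, 't1) classification \<Rightarrow> ('i2, 't2) classification \<Rightarrow> ('i3, 't3) classification \<Rightarrow>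
     ('i2 \<Rightarrow> 'i1) \<times> ('t1 \<Rightarrow> 't2) \<Rightarrow> ('i3 \<Rightarrow> 'i2) \<times> ('t2 \<Rightarrow> 't3) \<Rightarrow> ('i3 \<Rightarrow> 'i1) \<times> ('t1 \<Rightarrow> 't3)" where
  "info_comp A B C = (\<lambda>(f, g) (f', g'). (compose (Inst C) f f', compose (Typ A) g' g))"

definition Classification :: "(('i, 't) classification, ('i \<Rightarrow> 'i) \<times> ('t \<Rightarrow> 't)) cat" where
  "Classification = \<lparr>Obj = Collect is_classification, Hom = infomorphisms,
                     Ident = info_id, Comp = info_comp\<rparr>"


section \<open>The category Complete Adjoint\<close>

text \<open>\<open>adjoint_pairs L K\<close> contains the pairs \<open>\<langle>\<phi>,\<psi>\<rangle> : L \<rightleftharpoons> K\<close>, with left adjoint \<open>\<phi> : K \<rightarrow> L\<close>.\<close>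

definition adjoint_pairs :: "'l gorder \<Rightarrow> 'k gorder \<Rightarrow> (('k \<Rightarrow> 'l) \<times> ('l \<Rightarrow> 'k)) set" where
  "adjoint_pairs L K = {(\<phi>, \<psi>).
     \<phi> \<in> carrier K \<rightarrow>\<^sub>E carrier L \<and> \<psi> \<in> carrier L \<rightarrow>\<^sub>E carrier K \<and>
     isotone K L \<phi> \<and> isotone L K \<psi> \<and>
     (\<forall>p\<in>carrier L. \<forall>q\<in>carrier K. \<phi> q \<sqsubseteq>\<^bsub>L\<^esub> p \<longleftrightarrow> q \<sqsubseteq>\<^bsub>K\<^esub> \<psi> p)}"

definition adj_id :: "'l gorder \<Rightarrow> ('l \<Rightarrow> 'l) \<times> ('l \<Rightarrow> 'l)" where
  "adj_id L = (\<lambda>x\<in>carrier L. x, \<lambda>x\<in>carrier L. x)"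

definition adj_comp ::
    "'l gorder \<Rightarrow> 'k gorder \<Rightarrow> 'm gorder \<Rightarrow>
     ('k \<Rightarrow> 'l) \<times> ('l \<Rightarrow> 'k) \<Rightarrow> ('m \<Rightarrow> 'k) \<times> ('k \<Rightarrow> 'm) \<Rightarrow> ('m \<Rightarrow> 'l) \<times> ('l \<Rightarrow> 'm)" where
  "adj_comp L K M = (\<lambda>(\<phi>, \<psi>) (\<phi>', \<psi>'). (compose (carrier M) \<phi> \<phi>', compose (carrier L) \<psi>' \<psi>))"

definition CompleteAdjoint :: "('l gorder, ('l \<Rightarrow> 'l) \<times> ('l \<Rightarrow> 'l)) cat" where
  "CompleteAdjoint = \<lparr>Obj = Collect complete_lattice, Hom = adjoint_pairs,
                      Ident = adj_id, Comp = adj_comp\<rparr>"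

abbreviation adj_iso ::
    "'l gorder \<Rightarrow> 'k gorder \<Rightarrow> ('k \<Rightarrow> 'l) \<times> ('l \<Rightarrow> 'k) \<Rightarrow> bool" where
  "adj_iso \<equiv> het_isomorphism adjoint_pairs adjoint_pairs adj_id adj_id adj_comp adj_comp"


section \<open>The category Concept Lattice\<close>

record ('l, 'i, 't) conlat =
  Lat :: "'l gorder"
  LInst :: "'i set"
  LTyp :: "'t set"
  iota :: "'i \<Rightarrow> 'l"
  tau :: "'t \<Rightarrow> 'l"

definition is_conlat :: "('l, 'i, 't) conlat \<Rightarrow> bool" where
  "is_conlat L \<longleftrightarrow> complete_lattice (Lat L) \<and>
     iota L \<in> LInst L \<rightarrow>\<^sub>E carrier (Lat L) \<and> tau L \<in> LTyp L \<rightarrow>\<^sub>E carrier (Lat L) \<and>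
     (\<forall>x\<in>carrier (Lat L). \<exists>S\<subseteq>iota L ` LInst L. x = \<Squnion>\<^bsub>Lat L\<^esub> S) \<and>
     (\<forall>x\<in>carrier (Lat L). \<exists>S\<subseteq>tau L ` LTyp L. x = \<Sqinter>\<^bsub>Lat L\<^esub> S)"

definition conlat_morphisms ::
    "('l, 'i, 't) conlat \<Rightarrow> ('k, 'j, 's) conlat \<Rightarrow>
     (('k \<Rightarrow> 'l) \<times> ('l \<Rightarrow> 'k) \<times> ('j \<Rightarrow> 'i) \<times> ('t \<Rightarrow> 's)) set" where
  "conlat_morphisms L K = {(\<phi>, \<psi>, f, g).
     f \<in> LInst K \<rightarrow>\<^sub>E LInst L \<and> g \<in> LTyp L \<rightarrow>\<^sub>E LTyp K \<and>
     (\<phi>, \<psi>) \<in> adjoint_pairs (Lat L) (Lat K) \<and>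
     (\<forall>\<alpha>\<in>LTyp L. \<psi> (tau L \<alpha>) = tau K (g \<alpha>)) \<and>
     (\<forall>b\<in>LInst K. \<phi> (iota K b) = iota L (f b))}"

definition conlat_id ::
    "('l, 'i, 't) conlat \<Rightarrow> ('l \<Rightarrow> 'l) \<times> ('l \<Rightarrow> 'l) \<times> ('i \<Rightarrow> 'i) \<times> ('t \<Rightarrow> 't)" where
  "conlat_id L = (\<lambda>x\<in>carrier (Lat L). x, \<lambda>x\<in>carrier (Lat L). x,
                  \<lambda>a\<in>LInst L. a, \<lambda>\<alpha>\<in>LTyp L. \<alpha>)"

definition conlat_comp ::
    "('l1, 'i1, 't1) conlat \<Rightarrow> ('l2, 'i2, 't2) conlat \<Rightarrow> ('l3, 'i3, 't3) conlat \<Rightarrow>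
     ('l2 \<Rightarrow> 'l1) \<times> ('l1 \<Rightarrow> 'l2) \<times> ('i2 \<Rightarrow> 'i1) \<times> ('t1 \<Rightarrow> 't2) \<Rightarrow>
     ('l3 \<Rightarrow> 'l2) \<times> ('l2 \<Rightarrow> 'l3) \<times> ('i3 \<Rightarrow> 'i2) \<times> ('t2 \<Rightarrow> 't3) \<Rightarrow>
     ('l3 \<Rightarrow> 'l1) \<times> ('l1 \<Rightarrow> 'l3) \<times> ('i3 \<Rightarrow> 'i1) \<times> ('t1 \<Rightarrow> 't3)" where
  "conlat_comp L K M = (\<lambda>(\<phi>, \<psi>, f, g) (\<phi>', \<psi>', f', g').
     (compose (carrier (Lat M)) \<phi> \<phi>', compose (carrier (Lat L)) \<psi>' \<psi>,
      compose (LInst M) f f', compose (LTyp L) g' g))"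

definition ConceptLattice ::
    "(('l, 'i, 't) conlat, ('l \<Rightarrow> 'l) \<times> ('l \<Rightarrow> 'l) \<times> ('i \<Rightarrow> 'i) \<times> ('t \<Rightarrow> 't)) cat" where
  "ConceptLattice = \<lparr>Obj = Collect is_conlat, Hom = conlat_morphisms,
                     Ident = conlat_id, Comp = conlat_comp\<rparr>"

abbreviation conlat_iso ::
    "('l, 'i, 't) conlat \<Rightarrow> ('k, 'j, 's) conlat \<Rightarrow>
     ('k \<Rightarrow> 'l) \<times> ('l \<Rightarrow> 'k) \<times> ('j \<Rightarrow> 'i) \<times> ('t \<Rightarrow> 's) \<Rightarrow> bool" where
  "conlat_iso \<equiv> het_isomorphism conlat_morphisms conlat_morphisms
                   conlat_id conlat_id conlat_comp conlat_comp"


section \<open>The functors L and C\<close>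

definition L_obj :: "('i, 't) classification \<Rightarrow> (('i, 't) concept, 'i, 't) conlat" where
  "L_obj A = \<lparr>Lat = lattice_of A, LInst = Inst A, LTyp = Typ A, iota = iota_of A, tau = tau_of A\<rparr>"

definition L_arr ::
    "('i, 't) classification \<Rightarrow> ('j, 's) classification \<Rightarrow> ('j \<Rightarrow> 'i) \<times> ('t \<Rightarrow> 's) \<Rightarrow>
     (('j, 's) concept \<Rightarrow> ('i, 't) concept) \<times> (('i, 't) concept \<Rightarrow> ('j, 's) concept) \<times>
     ('j \<Rightarrow> 'i) \<times> ('t \<Rightarrow> 's)" where
  "L_arr A B = (\<lambda>(f, g).
     (\<lambda>(Y, \<Delta>)\<in>concepts B. (extent_of A {\<alpha> \<in> Typ A. g \<alpha> \<in> \<Delta>}, {\<alpha> \<in> Typ A. g \<alpha> \<in> \<Delta>}),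
      \<lambda>(X, \<Gamma>)\<in>concepts A. ({b \<in> Inst B. f b \<in> X}, intent_of B {b \<in> Inst B. f b \<in> X}),
      f, g))"

definition L_functor where
  "L_functor = \<lparr>fobj = L_obj, farr = L_arr\<rparr>"

definition C_obj :: "('l, 'i, 't) conlat \<Rightarrow> ('i, 't) classification" where
  "C_obj L = \<lparr>Inst = LInst L, Typ = LTyp L,
     Sat = {(a, \<alpha>). a \<in> LInst L \<and> \<alpha> \<in> LTyp L \<and> iota L a \<sqsubseteq>\<^bsub>Lat L\<^esub> tau L \<alpha>}\<rparr>"

definition C_arr ::
    "('l, 'i, 't) conlat \<Rightarrow> ('k, 'j, 's) conlat \<Rightarrow>
     ('k \<Rightarrow> 'l) \<times> ('l \<Rightarrow> 'k) \<times> ('j \<Rightarrow> 'i) \<times> ('t \<Rightarrow> 's) \<Rightarrow> ('j \<Rightarrow> 'i) \<times> ('t \<Rightarrow> 's)" where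
  "C_arr L K = (\<lambda>(\<phi>, \<psi>, f, g). (f, g))"

definition C_functor where
  "C_functor = \<lparr>fobj = C_obj, farr = C_arr\<rparr>"


section \<open>The category Bond\<close>

definition bonds :: "('i, 't) classification \<Rightarrow> ('j, 's) classification \<Rightarrow> ('j \<times> 't) set set" where
  "bonds A B = {F. F \<subseteq> Inst B \<times> Typ A \<and>
     (\<forall>b\<in>Inst B. is_intent A {\<alpha>. (b, \<alpha>) \<in> F}) \<and>
     (\<forall>\<alpha>\<in>Typ A. is_extent B {b. (b, \<alpha>) \<in> F})}"

definition bond_id :: "('i, 't) classification \<Rightarrow> ('i \<times> 't) set" where
  "bond_id A = Sat A"

definition bond_comp ::
    "('i1, 't1) classification \<Rightarrow> ('i2, 't2) classification \<Rightarrow> ('i3, 't3) classification \<Rightarrow>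
     ('i2 \<times> 't1) set \<Rightarrow> ('i3 \<times> 't2) set \<Rightarrow> ('i3 \<times> 't1) set" where
  "bond_comp A B C F G = {(c, \<alpha>). c \<in> Inst C \<and> \<alpha> \<in> Typ A \<and>
     extent_of B {\<beta>. (c, \<beta>) \<in> G} \<subseteq> {b. (b, \<alpha>) \<in> F}}"

definition Bond :: "(('i, 't) classification, ('i \<times> 't) set) cat" where
  "Bond = \<lparr>Obj = Collect is_classification, Hom = bonds, Ident = bond_id, Comp = bond_comp\<rparr>"

abbreviation bond_iso ::
    "('i, 't) classification \<Rightarrow> ('j, 's) classification \<Rightarrow> ('j \<times> 't) set \<Rightarrow> bool" where
  "bond_iso \<equiv> het_isomorphism bonds bonds bond_id bond_id bond_comp bond_comp"


section \<open>The functors A and B\<close>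

definition bond_psi ::
    "('i, 't) classification \<Rightarrow> ('j, 's) classification \<Rightarrow> ('j \<times> 't) set \<Rightarrow>
     ('i, 't) concept \<Rightarrow> ('j, 's) concept" where
  "bond_psi A B F = (\<lambda>(X, \<Gamma>)\<in>concepts A.
     (inst_deriv (Inst B) F \<Gamma>, intent_of B (inst_deriv (Inst B) F \<Gamma>)))"

definition bond_phi ::
    "('i, 't) classification \<Rightarrow> ('j, 's) classification \<Rightarrow> ('j \<times> 't) set \<Rightarrow>
     ('j, 's) concept \<Rightarrow> ('i, 't) concept" where
  "bond_phi A B F = (\<lambda>(Y, \<Delta>)\<in>concepts B.
     (extent_of A (typ_deriv (Typ A) F Y), typ_deriv (Typ A) F Y))"

definition A_functor where
  "A_functor = \<lparr>fobj = lattice_of, farr = (\<lambda>A B F. (bond_phi A B F, bond_psi A B F))\<rparr>"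

definition B_obj :: "'l gorder \<Rightarrow> ('l, 'l) classification" where
  "B_obj L = \<lparr>Inst = carrier L, Typ = carrier L,
              Sat = {(x, y). x \<in> carrier L \<and> y \<in> carrier L \<and> x \<sqsubseteq>\<^bsub>L\<^esub> y}\<rparr>"

definition B_arr ::
    "'l gorder \<Rightarrow> 'k gorder \<Rightarrow> ('k \<Rightarrow> 'l) \<times> ('l \<Rightarrow> 'k) \<Rightarrow> ('k \<times> 'l) set" where
  "B_arr L K = (\<lambda>(\<phi>, \<psi>). {(y, x). y \<in> carrier K \<and> x \<in> carrier L \<and> \<phi> y \<sqsubseteq>\<^bsub>L\<^esub> x})"

definition B_functor where
  "B_functor = \<lparr>fobj = B_obj, farr = B_arr\<rparr>"


section \<open>The category Bonding Pair\<close>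

definition bonding_pairs ::
    "('i, 't) classification \<Rightarrow> ('j, 's) classification \<Rightarrow> (('j \<times> 't) set \<times> ('i \<times> 's) set) set" where
  "bonding_pairs A B = {(F, G). F \<in> bonds A B \<and> G \<in> bonds B A \<and>
     (\<forall>(X, \<Gamma>)\<in>concepts A.
        inst_deriv (Inst B) F \<Gamma> = extent_of B (typ_deriv (Typ B) G X) \<and>
        typ_deriv (Typ B) G X = intent_of B (inst_deriv (Inst B) F \<Gamma>))}"

definition bp_id :: "('i, 't) classification \<Rightarrow> ('i \<times> 't) set \<times> ('i \<times> 't) set" where
  "bp_id A = (Sat A, Sat A)"

definition bp_comp ::
    "('i1, 't1) classification \<Rightarrow> ('i2, 't2) classification \<Rightarrow> ('i3, 't3) classification \<Rightarrow>
     ('i2 \<times> 't1) set \<times> ('i1 \<times> 't2) set \<Rightarrow> ('i3 \<times> 't2) set \<times> ('i2 \<times> 't3) set \<Rightarrow>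
     ('i3 \<times> 't1) set \<times> ('i1 \<times> 't3) set" where
  "bp_comp A B C = (\<lambda>(F, G) (M, N). (bond_comp A B C F M, bond_comp C B A N G))"

definition BondingPair :: "(('i, 't) classification, ('i \<times> 't) set \<times> ('i \<times> 't) set) cat" where
  "BondingPair = \<lparr>Obj = Collect is_classification, Hom = bonding_pairs,
                  Ident = bp_id, Comp = bp_comp\<rparr>"

abbreviation bp_iso ::
    "('i, 't) classification \<Rightarrow> ('j, 's) classification \<Rightarrow>
     ('j \<times> 't) set \<times> ('i \<times> 's) set \<Rightarrow> bool" where
  "bp_iso \<equiv> het_isomorphism bonding_pairs bonding_pairs bp_id bp_id bp_comp bp_comp"


section \<open>The category Complete Lattice\<close>

text \<open>\<open>sup_pres\<close> and \<open>inf_pres\<close> include the empty join and the empty meet.\<close>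

definition complete_homs :: "'l gorder \<Rightarrow> 'k gorder \<Rightarrow> ('l \<Rightarrow> 'k) set" where
  "complete_homs L K =
     {\<psi> \<in> carrier L \<rightarrow>\<^sub>E carrier K. sup_pres L K \<psi> \<and> inf_pres L K \<psi>}"

definition lat_id :: "'l gorder \<Rightarrow> 'l \<Rightarrow> 'l" where
  "lat_id L = (\<lambda>x\<in>carrier L. x)"

definition lat_comp ::
    "'l gorder \<Rightarrow> 'k gorder \<Rightarrow> 'm gorder \<Rightarrow> ('l \<Rightarrow> 'k) \<Rightarrow> ('k \<Rightarrow> 'm) \<Rightarrow> ('l \<Rightarrow> 'm)" where
  "lat_comp L K M \<psi> \<psi>' = compose (carrier L) \<psi>' \<psi>"

definition CompleteLattice :: "('l gorder, 'l \<Rightarrow> 'l) cat" where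
  "CompleteLattice = \<lparr>Obj = Collect complete_lattice, Hom = complete_homs,
                      Ident = lat_id, Comp = lat_comp\<rparr>"

abbreviation lat_iso :: "'l gorder \<Rightarrow> 'k gorder \<Rightarrow> ('l \<Rightarrow> 'k) \<Rightarrow> bool" where
  "lat_iso \<equiv> het_isomorphism complete_homs complete_homs lat_id lat_id lat_comp lat_comp"


section \<open>The functors \<open>A\<^sup>2\<close> and \<open>B\<^sup>2\<close>\<close>

definition A2_functor where
  "A2_functor = \<lparr>fobj = lattice_of, farr = (\<lambda>A B. \<lambda>(F, G). bond_psi A B F)\<rparr>"

definition left_adjoint_of :: "'l gorder \<Rightarrow> 'k gorder \<Rightarrow> ('l \<Rightarrow> 'k) \<Rightarrow> ('k \<Rightarrow> 'l)" where
  "left_adjoint_of L K \<psi> = (THE \<phi>. (\<phi>, \<psi>) \<in> adjoint_pairs L K)"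

definition right_adjoint_of :: "'l gorder \<Rightarrow> 'k gorder \<Rightarrow> ('l \<Rightarrow> 'k) \<Rightarrow> ('k \<Rightarrow> 'l)" where
  "right_adjoint_of L K \<psi> = (THE \<theta>. (\<psi>, \<theta>) \<in> adjoint_pairs K L)"

definition B2_functor where
  "B2_functor = \<lparr>fobj = B_obj,
     farr = (\<lambda>L K \<psi>. (B_arr L K (left_adjoint_of L K \<psi>, \<psi>),
                       B_arr K L (\<psi>, right_adjoint_of L K \<psi>)))\<rparr>"


section \<open>Equivalences inside one universe of carrier sets\<close>

text \<open>
  HOL has no type closed under the formation of concept lattices. For a collection \<open>S\<close> of sets
  over one HOL type \<open>'u\<close>, consider the classifications and complete lattices whose carrier sets lie
  in \<open>S\<close>. A classification is kept if its concept lattice also has the size of a member of \<open>S\<close>;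
  this condition is void if \<open>S\<close> is a universe of small sets. The concept lattice is then
  replaced by its copy on a member of \<open>S\<close> along a chosen bijection. With this encoding the
  composites of the functors are endofunctors of one category.
\<close>

definition classification_in :: "'u set set \<Rightarrow> ('u, 'u) classification \<Rightarrow> bool" where
  "classification_in S A \<longleftrightarrow> Inst A \<in> S \<and> Typ A \<in> S \<and> (\<exists>h. \<exists>X\<in>S. bij_betw h (concepts A) X)"

definition lattice_in :: "'u set set \<Rightarrow> 'u gorder \<Rightarrow> bool" where
  "lattice_in S L \<longleftrightarrow> carrier L \<in> S"

definition encoding :: "'u set set \<Rightarrow> ('u, 'u) classification \<Rightarrow> ('u, 'u) concept \<Rightarrow> 'u" where
  "encoding S A = (SOME h. \<exists>X\<in>S. bij_betw h (concepts A) X)"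

definition decoding :: "'u set set \<Rightarrow> ('u, 'u) classification \<Rightarrow> 'u \<Rightarrow> ('u, 'u) concept" where
  "decoding S A = the_inv_into (concepts A) (encoding S A)"

definition lattice_of_in :: "'u set set \<Rightarrow> ('u, 'u) classification \<Rightarrow> 'u gorder" where
  "lattice_of_in S A = \<lparr>carrier = encoding S A ` concepts A, eq = (=),
     le = (\<lambda>x y. decoding S A x \<sqsubseteq>\<^bsub>lattice_of A\<^esub> decoding S A y)\<rparr>"

definition map_in ::
    "'u set set \<Rightarrow> ('u, 'u) classification \<Rightarrow> ('u, 'u) classification \<Rightarrow>
     (('u, 'u) concept \<Rightarrow> ('u, 'u) concept) \<Rightarrow> 'u \<Rightarrow> 'u" where
  "map_in S A B \<psi> = (\<lambda>x\<in>carrier (lattice_of_in S A). encoding S B (\<psi> (decoding S A x)))"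

definition A_functor_in where
  "A_functor_in S = \<lparr>fobj = lattice_of_in S,
     farr = (\<lambda>A B F. (map_in S B A (bond_phi A B F), map_in S A B (bond_psi A B F)))\<rparr>"

definition A2_functor_in where
  "A2_functor_in S = \<lparr>fobj = lattice_of_in S,
     farr = (\<lambda>A B. \<lambda>(F, G). map_in S A B (bond_psi A B F))\<rparr>"

end

theory Submission
  imports Defs
begin

text \<open>
  Everything rests on \<open>\<^bold>A\<close>. A bond \<open>F : A \<rightarrow> B\<close> can be read off its right adjoint, because
  \<open>b F \<alpha>\<close> iff \<open>b\<close> lies in the extent of \<open>\<psi>\<^sub>F (\<tau> \<alpha>)\<close>; conversely, this formula turns every adjoint
  pair between concept lattices into a bond. Thus \<open>\<^bold>A\<close> is full and faithful, even across different
  HOL types, so all laws of \<open>Bond\<close>, the isomorphism \<open>\<^bold>B (\<^bold>A A) \<cong> A\<close> and its naturality are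
  reflected from adjoint pairs. A complete homomorphism is a map with both adjoints, and a bonding
  pair is a pair of bonds with \<open>\<psi>\<^sub>F = \<phi>\<^sub>G\<close>, so the third equivalence is the second one applied to
  both components.
  A functional infomorphism induces the bond \<open>{(b, \<alpha>). f b \<Turnstile> \<alpha>}\<close>, whose adjoint pair is
  \<open>\<^bold>L \<langle>f, g\<rangle>\<close>. Finally every concept lattice \<open>L\<close> is isomorphic to the lattice of concepts of
  \<open>\<^bold>C L\<close> via \<open>x \<mapsto> ({a. \<iota> a \<le> x}, {\<alpha>. x \<le> \<tau> \<alpha>})\<close>; for a complete lattice with \<open>\<iota> = \<tau> = id\<close> this is
  the isomorphism of \<open>L\<close> with \<open>\<^bold>A (\<^bold>B L)\<close>.
\<close>

section \<open>Adjoint pairs\<close>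

text \<open>The obstacle is typing. The concept lattice of a classification over \<open>'i\<close>,
  \<open>'t\<close> lives on \<open>('i, 't) concept\<close>, so the unit at A is a bond between
  classifications over different HOL types and is not an arrow of any single \<open>cat\<close>.
  Full faithfulness and reflection of isomorphisms are therefore proved for the polymorphic hom
  sets, once for \<open>bonds\<close> and once for \<open>bonding_pairs\<close>. Only after the
  concept lattice has been copied back into \<open>'u\<close> can an abstract lemma on fully
  faithful functors produce the unit from the counit. What makes the formula for bonds work is that
  iota and tau turn membership into inequalities: b lies in an extent iff \<open>iota_of B b\<close>
  is below that concept, and \<alpha> lies in an intent iff the concept is below
  \<open>tau_of A \<alpha>\<close>. An adjunction can move inequalities, so the columns of the
  relation come from the right adjoint and its rows from the left adjoint. Since each adjoint
  determines the other, most equalities of pairs are checked on one component.\<close>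

lemma partial_order_weak_partial_order [intro, simp]: "partial_order L \<Longrightarrow> weak_partial_order L"
  by (simp add: partial_order_def)

lemma complete_lattice_partial_order [intro, simp]: "complete_lattice L \<Longrightarrow> partial_order L"
  by (simp add: complete_lattice_def)

lemma extensional_eqI:
  "\<lbrakk>f \<in> A \<rightarrow>\<^sub>E B; g \<in> A \<rightarrow>\<^sub>E C; \<And>x. x \<in> A \<Longrightarrow> f x = g x\<rbrakk> \<Longrightarrow> f = g"
  by (meson PiE_iff extensionalityI)

lemma compose_mem: "\<lbrakk>f \<in> A \<rightarrow>\<^sub>E B; g \<in> B \<rightarrow>\<^sub>E C\<rbrakk> \<Longrightarrow> compose A g f \<in> A \<rightarrow>\<^sub>E C"
  by (auto simp: compose_def)

lemma compose_restrict_id: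
  assumes "f \<in> A \<rightarrow>\<^sub>E B"
  shows "compose A f (\<lambda>x\<in>A. x) = f" "compose A (\<lambda>x\<in>B. x) f = f"
  using assms by (simp_all add: PiE_def Id_compose compose_Id[of f A B])

text \<open>Monotonicity of both maps follows from the adjunction equivalence and is taken from the
  library's Galois connections, so later proofs only check the equivalence.\<close>

lemma adjoint_pairsI:
  assumes "partial_order L" "partial_order K"
    and \<phi>: "\<phi> \<in> carrier K \<rightarrow>\<^sub>E carrier L" and \<psi>: "\<psi> \<in> carrier L \<rightarrow>\<^sub>E carrier K"
    and adj: "\<And>p q. \<lbrakk>p \<in> carrier L; q \<in> carrier K\<rbrakk> \<Longrightarrow> \<phi> q \<sqsubseteq>\<^bsub>L\<^esub> p \<longleftrightarrow> q \<sqsubseteq>\<^bsub>K\<^esub> \<psi> p"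
  shows "(\<phi>, \<psi>) \<in> adjoint_pairs L K"
proof -
  \<comment> \<open>\<open>lower\<close> goes from \<open>orderA\<close> to \<open>orderB\<close>;
    as \<phi> goes from K to L, the first order is K.\<close>
  interpret galois_connection "\<lparr>orderA = K, orderB = L, lower = \<phi>, upper = \<psi>\<rparr>"
    using assms by (intro galois_connection.intro connection.intro galois_connection_axioms.intro)
      (auto simp: PiE_def)
  show ?thesis
    using lower_iso upper_iso assms by (simp add: adjoint_pairs_def)
qed

lemma adjoint_pairsD:
  assumes "(\<phi>, \<psi>) \<in> adjoint_pairs L K"
  shows "\<phi> \<in> carrier K \<rightarrow>\<^sub>E carrier L" "\<psi> \<in> carrier L \<rightarrow>\<^sub>E carrier K"
    "\<And>p q. \<lbrakk>p \<in> carrier L; q \<in> carrier K\<rbrakk> \<Longrightarrow> \<phi> q \<sqsubseteq>\<^bsub>L\<^esub> p \<longleftrightarrow> q \<sqsubseteq>\<^bsub>K\<^esub> \<psi> p"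
    "\<And>q. q \<in> carrier K \<Longrightarrow> \<phi> q \<in> carrier L" "\<And>p. p \<in> carrier L \<Longrightarrow> \<psi> p \<in> carrier K"
  using assms by (auto simp: adjoint_pairs_def)

text \<open>The Yoneda principle for posets. An adjunction describes a value only through its lower
  or upper bounds; antisymmetry turns this into equality.\<close>

lemma (in partial_order) eqI_below:
  assumes "x \<in> carrier L" "y \<in> carrier L" "\<And>z. z \<in> carrier L \<Longrightarrow> z \<sqsubseteq> x \<longleftrightarrow> z \<sqsubseteq> y"
  shows "x = y"
  using assms by (meson le_antisym le_refl)

lemma (in partial_order) eqI_above:
  assumes "x \<in> carrier L" "y \<in> carrier L" "\<And>z. z \<in> carrier L \<Longrightarrow> x \<sqsubseteq> z \<longleftrightarrow> y \<sqsubseteq> z"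
  shows "x = y"
  using assms by (meson le_antisym le_refl)

text \<open>\<open>\<phi> q\<close> and \<open>\<phi>' q\<close> have the same upper bounds p,
  namely those with q below \<open>\<psi> p\<close>. This reduces equality of adjoint pairs to
  equality of right adjoints.\<close>

lemma left_adjoint_unique:
  assumes "partial_order L" "(\<phi>, \<psi>) \<in> adjoint_pairs L K" "(\<phi>', \<psi>) \<in> adjoint_pairs L K"
  shows "\<phi> = \<phi>'"
proof -
  interpret partial_order L by fact
  note D = adjoint_pairsD[OF assms(2)] and D' = adjoint_pairsD[OF assms(3)]
  show ?thesis
    by (rule extensional_eqI[OF D(1) D'(1)], rule eqI_above) (use D D' in auto)
qed

lemma right_adjoint_unique:
  assumes "partial_order K" "(\<phi>, \<psi>) \<in> adjoint_pairs L K" "(\<phi>, \<psi>') \<in> adjoint_pairs L K"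
  shows "\<psi> = \<psi>'"
proof -
  interpret partial_order K by fact
  note D = adjoint_pairsD[OF assms(2)] and D' = adjoint_pairsD[OF assms(3)]
  show ?thesis
    by (rule extensional_eqI[OF D(2) D'(2)], rule eqI_below) (use D(3-5) D'(3-5) in auto)
qed

lemma adj_id_mem: "partial_order L \<Longrightarrow> adj_id L \<in> adjoint_pairs L L"
  unfolding adj_id_def by (rule adjoint_pairsI) auto

text \<open>Two moves: \<open>\<phi> (\<phi>' z)\<close> is below x iff \<open>\<phi>' z\<close> is
  below \<open>\<psi> x\<close> iff z is below \<open>\<psi>' (\<psi> x)\<close>.\<close>

lemma adj_comp_mem:
  assumes "partial_order L" "partial_order M"
    and m: "m \<in> adjoint_pairs L K" and n: "n \<in> adjoint_pairs K M"
  shows "adj_comp L K M m n \<in> adjoint_pairs L M"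
proof -
  obtain \<phi> \<psi> \<phi>' \<psi>' where mn: "m = (\<phi>, \<psi>)" "n = (\<phi>', \<psi>')" by (cases m, cases n)
  note D = adjoint_pairsD[OF m[unfolded mn]] and D' = adjoint_pairsD[OF n[unfolded mn]]
  show ?thesis
    unfolding mn adj_comp_def prod.case
    by (rule adjoint_pairsI[OF assms(1,2) compose_mem[OF D'(1) D(1)] compose_mem[OF D(2) D'(2)]])
       (use D D' in \<open>auto simp: compose_eq\<close>)
qed

lemma adj_comp_id:
  assumes "m \<in> adjoint_pairs L K"
  shows "adj_comp L L K (adj_id L) m = m" "adj_comp L K K m (adj_id K) = m"
  using assms by (auto simp: adj_comp_def adj_id_def adjoint_pairs_def compose_restrict_id)

lemma adj_comp_assoc:
  assumes "m \<in> adjoint_pairs L K" "n \<in> adjoint_pairs K M" "r \<in> adjoint_pairs M N"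
  shows "adj_comp L M N (adj_comp L K M m n) r = adj_comp L K N m (adj_comp K M N n r)"
  using assms by (auto simp: adj_comp_def adjoint_pairs_def compose_def PiE_iff)

lemma category_CompleteAdjoint: "category CompleteAdjoint"
  unfolding category_def CompleteAdjoint_def
  by (auto simp: adj_id_mem adj_comp_mem adj_comp_id adj_comp_assoc)

subsection \<open>Complete homomorphisms\<close>

text \<open>Reversing both orders swaps the roles of the adjoints; in this way statements on joins
  follow from those on meets.\<close>

lemma adjoint_pairs_dual:
  assumes "partial_order L" "partial_order K"
  shows "(\<phi>, \<psi>) \<in> adjoint_pairs (inv_gorder L) (inv_gorder K) \<longleftrightarrow> (\<psi>, \<phi>) \<in> adjoint_pairs K L"
proof
  assume "(\<phi>, \<psi>) \<in> adjoint_pairs (inv_gorder L) (inv_gorder K)"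
  from adjoint_pairsD[OF this] show "(\<psi>, \<phi>) \<in> adjoint_pairs K L"
    by (intro adjoint_pairsI assms) auto
next
  assume "(\<psi>, \<phi>) \<in> adjoint_pairs K L"
  from adjoint_pairsD[OF this] show "(\<phi>, \<psi>) \<in> adjoint_pairs (inv_gorder L) (inv_gorder K)"
    by (intro adjoint_pairsI) (auto simp: dual_order_iff assms)
qed

lemma complete_lattice_dual: "complete_lattice L \<Longrightarrow> complete_lattice (inv_gorder L)"
  by (auto simp: complete_lattice_def complete_lattice_axioms_def dual_order_iff)

lemma sup_pres_dual:
  "complete_lattice L \<Longrightarrow> complete_lattice K \<Longrightarrow>
    sup_pres L K f \<longleftrightarrow> inf_pres (inv_gorder L) (inv_gorder K) f"
  by (simp add: sup_pres_def inf_pres_def complete_lattice_dual)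

text \<open>The adjoint functor theorem for complete lattices, together with the fact that right
  adjoints preserve all meets, the empty one included.\<close>

lemma inf_pres_iff_left_adjoint:
  assumes L: "complete_lattice L" and K: "complete_lattice K"
    and \<psi>: "\<psi> \<in> carrier L \<rightarrow>\<^sub>E carrier K"
  shows "inf_pres L K \<psi> \<longleftrightarrow> (\<exists>\<phi>. (\<phi>, \<psi>) \<in> adjoint_pairs L K)"
proof
  interpret L: complete_lattice L by fact
  interpret K: complete_lattice K by fact
  {
    assume pres: "inf_pres L K \<psi>"
    \<comment> \<open>A map that preserves meets is monotone: x is the meet of {x, y} when x is
      below y.\<close>
    have mono: "\<psi> x \<sqsubseteq>\<^bsub>K\<^esub> \<psi> y" if "x \<in> carrier L" "y \<in> carrier L" "x \<sqsubseteq>\<^bsub>L\<^esub> y" for x y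
    proof -
      have "\<Sqinter>\<^bsub>L\<^esub>{x, y} = x"
        by (rule L.le_antisym) (use that in \<open>auto intro: L.inf_lower L.inf_greatest\<close>)
      then have "\<psi> x = \<Sqinter>\<^bsub>K\<^esub>(\<psi> ` {x, y})"
        using pres that by (metis inf_pres_def empty_subsetI insert_subset)
      then show ?thesis
        using that \<psi> K.inf_lower[of "\<psi> ` {x, y}" "\<psi> y"] by auto
    qed
    \<comment> \<open>A left adjoint must send q to the least x with q below
      \<open>\<psi> x\<close>, so the meet of all such x is the only candidate.\<close>
    define \<phi> where "\<phi> = (\<lambda>q\<in>carrier K. \<Sqinter>\<^bsub>L\<^esub>{x \<in> carrier L. q \<sqsubseteq>\<^bsub>K\<^esub> \<psi> x})"
    have "(\<phi>, \<psi>) \<in> adjoint_pairs L K"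
    proof (rule adjoint_pairsI)
      show \<phi>: "\<phi> \<in> carrier K \<rightarrow>\<^sub>E carrier L" by (auto simp: \<phi>_def)
      fix p q assume p: "p \<in> carrier L" and q: "q \<in> carrier K"
      show "\<phi> q \<sqsubseteq>\<^bsub>L\<^esub> p \<longleftrightarrow> q \<sqsubseteq>\<^bsub>K\<^esub> \<psi> p"
      proof
        let ?X = "{x \<in> carrier L. q \<sqsubseteq>\<^bsub>K\<^esub> \<psi> x}"
        \<comment> \<open>Preservation of this meet puts \<open>\<phi> q\<close> itself into
          \<open>?X\<close>, which is the unit inequality of the adjunction.\<close>
        have "q \<sqsubseteq>\<^bsub>K\<^esub> \<Sqinter>\<^bsub>K\<^esub>(\<psi> ` ?X)"
          by (rule K.inf_greatest) (use q \<psi> in auto)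
        also have "\<Sqinter>\<^bsub>K\<^esub>(\<psi> ` ?X) = \<psi> (\<phi> q)"
          using pres q unfolding inf_pres_def by (simp add: \<phi>_def)
        finally have "q \<sqsubseteq>\<^bsub>K\<^esub> \<psi> (\<phi> q)" .
        moreover assume "\<phi> q \<sqsubseteq>\<^bsub>L\<^esub> p"
        ultimately show "q \<sqsubseteq>\<^bsub>K\<^esub> \<psi> p"
          using p q \<phi> \<psi> mono[of "\<phi> q" p] by (meson K.le_trans PiE_mem)
      next
        assume "q \<sqsubseteq>\<^bsub>K\<^esub> \<psi> p"
        then show "\<phi> q \<sqsubseteq>\<^bsub>L\<^esub> p"
          using p q by (auto simp: \<phi>_def intro: L.inf_lower)
      qed
    qed (use L K \<psi> in auto)
    then show "\<exists>\<phi>. (\<phi>, \<psi>) \<in> adjoint_pairs L K" by blast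
  next
    assume "\<exists>\<phi>. (\<phi>, \<psi>) \<in> adjoint_pairs L K"
    then obtain \<phi> where \<phi>: "(\<phi>, \<psi>) \<in> adjoint_pairs L K" ..
    note D = adjoint_pairsD[OF \<phi>]
    have "\<psi> (\<Sqinter>\<^bsub>L\<^esub>X) = \<Sqinter>\<^bsub>K\<^esub>(\<psi> ` X)" if X: "X \<subseteq> carrier L" for X
    proof (rule K.eqI_below)
      have \<psi>X: "\<psi> ` X \<subseteq> carrier K" using X \<psi> by auto
      then show "\<Sqinter>\<^bsub>K\<^esub>(\<psi> ` X) \<in> carrier K" by simp
      show "\<psi> (\<Sqinter>\<^bsub>L\<^esub>X) \<in> carrier K" using X D(5) by simp
      fix z assume z: "z \<in> carrier K"
      have "z \<sqsubseteq>\<^bsub>K\<^esub> \<psi> (\<Sqinter>\<^bsub>L\<^esub>X) \<longleftrightarrow> \<phi> z \<sqsubseteq>\<^bsub>L\<^esub> \<Sqinter>\<^bsub>L\<^esub>X"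
        using D(3) X z by simp
      also have "\<dots> \<longleftrightarrow> (\<forall>x\<in>X. \<phi> z \<sqsubseteq>\<^bsub>L\<^esub> x)"
        using L.inf_lower L.inf_greatest L.le_trans X D(4)[OF z]
        by (meson L.inf_closed subsetD)
      also have "\<dots> \<longleftrightarrow> (\<forall>x\<in>\<psi> ` X. z \<sqsubseteq>\<^bsub>K\<^esub> x)"
        using D(3)[OF subsetD[OF X] z] by simp
      also have "\<dots> \<longleftrightarrow> z \<sqsubseteq>\<^bsub>K\<^esub> \<Sqinter>\<^bsub>K\<^esub>(\<psi> ` X)"
        using K.inf_lower K.inf_greatest K.le_trans \<psi>X z
        by (meson K.inf_closed subsetD)
      finally show "z \<sqsubseteq>\<^bsub>K\<^esub> \<psi> (\<Sqinter>\<^bsub>L\<^esub>X) \<longleftrightarrow> z \<sqsubseteq>\<^bsub>K\<^esub> \<Sqinter>\<^bsub>K\<^esub>(\<psi> ` X)" .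
    qed
    then show "inf_pres L K \<psi>"
      using L K by (auto simp: inf_pres_def)
  }
qed

text \<open>With preservation replaced by existence of adjoints, identities and composites of
  complete homomorphisms come from those of adjoint pairs.\<close>

lemma complete_homs_iff_adjoints:
  assumes L: "complete_lattice L" and K: "complete_lattice K"
  shows "\<psi> \<in> complete_homs L K \<longleftrightarrow>
    (\<exists>\<phi>. (\<phi>, \<psi>) \<in> adjoint_pairs L K) \<and> (\<exists>\<theta>. (\<psi>, \<theta>) \<in> adjoint_pairs K L)"
proof -
  \<comment> \<open>A right adjoint of \<psi> is a left adjoint of the same map between the dual
    lattices.\<close>
  have "sup_pres L K \<psi> \<longleftrightarrow> (\<exists>\<theta>. (\<psi>, \<theta>) \<in> adjoint_pairs K L)"
    if "\<psi> \<in> carrier L \<rightarrow>\<^sub>E carrier K"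
    using inf_pres_iff_left_adjoint[of "inv_gorder L" "inv_gorder K" \<psi>] that L K
    by (simp add: sup_pres_dual complete_lattice_dual adjoint_pairs_dual)
  then show ?thesis
    using inf_pres_iff_left_adjoint[OF L K, of \<psi>]
    by (auto simp: complete_homs_def dest: adjoint_pairsD(2))
qed

text \<open>Uniqueness resolves the definite description as soon as some adjoint is known.\<close>

lemma left_adjoint_of_eq:
  "partial_order L \<Longrightarrow> (\<phi>, \<psi>) \<in> adjoint_pairs L K \<Longrightarrow> left_adjoint_of L K \<psi> = \<phi>"
  unfolding left_adjoint_of_def by (blast intro: left_adjoint_unique)

lemma right_adjoint_of_eq:
  "partial_order L \<Longrightarrow> (\<psi>, \<theta>) \<in> adjoint_pairs K L \<Longrightarrow> right_adjoint_of L K \<psi> = \<theta>"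
  unfolding right_adjoint_of_def by (blast intro: right_adjoint_unique)

lemma complete_homE:
  assumes "\<psi> \<in> complete_homs L K" "complete_lattice L" "complete_lattice K"
  obtains \<phi> \<theta> where "(\<phi>, \<psi>) \<in> adjoint_pairs L K" "(\<psi>, \<theta>) \<in> adjoint_pairs K L"
    "left_adjoint_of L K \<psi> = \<phi>" "right_adjoint_of L K \<psi> = \<theta>"
  using assms complete_homs_iff_adjoints left_adjoint_of_eq right_adjoint_of_eq
  by (metis complete_lattice_partial_order)

lemma lat_id_mem: "complete_lattice L \<Longrightarrow> lat_id L \<in> complete_homs L L"
  using adj_id_mem[of L] by (auto simp: complete_homs_iff_adjoints lat_id_def adj_id_def)

lemma lat_comp_mem:
  assumes "complete_lattice L" "complete_lattice K" "complete_lattice M"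
    and "\<psi> \<in> complete_homs L K" "\<psi>' \<in> complete_homs K M"
  shows "lat_comp L K M \<psi> \<psi>' \<in> complete_homs L M"
proof -
  obtain \<phi> \<theta> where 1: "(\<phi>, \<psi>) \<in> adjoint_pairs L K" "(\<psi>, \<theta>) \<in> adjoint_pairs K L"
    using assms complete_homE by blast
  obtain \<phi>' \<theta>' where 2: "(\<phi>', \<psi>') \<in> adjoint_pairs K M" "(\<psi>', \<theta>') \<in> adjoint_pairs M K"
    using assms complete_homE by blast
  show ?thesis
    using adj_comp_mem[OF _ _ 1(1) 2(1)] adj_comp_mem[OF _ _ 2(2) 1(2)] assms(1-3)
    by (auto simp: complete_homs_iff_adjoints lat_comp_def adj_comp_def)
qed

lemma lat_comp_id:
  assumes "\<psi> \<in> complete_homs L K"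
  shows "lat_comp L L K (lat_id L) \<psi> = \<psi>" "lat_comp L K K \<psi> (lat_id K) = \<psi>"
  using assms by (auto simp: lat_comp_def lat_id_def complete_homs_def compose_restrict_id)

lemma lat_comp_assoc:
  assumes "m \<in> complete_homs L K" "n \<in> complete_homs K M"
  shows "lat_comp L M N (lat_comp L K M m n) r = lat_comp L K N m (lat_comp K M N n r)"
  using assms by (auto simp: lat_comp_def complete_homs_def compose_def PiE_iff)

lemma category_CompleteLattice: "category CompleteLattice"
  unfolding category_def CompleteLattice_def
  by (simp add: lat_id_mem lat_comp_mem lat_comp_id) (simp add: lat_comp_assoc)

subsection \<open>Order isomorphisms\<close>

text \<open>\<open>h\<close> may take any value outside the carrier, so that unrestricted functions
  such as \<open>concept_at\<close> and \<open>encoding\<close> qualify. \<open>iso_map\<close> and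
  \<open>iso_inv\<close> cut it and its inverse down to extensional functions.\<close>

definition order_iso :: "'l gorder \<Rightarrow> 'k gorder \<Rightarrow> ('l \<Rightarrow> 'k) \<Rightarrow> bool" where
  "order_iso L K h \<longleftrightarrow> partial_order L \<and> partial_order K \<and> bij_betw h (carrier L) (carrier K) \<and>
     (\<forall>x\<in>carrier L. \<forall>y\<in>carrier L. h x \<sqsubseteq>\<^bsub>K\<^esub> h y \<longleftrightarrow> x \<sqsubseteq>\<^bsub>L\<^esub> y)"

definition iso_map :: "'l gorder \<Rightarrow> 'k gorder \<Rightarrow> ('l \<Rightarrow> 'k) \<Rightarrow> 'l \<Rightarrow> 'k" where
  "iso_map L K h = (\<lambda>x\<in>carrier L. h x)"

definition iso_inv :: "'l gorder \<Rightarrow> 'k gorder \<Rightarrow> ('l \<Rightarrow> 'k) \<Rightarrow> 'k \<Rightarrow> 'l" where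
  "iso_inv L K h = (\<lambda>y\<in>carrier K. the_inv_into (carrier L) h y)"

lemma iso_map_mem: "order_iso L K h \<Longrightarrow> iso_map L K h \<in> carrier L \<rightarrow>\<^sub>E carrier K"
  by (auto simp: order_iso_def iso_map_def bij_betw_def)

lemma iso_inv_mem: "order_iso L K h \<Longrightarrow> iso_inv L K h \<in> carrier K \<rightarrow>\<^sub>E carrier L"
  by (auto simp: order_iso_def iso_inv_def bij_betw_def intro: the_inv_into_into)

lemma iso_map_eq: "x \<in> carrier L \<Longrightarrow> iso_map L K h x = h x"
  by (simp add: iso_map_def)

lemma iso_inv_eq: "\<lbrakk>order_iso L K h; x \<in> carrier L\<rbrakk> \<Longrightarrow> iso_inv L K h (h x) = x"
  by (auto simp: order_iso_def iso_inv_def bij_betw_def the_inv_into_f_f)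

lemma order_iso_surj:
  "\<lbrakk>order_iso L K h; y \<in> carrier K\<rbrakk> \<Longrightarrow> \<exists>x\<in>carrier L. y = h x"
  by (auto simp: order_iso_def bij_betw_def)

text \<open>Since h preserves and reflects the order, an inequality between \<open>h x\<close> and
  y, in either direction, is one between x and the preimage of y. So the inverse is adjoint to h on
  both sides.\<close>

lemma iso_inv_map_adjoint:
  assumes "order_iso L K h"
  shows "(iso_inv L K h, iso_map L K h) \<in> adjoint_pairs L K"
    "(iso_map L K h, iso_inv L K h) \<in> adjoint_pairs K L"
proof -
  have po: "partial_order L" "partial_order K" using assms by (auto simp: order_iso_def)
  show "(iso_inv L K h, iso_map L K h) \<in> adjoint_pairs L K"
    by (rule adjoint_pairsI[OF po iso_inv_mem[OF assms] iso_map_mem[OF assms]])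
       (use assms order_iso_surj[OF assms] in
        \<open>force simp: iso_map_eq iso_inv_eq[OF assms] order_iso_def\<close>)
  show "(iso_map L K h, iso_inv L K h) \<in> adjoint_pairs K L"
    by (rule adjoint_pairsI[OF po(2,1) iso_map_mem[OF assms] iso_inv_mem[OF assms]])
       (use assms order_iso_surj[OF assms] in
        \<open>force simp: iso_map_eq iso_inv_eq[OF assms] order_iso_def\<close>)
qed

lemma iso_map_inv_compose:
  assumes "order_iso L K h"
  shows "compose (carrier L) (iso_inv L K h) (iso_map L K h) = (\<lambda>x\<in>carrier L. x)"
    "compose (carrier K) (iso_map L K h) (iso_inv L K h) = (\<lambda>x\<in>carrier K. x)"
proof -
  have "iso_map L K h (iso_inv L K h y) = y" if "y \<in> carrier K" for y
    using order_iso_surj[OF assms that] by (auto simp: iso_map_eq iso_inv_eq[OF assms])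
  then show "compose (carrier K) (iso_map L K h) (iso_inv L K h) = (\<lambda>x\<in>carrier K. x)"
    by (simp add: compose_def cong: restrict_cong)
qed (simp add: compose_def iso_map_eq iso_inv_eq[OF assms] cong: restrict_cong)

text \<open>The morphism runs from K to L, against h, because h is its left adjoint. This is the
  direction in which counits are needed.\<close>

lemma adj_iso_of_order_iso:
  assumes "order_iso L K h"
  shows "adj_iso K L (iso_map L K h, iso_inv L K h)"
  using iso_inv_map_adjoint[OF assms] iso_map_inv_compose[OF assms]
  unfolding het_isomorphism_def
  by (auto simp: adj_comp_def adj_id_def intro!: bexI[of _ "(iso_inv L K h, iso_map L K h)"])

lemma lat_iso_of_order_iso:
  assumes "order_iso L K h" "complete_lattice L" "complete_lattice K"
  shows "lat_iso K L (iso_inv L K h)"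
  using iso_inv_map_adjoint[OF assms(1)] iso_map_inv_compose[OF assms(1)] assms(2,3)
  unfolding het_isomorphism_def
  by (auto simp: complete_homs_iff_adjoints lat_comp_def lat_id_def
      intro!: bexI[of _ "iso_map L K h"])

text \<open>A square that commutes with h and k commutes with their inverses: it can be tested at
  the points \<open>h x\<close>, which exhaust the carrier of \<open>L'\<close>.\<close>

lemma iso_inv_natural:
  assumes h: "order_iso L L' h" and k: "order_iso K K' k"
    and \<psi>: "\<psi> \<in> carrier L \<rightarrow> carrier K"
    and eq: "\<And>x. x \<in> carrier L \<Longrightarrow> \<psi>' (h x) = k (\<psi> x)"
  shows "compose (carrier L') (iso_inv K K' k) \<psi>' = compose (carrier L') \<psi> (iso_inv L L' h)"
proof -
  have "iso_inv K K' k (\<psi>' y) = \<psi> (iso_inv L L' h y)" if "y \<in> carrier L'" for y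
    using order_iso_surj[OF h that] \<psi> by (auto simp: eq iso_inv_eq[OF h] iso_inv_eq[OF k] Pi_iff)
  then show ?thesis
    by (simp add: compose_def cong: restrict_cong)
qed

lemma iso_map_natural:
  assumes "\<phi> \<in> carrier K \<rightarrow> carrier L"
    and "\<And>y. y \<in> carrier K \<Longrightarrow> \<phi>' (k y) = h (\<phi> y)"
  shows "compose (carrier K) \<phi>' (iso_map K K' k) = compose (carrier K) (iso_map L L' h) \<phi>"
  using assms by (auto simp: compose_def fun_eq_iff restrict_def iso_map_def Pi_iff)

section \<open>Formal concepts\<close>

text \<open>Both inclusions say that every member of X is R-related to every member of
  \<Gamma>.\<close>

lemma subset_deriv_iff:
  "\<lbrakk>\<Gamma> \<subseteq> T; X \<subseteq> I\<rbrakk> \<Longrightarrow> X \<subseteq> inst_deriv I R \<Gamma> \<longleftrightarrow> \<Gamma> \<subseteq> typ_deriv T R X"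
  by (auto simp: inst_deriv_def typ_deriv_def)

lemma deriv_subset: "typ_deriv T R X \<subseteq> T" "inst_deriv I R \<Gamma> \<subseteq> I"
  by (auto simp: inst_deriv_def typ_deriv_def)

text \<open>Deriving three times is the same as deriving once, so the existential becomes a fixed
  point condition; its witness is the derived set.\<close>

lemma is_intent_iff:
  "is_intent A \<Gamma> \<longleftrightarrow> \<Gamma> \<subseteq> Typ A \<and> intent_of A (extent_of A \<Gamma>) = \<Gamma>"
  unfolding is_intent_def
  by (auto simp: inst_deriv_def typ_deriv_def intro!: exI[of _ "extent_of A \<Gamma>"])

lemma is_extent_iff:
  "is_extent A X \<longleftrightarrow> X \<subseteq> Inst A \<and> extent_of A (intent_of A X) = X"
  unfolding is_extent_def
  by (auto simp: inst_deriv_def typ_deriv_def intro!: exI[of _ "intent_of A X"])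

lemma conceptsD:
  assumes "(X, \<Gamma>) \<in> concepts A"
  shows "X \<subseteq> Inst A" "\<Gamma> \<subseteq> Typ A" "extent_of A \<Gamma> = X" "intent_of A X = \<Gamma>"
    "is_extent A X" "is_intent A \<Gamma>"
proof -
  have h: "X \<subseteq> Inst A \<and> \<Gamma> \<subseteq> Typ A \<and> X = extent_of A \<Gamma> \<and> \<Gamma> = intent_of A X"
    using assms unfolding concepts_def by blast
  then show X: "X \<subseteq> Inst A" and \<Gamma>: "\<Gamma> \<subseteq> Typ A" by blast+
  from h show e: "extent_of A \<Gamma> = X" and i: "intent_of A X = \<Gamma>" by metis+
  show "is_extent A X" "is_intent A \<Gamma>"
    using X \<Gamma> e i by (simp_all add: is_extent_iff is_intent_iff)
qed

lemma concept_of_extent: "is_extent A X \<Longrightarrow> (X, intent_of A X) \<in> concepts A"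
  by (simp add: concepts_def is_extent_iff deriv_subset)

lemma concept_of_intent: "is_intent A \<Gamma> \<Longrightarrow> (extent_of A \<Gamma>, \<Gamma>) \<in> concepts A"
  by (simp add: concepts_def is_intent_iff deriv_subset)

lemma is_extent_extent_of: "\<Gamma> \<subseteq> Typ A \<Longrightarrow> is_extent A (extent_of A \<Gamma>)"
  by (auto simp: is_extent_def)

lemma is_intent_intent_of: "X \<subseteq> Inst A \<Longrightarrow> is_intent A (intent_of A X)"
  by (auto simp: is_intent_def)

lemma lattice_of_simps [simp]:
  "carrier (lattice_of A) = concepts A"
  "eq (lattice_of A) = (=)"
  "x \<sqsubseteq>\<^bsub>lattice_of A\<^esub> y \<longleftrightarrow> fst x \<subseteq> fst y"
  by (auto simp: lattice_of_def)

text \<open>This is \<open>subset_deriv_iff\<close> with Y as the extent of \<Delta> and \<Gamma> as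
  the intent of X. It is the device for passing between extents and intents in all proofs on
  bonds.\<close>

lemma concept_le_iff:
  "\<lbrakk>(X, \<Gamma>) \<in> concepts A; (Y, \<Delta>) \<in> concepts A\<rbrakk> \<Longrightarrow> X \<subseteq> Y \<longleftrightarrow> \<Delta> \<subseteq> \<Gamma>"
  using subset_deriv_iff[of \<Delta> "Typ A" X "Inst A" "Sat A"] by (simp add: conceptsD)

lemma concept_eqI: "\<lbrakk>x \<in> concepts A; y \<in> concepts A; fst x = fst y\<rbrakk> \<Longrightarrow> x = y"
  by (cases x; cases y) (metis conceptsD(4) fst_conv)

lemma concept_eqI': "\<lbrakk>x \<in> concepts A; y \<in> concepts A; snd x = snd y\<rbrakk> \<Longrightarrow> x = y"
  by (cases x; cases y) (metis conceptsD(3) snd_conv)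

lemma partial_order_lattice_of [simp, intro]: "partial_order (lattice_of A)"
  by unfold_locales (simp_all, use concept_eqI in blast)

lemma deriv_antimono:
  "X \<subseteq> Y \<Longrightarrow> typ_deriv T R Y \<subseteq> typ_deriv T R X"
  "\<Gamma> \<subseteq> \<Delta> \<Longrightarrow> inst_deriv I R \<Delta> \<subseteq> inst_deriv I R \<Gamma>"
  by (auto simp: inst_deriv_def typ_deriv_def)

lemma closure_extensive:
  "X \<subseteq> Inst A \<Longrightarrow> X \<subseteq> extent_of A (intent_of A X)"
  "\<Gamma> \<subseteq> Typ A \<Longrightarrow> \<Gamma> \<subseteq> intent_of A (extent_of A \<Gamma>)"
  by (auto simp: inst_deriv_def typ_deriv_def)

text \<open>Deriving twice is monotone, so the closure of the intersection lies in the closure of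
  each member, which is that member. The factor \<open>Inst A\<close> is the value for the empty
  family.\<close>

lemma is_extent_Inter:
  assumes "\<And>X. X \<in> \<E> \<Longrightarrow> is_extent A X"
  shows "is_extent A (Inst A \<inter> \<Inter>\<E>)"
proof -
  let ?Y = "Inst A \<inter> \<Inter>\<E>"
  have "extent_of A (intent_of A ?Y) \<subseteq> X" if "X \<in> \<E>" for X
  proof -
    have "extent_of A (intent_of A ?Y) \<subseteq> extent_of A (intent_of A X)"
      using that by (intro deriv_antimono) auto
    then show ?thesis using assms[OF that] by (simp add: is_extent_iff)
  qed
  then show ?thesis
    unfolding is_extent_iff using closure_extensive(1)[of ?Y A]
    by (intro conjI Int_lower1 equalityI Int_greatest Inf_greatest) (simp_all add: deriv_subset)
qed

lemma is_intent_Inter: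
  assumes "\<And>\<Gamma>. \<Gamma> \<in> \<G> \<Longrightarrow> is_intent A \<Gamma>"
  shows "is_intent A (Typ A \<inter> \<Inter>\<G>)"
proof -
  let ?Y = "Typ A \<inter> \<Inter>\<G>"
  have "intent_of A (extent_of A ?Y) \<subseteq> \<Gamma>" if "\<Gamma> \<in> \<G>" for \<Gamma>
  proof -
    have "intent_of A (extent_of A ?Y) \<subseteq> intent_of A (extent_of A \<Gamma>)"
      using that by (intro deriv_antimono) auto
    then show ?thesis using assms[OF that] by (simp add: is_intent_iff)
  qed
  then show ?thesis
    unfolding is_intent_iff using closure_extensive(2)[of ?Y A]
    by (intro conjI Int_lower1 equalityI Int_greatest Inf_greatest) (simp_all add: deriv_subset)
qed

text \<open>Meets intersect the extents and joins intersect the intents; the other component is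
  obtained by derivation.\<close>

lemma complete_lattice_lattice_of [simp, intro]: "complete_lattice (lattice_of A)"
proof (rule partial_order.complete_latticeI)
  fix S assume S: "S \<subseteq> carrier (lattice_of A)"
  have "is_extent A (Inst A \<inter> \<Inter>(fst ` S))"
    by (rule is_extent_Inter) (use S conceptsD(5) in force)
  note c = concept_of_extent[OF this]
  then have "greatest (lattice_of A)
      (Inst A \<inter> \<Inter>(fst ` S), intent_of A (Inst A \<inter> \<Inter>(fst ` S))) (Lower (lattice_of A) S)"
    using S by (intro greatest_LowerI) (force simp: Lower_def dest: conceptsD(1))+
  then show "\<exists>i. greatest (lattice_of A) i (Lower (lattice_of A) S)" ..
  have "is_intent A (Typ A \<inter> \<Inter>(snd ` S))"
    by (rule is_intent_Inter) (use S conceptsD(6) in force)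
  note c = concept_of_intent[OF this]
  have "least (lattice_of A)
      (extent_of A (Typ A \<inter> \<Inter>(snd ` S)), Typ A \<inter> \<Inter>(snd ` S)) (Upper (lattice_of A) S)"
  proof (rule least_UpperI)
    fix x assume "x \<in> S"
    then show "x \<sqsubseteq>\<^bsub>lattice_of A\<^esub> (extent_of A (Typ A \<inter> \<Inter>(snd ` S)), Typ A \<inter> \<Inter>(snd ` S))"
      using S concept_le_iff[of "fst x" "snd x" A, OF _ c] by force
  next
    fix y assume "y \<in> Upper (lattice_of A) S"
    then have y: "y \<in> concepts A" "\<And>x. x \<in> S \<Longrightarrow> fst x \<subseteq> fst y"
      using S Upper_memD[of y "lattice_of A" S] Upper_closed[of "lattice_of A" S] by auto
    have "snd y \<subseteq> snd x" if "x \<in> S" for x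
      using y that S concept_le_iff[of "fst x" "snd x" A "fst y" "snd y"] by auto
    moreover have "snd y \<subseteq> Typ A"
      using y(1) conceptsD(2)[of "fst y" "snd y" A] by simp
    ultimately show "(extent_of A (Typ A \<inter> \<Inter>(snd ` S)), Typ A \<inter> \<Inter>(snd ` S)) \<sqsubseteq>\<^bsub>lattice_of A\<^esub> y"
      using concept_le_iff[OF c, of "fst y" "snd y"] y(1) by auto
  qed (use S c in auto)
  then show "\<exists>s. least (lattice_of A) s (Upper (lattice_of A) S)" ..
qed auto

lemma iota_of_mem: "iota_of A \<in> Inst A \<rightarrow>\<^sub>E concepts A"
  by (auto simp: iota_of_def concept_of_intent is_intent_intent_of)

lemma tau_of_mem: "tau_of A \<in> Typ A \<rightarrow>\<^sub>E concepts A"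
  by (auto simp: tau_of_def concept_of_extent is_extent_extent_of)

text \<open>The extent of \<open>iota_of A a\<close> is the closure of {a}, and an extent that
  contains a contains this closure.\<close>

lemma iota_of_le_iff:
  assumes "a \<in> Inst A" "c \<in> concepts A"
  shows "fst (iota_of A a) \<subseteq> fst c \<longleftrightarrow> a \<in> fst c"
proof (cases c)
  case (Pair X \<Gamma>)
  have c: "(X, \<Gamma>) \<in> concepts A" and a: "{a} \<subseteq> Inst A" using assms Pair by auto
  show ?thesis
    using concept_le_iff[OF concept_of_intent[OF is_intent_intent_of[OF a]] c]
      subset_deriv_iff[OF conceptsD(2)[OF c] a, of "Sat A"] conceptsD(3)[OF c] assms(1)
    by (simp add: Pair iota_of_def)
qed

lemma le_tau_of_iff:
  assumes "\<alpha> \<in> Typ A" "c \<in> concepts A"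
  shows "fst c \<subseteq> fst (tau_of A \<alpha>) \<longleftrightarrow> \<alpha> \<in> snd c"
proof (cases c)
  case (Pair X \<Gamma>)
  have c: "(X, \<Gamma>) \<in> concepts A" and \<alpha>: "{\<alpha>} \<subseteq> Typ A" using assms Pair by auto
  show ?thesis
    using subset_deriv_iff[OF \<alpha> conceptsD(1)[OF c], of "Sat A"] conceptsD(4)[OF c] assms(1)
    by (simp add: Pair tau_of_def)
qed

lemma iota_of_le_tau_of_iff:
  assumes "a \<in> Inst A" "\<alpha> \<in> Typ A"
  shows "fst (iota_of A a) \<subseteq> fst (tau_of A \<alpha>) \<longleftrightarrow> (a, \<alpha>) \<in> Sat A"
  using assms tau_of_mem[of A]
  by (subst iota_of_le_iff) (auto simp: tau_of_def inst_deriv_def Pi_iff)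

section \<open>Concept lattices\<close>

lemma is_conlatD:
  assumes "is_conlat L"
  shows "complete_lattice (Lat L)" "iota L \<in> LInst L \<rightarrow>\<^sub>E carrier (Lat L)"
    "tau L \<in> LTyp L \<rightarrow>\<^sub>E carrier (Lat L)"
    "\<And>a. a \<in> LInst L \<Longrightarrow> iota L a \<in> carrier (Lat L)"
    "\<And>\<alpha>. \<alpha> \<in> LTyp L \<Longrightarrow> tau L \<alpha> \<in> carrier (Lat L)"
  using assms by (auto simp: is_conlat_def)

text \<open>Join density in pointwise form: x is a join of elements \<open>iota L a\<close>, each of
  which lies below x.\<close>

lemma conlat_le_iff_iota:
  assumes L: "is_conlat L" and x: "x \<in> carrier (Lat L)" and y: "y \<in> carrier (Lat L)"
  shows "x \<sqsubseteq>\<^bsub>Lat L\<^esub> y \<longleftrightarrow> (\<forall>a\<in>LInst L. iota L a \<sqsubseteq>\<^bsub>Lat L\<^esub> x \<longrightarrow> iota L a \<sqsubseteq>\<^bsub>Lat L\<^esub> y)"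
proof -
  interpret complete_lattice "Lat L" using L by (rule is_conlatD)
  obtain S where S: "S \<subseteq> iota L ` LInst L" "x = \<Squnion>\<^bsub>Lat L\<^esub>S"
    using L x by (auto simp: is_conlat_def)
  have "S \<subseteq> carrier (Lat L)" using S(1) is_conlatD(4)[OF L] by auto
  then have "x \<sqsubseteq>\<^bsub>Lat L\<^esub> y" if "\<forall>a\<in>LInst L. iota L a \<sqsubseteq>\<^bsub>Lat L\<^esub> x \<longrightarrow> iota L a \<sqsubseteq>\<^bsub>Lat L\<^esub> y"
    using S that y sup_upper[of S] unfolding S(2) by (intro sup_least) auto
  then show ?thesis
    using x y is_conlatD(4)[OF L] by (meson le_trans)
qed

lemma conlat_le_iff_tau:
  assumes L: "is_conlat L" and x: "x \<in> carrier (Lat L)" and y: "y \<in> carrier (Lat L)"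
  shows "x \<sqsubseteq>\<^bsub>Lat L\<^esub> y \<longleftrightarrow> (\<forall>\<alpha>\<in>LTyp L. y \<sqsubseteq>\<^bsub>Lat L\<^esub> tau L \<alpha> \<longrightarrow> x \<sqsubseteq>\<^bsub>Lat L\<^esub> tau L \<alpha>)"
proof -
  interpret complete_lattice "Lat L" using L by (rule is_conlatD)
  obtain S where S: "S \<subseteq> tau L ` LTyp L" "y = \<Sqinter>\<^bsub>Lat L\<^esub>S"
    using L y by (auto simp: is_conlat_def)
  have "S \<subseteq> carrier (Lat L)" using S(1) is_conlatD(5)[OF L] by auto
  then have "x \<sqsubseteq>\<^bsub>Lat L\<^esub> y" if "\<forall>\<alpha>\<in>LTyp L. y \<sqsubseteq>\<^bsub>Lat L\<^esub> tau L \<alpha> \<longrightarrow> x \<sqsubseteq>\<^bsub>Lat L\<^esub> tau L \<alpha>"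
    using S that x inf_lower[of S] unfolding S(2) by (intro inf_greatest) auto
  then show ?thesis
    using x y is_conlatD(5)[OF L] by (meson le_trans)
qed

text \<open>An x that is a join of members of S is the join of all members of S below it. The third
  hypothesis makes x the least upper bound of these.\<close>

lemma (in complete_lattice) is_join_of_below:
  assumes "S \<subseteq> carrier L" "x \<in> carrier L"
    "\<And>y. y \<in> carrier L \<Longrightarrow> (\<And>s. s \<in> S \<Longrightarrow> s \<sqsubseteq> x \<Longrightarrow> s \<sqsubseteq> y) \<Longrightarrow> x \<sqsubseteq> y"
  shows "\<exists>S'\<subseteq>S. x = \<Squnion>S'"
proof (intro exI conjI)
  let ?S = "{s \<in> S. s \<sqsubseteq> x}"
  have "?S \<subseteq> carrier L" using assms(1) by auto
  then show "x = \<Squnion>?S"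
    by (intro le_antisym sup_least assms(3)) (use assms in \<open>auto intro: sup_upper\<close>)
qed auto

lemma (in complete_lattice) is_meet_of_above:
  assumes "S \<subseteq> carrier L" "x \<in> carrier L"
    "\<And>y. y \<in> carrier L \<Longrightarrow> (\<And>s. s \<in> S \<Longrightarrow> x \<sqsubseteq> s \<Longrightarrow> y \<sqsubseteq> s) \<Longrightarrow> y \<sqsubseteq> x"
  shows "\<exists>S'\<subseteq>S. x = \<Sqinter>S'"
proof (intro exI conjI)
  let ?S = "{s \<in> S. x \<sqsubseteq> s}"
  have "?S \<subseteq> carrier L" using assms(1) by auto
  then show "x = \<Sqinter>?S"
    by (intro le_antisym inf_greatest assms(3)) (use assms in \<open>auto intro: inf_lower\<close>)
qed auto

lemma is_conlatI:
  assumes "complete_lattice (Lat L)" "iota L \<in> LInst L \<rightarrow>\<^sub>E carrier (Lat L)"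
    "tau L \<in> LTyp L \<rightarrow>\<^sub>E carrier (Lat L)"
    and "\<And>x y. \<lbrakk>x \<in> carrier (Lat L); y \<in> carrier (Lat L);
      \<And>a. a \<in> LInst L \<Longrightarrow> iota L a \<sqsubseteq>\<^bsub>Lat L\<^esub> x \<Longrightarrow> iota L a \<sqsubseteq>\<^bsub>Lat L\<^esub> y\<rbrakk> \<Longrightarrow> x \<sqsubseteq>\<^bsub>Lat L\<^esub> y"
    and "\<And>x y. \<lbrakk>x \<in> carrier (Lat L); y \<in> carrier (Lat L);
      \<And>\<alpha>. \<alpha> \<in> LTyp L \<Longrightarrow> y \<sqsubseteq>\<^bsub>Lat L\<^esub> tau L \<alpha> \<Longrightarrow> x \<sqsubseteq>\<^bsub>Lat L\<^esub> tau L \<alpha>\<rbrakk> \<Longrightarrow> x \<sqsubseteq>\<^bsub>Lat L\<^esub> y"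
  shows "is_conlat L"
  unfolding is_conlat_def
proof (intro conjI ballI assms(1-3))
  interpret complete_lattice "Lat L" by fact
  have "iota L ` LInst L \<subseteq> carrier (Lat L)" "tau L ` LTyp L \<subseteq> carrier (Lat L)"
    using assms(2,3) by auto
  note join = is_join_of_below[OF this(1)] and meet = is_meet_of_above[OF this(2)]
  fix x assume x: "x \<in> carrier (Lat L)"
  show "\<exists>S\<subseteq>iota L ` LInst L. x = \<Squnion>\<^bsub>Lat L\<^esub>S"
    by (rule join[OF x]) (rule assms(4)[OF x], simp_all)
  show "\<exists>S\<subseteq>tau L ` LTyp L. x = \<Sqinter>\<^bsub>Lat L\<^esub>S"
    by (rule meet[OF x]) (rule assms(5)[OF _ x], simp_all)
qed

text \<open>By \<open>iota_of_le_iff\<close> and \<open>le_tau_of_iff\<close> the two density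
  conditions say that concepts are ordered by inclusion of extents and by reversed inclusion of
  intents.\<close>

lemma is_conlat_L_obj: "is_conlat (L_obj A)"
proof (rule is_conlatI)
  fix x y assume xy: "x \<in> carrier (Lat (L_obj A))" "y \<in> carrier (Lat (L_obj A))"
  then have xy': "(fst x, snd x) \<in> concepts A" "(fst y, snd y) \<in> concepts A"
    by (auto simp: L_obj_def)
  {
    assume "\<And>a. a \<in> LInst (L_obj A) \<Longrightarrow>
      iota (L_obj A) a \<sqsubseteq>\<^bsub>Lat (L_obj A)\<^esub> x \<Longrightarrow> iota (L_obj A) a \<sqsubseteq>\<^bsub>Lat (L_obj A)\<^esub> y"
    then show "x \<sqsubseteq>\<^bsub>Lat (L_obj A)\<^esub> y"
      using xy conceptsD(1)[OF xy'(1)] by (auto simp: L_obj_def iota_of_le_iff)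
  next
    assume "\<And>\<alpha>. \<alpha> \<in> LTyp (L_obj A) \<Longrightarrow>
      y \<sqsubseteq>\<^bsub>Lat (L_obj A)\<^esub> tau (L_obj A) \<alpha> \<Longrightarrow> x \<sqsubseteq>\<^bsub>Lat (L_obj A)\<^esub> tau (L_obj A) \<alpha>"
    then show "x \<sqsubseteq>\<^bsub>Lat (L_obj A)\<^esub> y"
      using xy conceptsD(2)[OF xy'(2)] concept_le_iff[OF xy'] by (auto simp: L_obj_def le_tau_of_iff)
  }
qed (simp_all add: L_obj_def iota_of_mem tau_of_mem)

definition concept_at :: "('l, 'i, 't) conlat \<Rightarrow> 'l \<Rightarrow> ('i, 't) concept" where
  "concept_at L x =
     ({a \<in> LInst L. iota L a \<sqsubseteq>\<^bsub>Lat L\<^esub> x}, {\<alpha> \<in> LTyp L. x \<sqsubseteq>\<^bsub>Lat L\<^esub> tau L \<alpha>})"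

lemma C_obj_simps [simp]:
  "Inst (C_obj L) = LInst L" "Typ (C_obj L) = LTyp L"
  "(a, \<alpha>) \<in> Sat (C_obj L) \<longleftrightarrow> a \<in> LInst L \<and> \<alpha> \<in> LTyp L \<and> iota L a \<sqsubseteq>\<^bsub>Lat L\<^esub> tau L \<alpha>"
  by (auto simp: C_obj_def)

text \<open>Meet density makes the first component the extent of the second; join density makes the
  second the intent of the first.\<close>

lemma concept_at_mem:
  assumes L: "is_conlat L" and x: "x \<in> carrier (Lat L)"
  shows "concept_at L x \<in> concepts (C_obj L)"
proof -
  let ?X = "{a \<in> LInst L. iota L a \<sqsubseteq>\<^bsub>Lat L\<^esub> x}"
    and ?\<Gamma> = "{\<alpha> \<in> LTyp L. x \<sqsubseteq>\<^bsub>Lat L\<^esub> tau L \<alpha>}"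
  have "iota L a \<sqsubseteq>\<^bsub>Lat L\<^esub> x \<longleftrightarrow>
      (\<forall>\<alpha>\<in>LTyp L. x \<sqsubseteq>\<^bsub>Lat L\<^esub> tau L \<alpha> \<longrightarrow> iota L a \<sqsubseteq>\<^bsub>Lat L\<^esub> tau L \<alpha>)" if "a \<in> LInst L" for a
    by (rule conlat_le_iff_tau[OF L is_conlatD(4)[OF L that] x])
  then have e: "extent_of (C_obj L) ?\<Gamma> = ?X"
    by (auto simp: inst_deriv_def)
  have "x \<sqsubseteq>\<^bsub>Lat L\<^esub> tau L \<alpha> \<longleftrightarrow>
      (\<forall>a\<in>LInst L. iota L a \<sqsubseteq>\<^bsub>Lat L\<^esub> x \<longrightarrow> iota L a \<sqsubseteq>\<^bsub>Lat L\<^esub> tau L \<alpha>)" if "\<alpha> \<in> LTyp L" for \<alpha>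
    by (rule conlat_le_iff_iota[OF L x is_conlatD(5)[OF L that]])
  then have i: "intent_of (C_obj L) ?X = ?\<Gamma>"
    by (auto simp: typ_deriv_def)
  have "(extent_of (C_obj L) (intent_of (C_obj L) ?X), intent_of (C_obj L) ?X) \<in> concepts (C_obj L)"
    by (intro concept_of_intent is_intent_intent_of) auto
  then show ?thesis unfolding i e concept_at_def .
qed

text \<open>The representation part of the basic theorem on concept lattices: density gives an order
  embedding, completeness gives surjectivity.\<close>

lemma order_iso_concept_at:
  assumes L: "is_conlat L"
  shows "order_iso (Lat L) (lattice_of (C_obj L)) (concept_at L)"
proof -
  interpret complete_lattice "Lat L" using L by (rule is_conlatD)
  have le: "fst (concept_at L x) \<subseteq> fst (concept_at L y) \<longleftrightarrow> x \<sqsubseteq>\<^bsub>Lat L\<^esub> y"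
    if "x \<in> carrier (Lat L)" "y \<in> carrier (Lat L)" for x y
    using that by (subst conlat_le_iff_iota[OF L]) (auto simp: concept_at_def)
  then have "inj_on (concept_at L) (carrier (Lat L))"
    by (intro inj_onI) (metis le_antisym order_refl)
  moreover have "c \<in> concept_at L ` carrier (Lat L)" if c: "c \<in> concepts (C_obj L)" for c
  proof
    define X \<Gamma> where "X = fst c" and "\<Gamma> = snd c"
    then have c_eq: "c = (X, \<Gamma>)" by simp
    note D = conceptsD[OF c[unfolded c_eq]]
    \<comment> \<open>The preimage of c is generated by the instances of its extent:
      \<open>tau L \<alpha>\<close> is above this join iff \<alpha> belongs to the intent of
      c.\<close>
    let ?p = "\<Squnion>\<^bsub>Lat L\<^esub>(iota L ` X)"
    have S: "iota L ` X \<subseteq> carrier (Lat L)"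
      using D(1) is_conlatD(4)[OF L] by auto
    then show p: "?p \<in> carrier (Lat L)" by simp
    have "?p \<sqsubseteq>\<^bsub>Lat L\<^esub> tau L \<alpha> \<longleftrightarrow> (\<forall>a\<in>X. iota L a \<sqsubseteq>\<^bsub>Lat L\<^esub> tau L \<alpha>)" if "\<alpha> \<in> LTyp L" for \<alpha>
    proof
      assume "?p \<sqsubseteq>\<^bsub>Lat L\<^esub> tau L \<alpha>"
      then show "\<forall>a\<in>X. iota L a \<sqsubseteq>\<^bsub>Lat L\<^esub> tau L \<alpha>"
        using S p is_conlatD(5)[OF L that] sup_upper[OF S] by (meson image_eqI le_trans subsetD)
    next
      assume "\<forall>a\<in>X. iota L a \<sqsubseteq>\<^bsub>Lat L\<^esub> tau L \<alpha>"
      then show "?p \<sqsubseteq>\<^bsub>Lat L\<^esub> tau L \<alpha>"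
        using S is_conlatD(5)[OF L that] by (intro sup_least) auto
    qed
    then have "snd (concept_at L ?p) = intent_of (C_obj L) X"
      using D(1) by (auto simp: concept_at_def typ_deriv_def)
    then show "c = concept_at L ?p"
      using c concept_at_mem[OF L p] D(4) by (intro concept_eqI') (auto simp: c_eq)
  qed
  ultimately show ?thesis
    using concept_at_mem[OF L] le
    by (auto simp: order_iso_def bij_betw_def partial_order_axioms)
qed

section \<open>Bonds\<close>

lemma bondsD:
  assumes "F \<in> bonds A B"
  shows "F \<subseteq> Inst B \<times> Typ A"
    "\<And>b. b \<in> Inst B \<Longrightarrow> is_intent A {\<alpha>. (b, \<alpha>) \<in> F}"
    "\<And>\<alpha>. \<alpha> \<in> Typ A \<Longrightarrow> is_extent B {b. (b, \<alpha>) \<in> F}"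
  using assms by (auto simp: bonds_def)

text \<open>Deriving \<Gamma> along F intersects columns of F, and these are extents of B.\<close>

lemma bond_inst_deriv_extent:
  assumes "F \<in> bonds A B" "\<Gamma> \<subseteq> Typ A"
  shows "is_extent B (inst_deriv (Inst B) F \<Gamma>)"
proof -
  have "inst_deriv (Inst B) F \<Gamma> = Inst B \<inter> \<Inter>((\<lambda>\<alpha>. {b. (b, \<alpha>) \<in> F}) ` \<Gamma>)"
    by (auto simp: inst_deriv_def)
  then show ?thesis
    using is_extent_Inter[of "(\<lambda>\<alpha>. {b. (b, \<alpha>) \<in> F}) ` \<Gamma>" B] bondsD(3)[OF assms(1)] assms(2) by auto
qed

lemma bond_typ_deriv_intent:
  assumes "F \<in> bonds A B" "Y \<subseteq> Inst B"
  shows "is_intent A (typ_deriv (Typ A) F Y)"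
proof -
  have "typ_deriv (Typ A) F Y = Typ A \<inter> \<Inter>((\<lambda>b. {\<alpha>. (b, \<alpha>) \<in> F}) ` Y)"
    by (auto simp: typ_deriv_def)
  then show ?thesis
    using is_intent_Inter[of "(\<lambda>b. {\<alpha>. (b, \<alpha>) \<in> F}) ` Y" A] bondsD(2)[OF assms(1)] assms(2) by auto
qed

lemma bond_psi_mem:
  assumes "F \<in> bonds A B"
  shows "bond_psi A B F \<in> concepts A \<rightarrow>\<^sub>E concepts B"
  unfolding bond_psi_def
  by (rule restrict_PiE_iff[THEN iffD2])
     (use assms in \<open>auto intro!: concept_of_extent bond_inst_deriv_extent dest: conceptsD(2)\<close>)

lemma bond_phi_mem:
  assumes "F \<in> bonds A B"
  shows "bond_phi A B F \<in> concepts B \<rightarrow>\<^sub>E concepts A"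
  unfolding bond_phi_def
  by (rule restrict_PiE_iff[THEN iffD2])
     (use assms in \<open>auto intro!: concept_of_intent bond_typ_deriv_intent dest: conceptsD(1)\<close>)

abbreviation bond_adj ::
    "('i, 't) classification \<Rightarrow> ('j, 's) classification \<Rightarrow> ('j \<times> 't) set \<Rightarrow>
     (('j, 's) concept \<Rightarrow> ('i, 't) concept) \<times> (('i, 't) concept \<Rightarrow> ('j, 's) concept)" where
  "bond_adj A B F \<equiv> (bond_phi A B F, bond_psi A B F)"

text \<open>Both inequalities say that every member of Y is F-related to every member of
  \<Gamma>.\<close>

lemma bond_adj_mem:
  assumes F: "F \<in> bonds A B"
  shows "bond_adj A B F \<in> adjoint_pairs (lattice_of A) (lattice_of B)"
proof (rule adjoint_pairsI)
  fix p q assume "p \<in> carrier (lattice_of A)" "q \<in> carrier (lattice_of B)"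
  moreover obtain X \<Gamma> Y \<Delta> where pq_eq: "p = (X, \<Gamma>)" "q = (Y, \<Delta>)" by (cases p, cases q)
  ultimately have p: "(X, \<Gamma>) \<in> concepts A" and q: "(Y, \<Delta>) \<in> concepts B" by auto
  note Y = conceptsD(1)[OF q] and \<Gamma> = conceptsD(2)[OF p]
  show "bond_phi A B F q \<sqsubseteq>\<^bsub>lattice_of A\<^esub> p \<longleftrightarrow> q \<sqsubseteq>\<^bsub>lattice_of B\<^esub> bond_psi A B F p"
    using concept_le_iff[OF concept_of_intent[OF bond_typ_deriv_intent[OF F Y]] p]
      subset_deriv_iff[OF \<Gamma> Y, of F] p q
    by (simp add: pq_eq bond_phi_def bond_psi_def)
qed (simp_all add: bond_psi_mem[OF F] bond_phi_mem[OF F])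

lemma snd_tau_subset_iff:
  assumes "\<alpha> \<in> Typ A" "is_intent A \<Delta>"
  shows "snd (tau_of A \<alpha>) \<subseteq> \<Delta> \<longleftrightarrow> \<alpha> \<in> \<Delta>"
  using le_tau_of_iff[OF assms(1) concept_of_intent[OF assms(2)]] PiE_mem[OF tau_of_mem assms(1)]
    concept_le_iff[OF concept_of_intent[OF assms(2)], of "fst (tau_of A \<alpha>)" "snd (tau_of A \<alpha>)"]
  by simp

text \<open>The intent of \<open>tau_of A \<alpha>\<close> is the closure of {\<alpha>}. Rows of F
  are intents, so a row contains this closure iff it contains \<alpha>.\<close>

lemma bond_psi_tau:
  assumes F: "F \<in> bonds A B" and \<alpha>: "\<alpha> \<in> Typ A"
  shows "fst (bond_psi A B F (tau_of A \<alpha>)) = {b. (b, \<alpha>) \<in> F}"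
proof -
  have tau: "tau_of A \<alpha> \<in> concepts A" using tau_of_mem \<alpha> by (rule PiE_mem)
  have "fst (bond_psi A B F (tau_of A \<alpha>)) = inst_deriv (Inst B) F (snd (tau_of A \<alpha>))"
    using tau by (simp add: bond_psi_def case_prod_beta)
  also have "\<dots> = {b \<in> Inst B. snd (tau_of A \<alpha>) \<subseteq> {\<alpha>. (b, \<alpha>) \<in> F}}"
    by (auto simp: inst_deriv_def)
  also have "\<dots> = {b. (b, \<alpha>) \<in> F}"
    using snd_tau_subset_iff[OF \<alpha>] bondsD[OF F] by auto
  finally show ?thesis .
qed

lemma bond_psi_inj:
  assumes "F \<in> bonds A B" "G \<in> bonds A B" "bond_psi A B F = bond_psi A B G"
  shows "F = G"
proof -
  have "(b, \<alpha>) \<in> F \<longleftrightarrow> (b, \<alpha>) \<in> G" for b \<alpha>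
    using bond_psi_tau[OF assms(1), of \<alpha>] bond_psi_tau[OF assms(2), of \<alpha>] assms(3)
      bondsD(1)[OF assms(1)] bondsD(1)[OF assms(2)] by auto
  then show ?thesis by auto
qed

text \<open>The relation is read off \<psi> by columns, and the adjunction reads the same relation
  off \<phi> by rows; this yields both closure conditions of a bond.\<close>

lemma bond_adj_surj:
  assumes m: "(\<phi>, \<psi>) \<in> adjoint_pairs (lattice_of A) (lattice_of B)"
  shows "\<exists>F\<in>bonds A B. bond_adj A B F = (\<phi>, \<psi>)"
proof -
  note D = adjoint_pairsD[OF m, simplified]
  have tau: "tau_of A \<alpha> \<in> concepts A" if "\<alpha> \<in> Typ A" for \<alpha>
    using tau_of_mem that by (rule PiE_mem)
  have iota: "iota_of B b \<in> concepts B" if "b \<in> Inst B" for b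
    using iota_of_mem that by (rule PiE_mem)
  define F where "F = {(b, \<alpha>). b \<in> Inst B \<and> \<alpha> \<in> Typ A \<and> b \<in> fst (\<psi> (tau_of A \<alpha>))}"
  \<comment> \<open>Membership of b in the extent of \<open>\<psi> (tau_of A \<alpha>)\<close> means
    that \<open>iota_of B b\<close> is below it; the adjunction moves this to
    \<open>\<phi> (iota_of B b)\<close> below \<open>tau_of A \<alpha>\<close>.\<close>
  have F_iff: "(b, \<alpha>) \<in> F \<longleftrightarrow> \<alpha> \<in> snd (\<phi> (iota_of B b))" if "b \<in> Inst B" "\<alpha> \<in> Typ A" for b \<alpha>
    using that D(3)[OF tau[OF that(2)] iota[OF that(1)]] D(5)[OF tau[OF that(2)]]
      D(4)[OF iota[OF that(1)]]
    by (simp add: F_def iota_of_le_iff le_tau_of_iff)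
  have F: "F \<in> bonds A B"
    unfolding bonds_def
  proof (intro CollectI conjI ballI)
    fix b assume b: "b \<in> Inst B"
    then have c: "(fst (\<phi> (iota_of B b)), snd (\<phi> (iota_of B b))) \<in> concepts A"
      using D(4) iota by simp
    have "{\<alpha>. (b, \<alpha>) \<in> F} = snd (\<phi> (iota_of B b))"
      using F_iff[OF b] conceptsD(2)[OF c] by (auto simp: F_def)
    then show "is_intent A {\<alpha>. (b, \<alpha>) \<in> F}"
      using conceptsD(6)[OF c] by simp
  next
    fix \<alpha> assume \<alpha>: "\<alpha> \<in> Typ A"
    then have c: "(fst (\<psi> (tau_of A \<alpha>)), snd (\<psi> (tau_of A \<alpha>))) \<in> concepts B"
      using D(5) tau by simp
    have "{b. (b, \<alpha>) \<in> F} = fst (\<psi> (tau_of A \<alpha>))"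
      using conceptsD(1)[OF c] \<alpha> by (auto simp: F_def)
    then show "is_extent B {b. (b, \<alpha>) \<in> F}"
      using conceptsD(5)[OF c] by simp
  qed (auto simp: F_def)
  have "bond_psi A B F c = \<psi> c" if c: "c \<in> concepts A" for c
  proof (rule concept_eqI)
    show "bond_psi A B F c \<in> concepts B" using bond_psi_mem[OF F] c by (rule PiE_mem)
    show "\<psi> c \<in> concepts B" using D(5) c .
    have c': "(fst c, snd c) \<in> concepts A" using c by simp
    have "b \<in> fst (bond_psi A B F c) \<longleftrightarrow> b \<in> fst (\<psi> c)" if b: "b \<in> Inst B" for b
    proof -
      have c2: "(fst (\<phi> (iota_of B b)), snd (\<phi> (iota_of B b))) \<in> concepts A"
        using D(4) iota b by simp
      have "b \<in> fst (bond_psi A B F c) \<longleftrightarrow> (\<forall>\<alpha>\<in>snd c. (b, \<alpha>) \<in> F)"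
        using c b by (simp add: bond_psi_def case_prod_beta inst_deriv_def)
      also have "\<dots> \<longleftrightarrow> snd c \<subseteq> snd (\<phi> (iota_of B b))"
        using F_iff[OF b] conceptsD(2)[OF c'] by blast
      also have "\<dots> \<longleftrightarrow> fst (iota_of B b) \<subseteq> fst (\<psi> c)"
        using concept_le_iff[OF c2 c'] D(3)[OF c iota[OF b]] by simp
      also have "\<dots> \<longleftrightarrow> b \<in> fst (\<psi> c)"
        using iota_of_le_iff[OF b D(5)[OF c]] .
      finally show ?thesis .
    qed
    moreover have "fst (bond_psi A B F c) \<subseteq> Inst B" "fst (\<psi> c) \<subseteq> Inst B"
      using conceptsD(1)[of "fst (\<psi> c)" "snd (\<psi> c)" B] D(5)[OF c] c
      by (auto simp: bond_psi_def case_prod_beta inst_deriv_def)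
    ultimately show "fst (bond_psi A B F c) = fst (\<psi> c)" by auto
  qed
  then have "bond_psi A B F = \<psi>"
    by (rule extensional_eqI[OF bond_psi_mem[OF F] D(2)])
  then show ?thesis
    using left_adjoint_unique[OF _ bond_adj_mem[OF F]] m F by auto
qed

section \<open>Identities and composition of bonds, and functoriality of the passage to concept
  lattices\<close>

lemma bond_id_mem: "is_classification A \<Longrightarrow> bond_id A \<in> bonds A A"
proof -
  assume A: "is_classification A"
  then have "{\<alpha>. (b, \<alpha>) \<in> Sat A} = intent_of A {b}" "{b. (b, \<alpha>) \<in> Sat A} = extent_of A {\<alpha>}" for b \<alpha>
    by (auto simp: is_classification_def typ_deriv_def inst_deriv_def)
  then show ?thesis
    using A is_extent_extent_of[of "{_}" A] is_intent_intent_of[of "{_}" A]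
    by (auto simp: bonds_def bond_id_def is_classification_def)
qed

lemma bond_adj_id: "bond_adj A A (bond_id A) = adj_id (lattice_of A)"
  by (auto simp: bond_phi_def bond_psi_def bond_id_def adj_id_def conceptsD cong: restrict_cong
      intro!: restrict_ext)

text \<open>A row of the composite is the derivation along F of the extent of a row of G, hence an
  intent of A.\<close>

lemma bond_comp_mem:
  assumes F: "F \<in> bonds A B" and G: "G \<in> bonds B C"
  shows "bond_comp A B C F G \<in> bonds A C"
  unfolding bonds_def
proof (intro CollectI conjI ballI)
  fix c assume c: "c \<in> Inst C"
  have "{\<alpha>. (c, \<alpha>) \<in> bond_comp A B C F G} = typ_deriv (Typ A) F (extent_of B {\<beta>. (c, \<beta>) \<in> G})"
    using c by (auto simp: bond_comp_def typ_deriv_def)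
  then show "is_intent A {\<alpha>. (c, \<alpha>) \<in> bond_comp A B C F G}"
    by (simp add: bond_typ_deriv_intent[OF F] deriv_subset)
next
  fix \<alpha> assume \<alpha>: "\<alpha> \<in> Typ A"
  \<comment> \<open>Rows of G and columns of F complete to concepts of B, so the inclusion can be
    read on intents. This exhibits a column of the composite as a derivation along G.\<close>
  have "extent_of B {\<beta>. (c, \<beta>) \<in> G} \<subseteq> {b. (b, \<alpha>) \<in> F} \<longleftrightarrow>
      intent_of B {b. (b, \<alpha>) \<in> F} \<subseteq> {\<beta>. (c, \<beta>) \<in> G}" if "c \<in> Inst C" for c
    by (rule concept_le_iff[OF concept_of_intent[OF bondsD(2)[OF G that]]
          concept_of_extent[OF bondsD(3)[OF F \<alpha>]]])
  then have "{c. (c, \<alpha>) \<in> bond_comp A B C F G} = inst_deriv (Inst C) G (intent_of B {b. (b, \<alpha>) \<in> F})"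
    using \<alpha> by (auto simp: bond_comp_def inst_deriv_def)
  then show "is_extent C {c. (c, \<alpha>) \<in> bond_comp A B C F G}"
    by (simp add: bond_inst_deriv_extent[OF G] deriv_subset)
qed (auto simp: bond_comp_def)

text \<open>An instance d is related to all of \<Gamma> by the composite iff the extent of its row
  in G lies in \<open>?Y\<close>, iff the intent of \<open>?Y\<close> lies in that row. So one
  derives along F, passes to the intent and derives along G.\<close>

lemma bond_psi_comp:
  assumes F: "F \<in> bonds A B" and G: "G \<in> bonds B C"
  shows "bond_psi A C (bond_comp A B C F G) = compose (concepts A) (bond_psi B C G) (bond_psi A B F)"
proof (rule extensional_eqI[OF bond_psi_mem[OF bond_comp_mem[OF F G]]
      compose_mem[OF bond_psi_mem[OF F] bond_psi_mem[OF G]]])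
  fix c assume c: "c \<in> concepts A"
  define \<Gamma> where "\<Gamma> = snd c"
  have \<Gamma>: "\<Gamma> \<subseteq> Typ A" using conceptsD(2)[of "fst c" "snd c" A] c by (simp add: \<Gamma>_def)
  let ?Y = "inst_deriv (Inst B) F \<Gamma>"
  note Y = concept_of_extent[OF bond_inst_deriv_extent[OF F \<Gamma>]]
  have "(\<forall>\<alpha>\<in>\<Gamma>. (d, \<alpha>) \<in> bond_comp A B C F G) \<longleftrightarrow> (\<forall>\<beta>\<in>intent_of B ?Y. (d, \<beta>) \<in> G)"
    if d: "d \<in> Inst C" for d
  proof -
    have "(\<forall>\<alpha>\<in>\<Gamma>. (d, \<alpha>) \<in> bond_comp A B C F G) \<longleftrightarrow> extent_of B {\<beta>. (d, \<beta>) \<in> G} \<subseteq> ?Y"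
      using d \<Gamma> by (auto simp: bond_comp_def inst_deriv_def)
    also have "\<dots> \<longleftrightarrow> intent_of B ?Y \<subseteq> {\<beta>. (d, \<beta>) \<in> G}"
      by (rule concept_le_iff[OF concept_of_intent[OF bondsD(2)[OF G d]] Y])
    finally show ?thesis by auto
  qed
  then have "inst_deriv (Inst C) (bond_comp A B C F G) \<Gamma> = inst_deriv (Inst C) G (intent_of B ?Y)"
    by (auto simp: inst_deriv_def)
  then show "bond_psi A C (bond_comp A B C F G) c = compose (concepts A) (bond_psi B C G) (bond_psi A B F) c"
    using c Y by (simp add: bond_psi_def compose_eq case_prod_beta \<Gamma>_def)
qed

text \<open>Both sides are adjoint pairs with the same right adjoint.\<close>

lemma bond_adj_comp:
  assumes F: "F \<in> bonds A B" and G: "G \<in> bonds B C"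
  shows "bond_adj A C (bond_comp A B C F G) =
    adj_comp (lattice_of A) (lattice_of B) (lattice_of C) (bond_adj A B F) (bond_adj B C G)"
  using adj_comp_mem[OF _ _ bond_adj_mem[OF F] bond_adj_mem[OF G]]
    bond_adj_mem[OF bond_comp_mem[OF F G]]
  by (auto simp: adj_comp_def bond_psi_comp[OF F G] intro: left_adjoint_unique)

lemma bond_adj_inj:
  "\<lbrakk>F \<in> bonds A B; G \<in> bonds A B; bond_adj A B F = bond_adj A B G\<rbrakk> \<Longrightarrow> F = G"
  using bond_psi_inj by blast

lemma bond_comp_id:
  assumes F: "F \<in> bonds A B"
  shows "is_classification A \<Longrightarrow> bond_comp A A B (bond_id A) F = F"
    "is_classification B \<Longrightarrow> bond_comp A B B F (bond_id B) = F"
  by (rule bond_adj_inj[OF _ F];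
      simp only: bond_adj_comp[OF bond_id_mem F] bond_adj_comp[OF F bond_id_mem] bond_adj_id
        adj_comp_id[OF bond_adj_mem[OF F]] bond_comp_mem[OF F bond_id_mem] bond_comp_mem[OF bond_id_mem F])+

lemma bond_comp_assoc:
  assumes "F \<in> bonds A B" "G \<in> bonds B C" "H \<in> bonds C D"
  shows "bond_comp A C D (bond_comp A B C F G) H = bond_comp A B D F (bond_comp B C D G H)"
  by (rule bond_adj_inj[of _ A D])
     (simp_all only: assms bond_comp_mem bond_adj_comp bond_adj_mem
        adj_comp_assoc[OF assms[THEN bond_adj_mem]])

lemma category_Bond: "category Bond"
  unfolding category_def Bond_def
  by (auto simp: bond_id_mem bond_comp_mem bond_comp_id bond_comp_assoc)

lemma is_functor_A: "is_functor Bond CompleteAdjoint A_functor"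
  unfolding is_functor_def Bond_def CompleteAdjoint_def A_functor_def
  by (simp add: bond_adj_mem bond_adj_id) (simp add: bond_adj_comp)

text \<open>Since \<open>bond_adj\<close> is full and faithful, it reflects isomorphisms.\<close>

lemma bond_iso_lift:
  assumes A: "is_classification A" and B: "is_classification B"
    and e: "adj_iso (lattice_of A) (lattice_of B) e"
  shows "\<exists>F\<in>bonds A B. bond_adj A B F = e \<and> bond_iso A B F"
proof -
  obtain e' where e': "e' \<in> adjoint_pairs (lattice_of B) (lattice_of A)"
    "adj_comp (lattice_of A) (lattice_of B) (lattice_of A) e e' = adj_id (lattice_of A)"
    "adj_comp (lattice_of B) (lattice_of A) (lattice_of B) e' e = adj_id (lattice_of B)"
    and "e \<in> adjoint_pairs (lattice_of A) (lattice_of B)"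
    using e unfolding het_isomorphism_def by blast
  then obtain F G where F: "F \<in> bonds A B" "bond_adj A B F = e"
    and G: "G \<in> bonds B A" "bond_adj B A G = e'"
    using bond_adj_surj by (metis surj_pair)
  have "bond_comp A B A F G = bond_id A"
    by (rule bond_adj_inj[OF bond_comp_mem[OF F(1) G(1)] bond_id_mem[OF A]])
       (simp only: bond_adj_comp[OF F(1) G(1)] F G e' bond_adj_id)
  moreover have "bond_comp B A B G F = bond_id B"
    by (rule bond_adj_inj[OF bond_comp_mem[OF G(1) F(1)] bond_id_mem[OF B]])
       (simp only: bond_adj_comp[OF G(1) F(1)] F G e' bond_adj_id)
  ultimately show ?thesis
    using F G(1) unfolding het_isomorphism_def by blast
qed

section \<open>Bonding pairs\<close>

text \<open>At a concept (X, \<Gamma>) both maps return an extent paired with an intent; the two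
  equations in the definition are the equalities of the components.\<close>

lemma bonding_pairs_iff:
  "(F, G) \<in> bonding_pairs A B \<longleftrightarrow>
    F \<in> bonds A B \<and> G \<in> bonds B A \<and> bond_psi A B F = bond_phi B A G"
proof -
  have "bond_psi A B F = bond_phi B A G \<longleftrightarrow>
    (\<forall>(X, \<Gamma>)\<in>concepts A.
        inst_deriv (Inst B) F \<Gamma> = extent_of B (typ_deriv (Typ B) G X) \<and>
        typ_deriv (Typ B) G X = intent_of B (inst_deriv (Inst B) F \<Gamma>))"
    (is "?l = ?r")
  proof
    assume ?l
    show ?r
    proof clarify
      fix X \<Gamma> assume "(X, \<Gamma>) \<in> concepts A"
      then show "inst_deriv (Inst B) F \<Gamma> = extent_of B (typ_deriv (Typ B) G X) \<and>
        typ_deriv (Typ B) G X = intent_of B (inst_deriv (Inst B) F \<Gamma>)"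
        using fun_cong[OF \<open>?l\<close>, of "(X, \<Gamma>)"]
        unfolding bond_psi_def bond_phi_def by (metis (no_types, lifting) prod.case prod.inject restrict_apply')
    qed
  next
    assume r: ?r
    show ?l
      unfolding bond_psi_def bond_phi_def
    proof (rule restrict_ext)
      fix c assume c: "c \<in> concepts A"
      obtain X \<Gamma> where c_eq: "c = (X, \<Gamma>)" by (cases c)
      have "inst_deriv (Inst B) F \<Gamma> = extent_of B (typ_deriv (Typ B) G X) \<and>
          typ_deriv (Typ B) G X = intent_of B (inst_deriv (Inst B) F \<Gamma>)"
        using bspec[OF r c] unfolding c_eq prod.case .
      then show "(case c of (X, \<Gamma>) \<Rightarrow> (inst_deriv (Inst B) F \<Gamma>, intent_of B (inst_deriv (Inst B) F \<Gamma>))) =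
          (case c of (Y, \<Delta>) \<Rightarrow> (extent_of B (typ_deriv (Typ B) G Y), typ_deriv (Typ B) G Y))"
        unfolding c_eq prod.case prod.inject by metis
    qed
  qed
  then show ?thesis by (simp only: bonding_pairs_def mem_Collect_eq prod.case)
qed

lemma bp_id_mem:
  assumes "is_classification A"
  shows "bp_id A \<in> bonding_pairs A A"
  using bond_id_mem[OF assms] bond_adj_id[of A]
  by (simp add: bp_id_def bond_id_def bonding_pairs_iff adj_id_def)

text \<open>The right adjoint for F followed by M is \<open>bond_psi B C M\<close> after
  \<open>bond_psi A B F\<close>. This equals \<open>bond_phi C B N\<close> after
  \<open>bond_phi B A G\<close>, the left adjoint for N followed by G; hence the second components
  compose backwards.\<close>

lemma bp_comp_mem:
  assumes "m \<in> bonding_pairs A B" "n \<in> bonding_pairs B C"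
  shows "bp_comp A B C m n \<in> bonding_pairs A C"
proof -
  obtain F G M N where mn: "m = (F, G)" "n = (M, N)" by (cases m, cases n)
  note D = assms[unfolded mn bonding_pairs_iff]
  show ?thesis
    using D bond_adj_comp[of N C B G A] bond_psi_comp[of F A B M C]
    by (auto simp: mn bp_comp_def bonding_pairs_iff bond_comp_mem adj_comp_def)
qed

lemma bp_comp_id:
  assumes "m \<in> bonding_pairs A B" "is_classification A" "is_classification B"
  shows "bp_comp A A B (bp_id A) m = m" "bp_comp A B B m (bp_id B) = m"
  using assms bond_comp_id[of "fst m" A B] bond_comp_id[of "snd m" B A]
  by (cases m; simp add: bp_comp_def bp_id_def bond_id_def bonding_pairs_iff)+

lemma bp_comp_assoc:
  assumes "m \<in> bonding_pairs A B" "n \<in> bonding_pairs B C" "r \<in> bonding_pairs C D"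
  shows "bp_comp A C D (bp_comp A B C m n) r = bp_comp A B D m (bp_comp B C D n r)"
  using assms by (cases m; cases n; cases r) (simp add: bp_comp_def bonding_pairs_iff bond_comp_assoc)

lemma category_BondingPair: "category BondingPair"
  unfolding category_def BondingPair_def
  by (auto simp: bp_id_mem bp_comp_mem bp_comp_id bp_comp_assoc)

abbreviation bp_hom ::
    "('i, 't) classification \<Rightarrow> ('j, 's) classification \<Rightarrow> ('j \<times> 't) set \<times> ('i \<times> 's) set \<Rightarrow>
     ('i, 't) concept \<Rightarrow> ('j, 's) concept" where
  "bp_hom A B m \<equiv> bond_psi A B (fst m)"

lemma bp_hom_mem:
  assumes "m \<in> bonding_pairs A B"
  shows "bp_hom A B m \<in> complete_homs (lattice_of A) (lattice_of B)"
  using assms bond_adj_mem[of "fst m" A B] bond_adj_mem[of "snd m" B A]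
  by (cases m) (auto simp: bonding_pairs_iff complete_homs_iff_adjoints)

lemma bp_hom_id: "bp_hom A A (bp_id A) = lat_id (lattice_of A)"
  using bond_adj_id[of A] by (simp add: bp_id_def bond_id_def lat_id_def adj_id_def)

lemma bp_hom_comp:
  assumes "m \<in> bonding_pairs A B" "n \<in> bonding_pairs B C"
  shows "bp_hom A C (bp_comp A B C m n) =
    lat_comp (lattice_of A) (lattice_of B) (lattice_of C) (bp_hom A B m) (bp_hom B C n)"
  using assms
  by (cases m; cases n) (simp add: bp_comp_def lat_comp_def bonding_pairs_iff bond_psi_comp)

text \<open>The map determines F as its right adjoint. It is also the left adjoint for G, so it
  determines the right adjoint for G and thereby G.\<close>

lemma bp_hom_inj:
  assumes "m \<in> bonding_pairs A B" "n \<in> bonding_pairs A B" "bp_hom A B m = bp_hom A B n"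
  shows "m = n"
proof -
  obtain F G M N where mn: "m = (F, G)" "n = (M, N)" by (cases m, cases n)
  note D = assms[unfolded mn bonding_pairs_iff fst_conv]
  have "bond_psi B A G = bond_psi B A N"
    using right_adjoint_unique[OF _ bond_adj_mem[of G B A], of "bond_psi B A N"]
      bond_adj_mem[of N B A] D by auto
  then show ?thesis using D bond_psi_inj[of F A B M] bond_psi_inj[of G B A N] by (simp add: mn)
qed

text \<open>The left adjoint of \<psi> yields F and the right adjoint yields G; sharing \<psi> is
  the condition on bonding pairs.\<close>

lemma bp_hom_surj:
  assumes "\<psi> \<in> complete_homs (lattice_of A) (lattice_of B)"
  shows "\<exists>m\<in>bonding_pairs A B. bp_hom A B m = \<psi>"
proof -
  obtain \<phi> \<theta> where "(\<phi>, \<psi>) \<in> adjoint_pairs (lattice_of A) (lattice_of B)"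
    "(\<psi>, \<theta>) \<in> adjoint_pairs (lattice_of B) (lattice_of A)"
    using assms by (rule complete_homE) auto
  then obtain F G where "F \<in> bonds A B" "bond_adj A B F = (\<phi>, \<psi>)"
    "G \<in> bonds B A" "bond_adj B A G = (\<psi>, \<theta>)"
    using bond_adj_surj by metis
  then show ?thesis
    by (intro bexI[of _ "(F, G)"]) (auto simp: bonding_pairs_iff)
qed

lemma is_functor_A2: "is_functor BondingPair CompleteLattice A2_functor"
  unfolding is_functor_def BondingPair_def CompleteLattice_def A2_functor_def
  by (simp add: case_prod_beta bp_hom_mem bp_hom_id) (simp add: bp_hom_comp)

text \<open>\<open>bp_hom\<close> is full and faithful, so it reflects isomorphisms as
  \<open>bond_adj\<close> does.\<close>

lemma bp_iso_lift:
  assumes A: "is_classification A" and B: "is_classification B"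
    and e: "lat_iso (lattice_of A) (lattice_of B) e"
  shows "\<exists>m\<in>bonding_pairs A B. bp_hom A B m = e \<and> bp_iso A B m"
proof -
  obtain e' where e': "e' \<in> complete_homs (lattice_of B) (lattice_of A)"
    "lat_comp (lattice_of A) (lattice_of B) (lattice_of A) e e' = lat_id (lattice_of A)"
    "lat_comp (lattice_of B) (lattice_of A) (lattice_of B) e' e = lat_id (lattice_of B)"
    and "e \<in> complete_homs (lattice_of A) (lattice_of B)"
    using e unfolding het_isomorphism_def by blast
  then obtain m n where m: "m \<in> bonding_pairs A B" "bp_hom A B m = e"
    and n: "n \<in> bonding_pairs B A" "bp_hom B A n = e'"
    using bp_hom_surj by metis
  have "bp_comp A B A m n = bp_id A"
    by (rule bp_hom_inj[OF bp_comp_mem[OF m(1) n(1)] bp_id_mem[OF A]])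
       (simp only: bp_hom_comp[OF m(1) n(1)] m n e' bp_hom_id)
  moreover have "bp_comp B A B n m = bp_id B"
    by (rule bp_hom_inj[OF bp_comp_mem[OF n(1) m(1)] bp_id_mem[OF B]])
       (simp only: bp_hom_comp[OF n(1) m(1)] m n e' bp_hom_id)
  ultimately show ?thesis
    using m n(1) unfolding het_isomorphism_def by blast
qed

section \<open>Complete lattices as classifications\<close>

definition self_conlat :: "'l gorder \<Rightarrow> ('l, 'l, 'l) conlat" where
  "self_conlat L = \<lparr>Lat = L, LInst = carrier L, LTyp = carrier L,
     iota = (\<lambda>x\<in>carrier L. x), tau = (\<lambda>x\<in>carrier L. x)\<rparr>"

lemma is_conlat_self_conlat:
  assumes "complete_lattice L"
  shows "is_conlat (self_conlat L)"
proof -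
  interpret complete_lattice L by fact
  show ?thesis
    by (rule is_conlatI) (simp_all add: self_conlat_def assms)
qed

lemma C_obj_self_conlat: "C_obj (self_conlat L) = B_obj L"
  by (auto simp: C_obj_def B_obj_def self_conlat_def)

abbreviation principal :: "'l gorder \<Rightarrow> 'l \<Rightarrow> ('l, 'l) concept" where
  "principal L \<equiv> concept_at (self_conlat L)"

lemma principal_eq:
  "x \<in> carrier L \<Longrightarrow> principal L x = ({y \<in> carrier L. y \<sqsubseteq>\<^bsub>L\<^esub> x}, {y \<in> carrier L. x \<sqsubseteq>\<^bsub>L\<^esub> y})"
  by (auto simp: concept_at_def self_conlat_def)

lemma order_iso_principal:
  "complete_lattice L \<Longrightarrow> order_iso L (lattice_of (B_obj L)) (principal L)"
  using order_iso_concept_at[OF is_conlat_self_conlat, of L]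
  by (simp add: C_obj_self_conlat) (simp add: self_conlat_def)

lemma principal_mem:
  "\<lbrakk>complete_lattice L; x \<in> carrier L\<rbrakk> \<Longrightarrow> principal L x \<in> concepts (B_obj L)"
  using concept_at_mem[OF is_conlat_self_conlat, of L x]
  by (simp add: C_obj_self_conlat) (simp add: self_conlat_def)

lemma B_obj_simps [simp]:
  "Inst (B_obj L) = carrier L" "Typ (B_obj L) = carrier L"
  "(x, y) \<in> Sat (B_obj L) \<longleftrightarrow> x \<in> carrier L \<and> y \<in> carrier L \<and> x \<sqsubseteq>\<^bsub>L\<^esub> y"
  by (auto simp: B_obj_def)

lemma is_classification_B_obj: "is_classification (B_obj L)"
  by (auto simp: is_classification_def)

lemma B_arr_iff:
  "(y, x) \<in> B_arr L K (\<phi>, \<psi>) \<longleftrightarrow> y \<in> carrier K \<and> x \<in> carrier L \<and> \<phi> y \<sqsubseteq>\<^bsub>L\<^esub> x"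
  by (simp add: B_arr_def)

text \<open>The row of y is the principal filter of \<open>\<phi> y\<close> and the column of x is
  the principal ideal of \<open>\<psi> x\<close>; these are components of principal
  concepts.\<close>

lemma B_arr_mem:
  assumes L: "complete_lattice L" and K: "complete_lattice K"
    and m: "(\<phi>, \<psi>) \<in> adjoint_pairs L K"
  shows "B_arr L K (\<phi>, \<psi>) \<in> bonds (B_obj L) (B_obj K)"
  unfolding bonds_def
proof (intro CollectI conjI ballI)
  note D = adjoint_pairsD[OF m]
  fix y assume "y \<in> Inst (B_obj K)"
  then have y: "y \<in> carrier K" by simp
  have "{x. (y, x) \<in> B_arr L K (\<phi>, \<psi>)} = snd (principal L (\<phi> y))"
    using y D(4) by (auto simp: principal_eq B_arr_iff)
  then show "is_intent (B_obj L) {x. (y, x) \<in> B_arr L K (\<phi>, \<psi>)}"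
    using conceptsD(6)[of "fst (principal L (\<phi> y))" "snd (principal L (\<phi> y))" "B_obj L"]
      principal_mem[OF L D(4)[OF y]] by simp
next
  note D = adjoint_pairsD[OF m]
  fix x assume "x \<in> Typ (B_obj L)"
  then have x: "x \<in> carrier L" by simp
  have "{y. (y, x) \<in> B_arr L K (\<phi>, \<psi>)} = fst (principal K (\<psi> x))"
    using x D(3,5) by (auto simp: principal_eq B_arr_iff)
  then show "is_extent (B_obj K) {y. (y, x) \<in> B_arr L K (\<phi>, \<psi>)}"
    using conceptsD(5)[of "fst (principal K (\<psi> x))" "snd (principal K (\<psi> x))" "B_obj K"]
      principal_mem[OF K D(5)[OF x]] by simp
qed (auto simp: B_arr_def)

text \<open>What lies below every upper bound of x lies below x. So deriving along the bond sends
  the filter of x to the ideal of \<open>\<psi> x\<close>, and dually the ideal of y to the filter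
  of \<open>\<phi> y\<close>.\<close>

lemma bond_adj_B_arr_principal:
  assumes L: "complete_lattice L" and K: "complete_lattice K"
    and m: "(\<phi>, \<psi>) \<in> adjoint_pairs L K"
  shows "x \<in> carrier L \<Longrightarrow>
      bond_psi (B_obj L) (B_obj K) (B_arr L K (\<phi>, \<psi>)) (principal L x) = principal K (\<psi> x)"
    and "y \<in> carrier K \<Longrightarrow>
      bond_phi (B_obj L) (B_obj K) (B_arr L K (\<phi>, \<psi>)) (principal K y) = principal L (\<phi> y)"
proof -
  note D = adjoint_pairsD[OF m] and F = B_arr_mem[OF L K m]
  interpret L: complete_lattice L by fact
  interpret K: complete_lattice K by fact
  {
    assume x: "x \<in> carrier L"
    note px = principal_mem[OF L x]
    have "\<phi> y \<sqsubseteq>\<^bsub>L\<^esub> x \<longleftrightarrow> (\<forall>z\<in>carrier L. x \<sqsubseteq>\<^bsub>L\<^esub> z \<longrightarrow> \<phi> y \<sqsubseteq>\<^bsub>L\<^esub> z)" if "y \<in> carrier K" for y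
      using L.le_trans D(4)[OF that] x by (meson L.le_refl)
    then have "fst (bond_psi (B_obj L) (B_obj K) (B_arr L K (\<phi>, \<psi>)) (principal L x)) =
        fst (principal K (\<psi> x))"
      using px x D(3,5)
      by (auto simp: bond_psi_def case_prod_beta principal_eq B_arr_iff inst_deriv_def)
    then show "bond_psi (B_obj L) (B_obj K) (B_arr L K (\<phi>, \<psi>)) (principal L x) = principal K (\<psi> x)"
      using concept_eqI[OF PiE_mem[OF bond_psi_mem[OF F] px] principal_mem[OF K D(5)[OF x]]] by blast
  next
    assume y: "y \<in> carrier K"
    note py = principal_mem[OF K y]
    have "y \<sqsubseteq>\<^bsub>K\<^esub> \<psi> x \<longleftrightarrow> (\<forall>z\<in>carrier K. z \<sqsubseteq>\<^bsub>K\<^esub> y \<longrightarrow> z \<sqsubseteq>\<^bsub>K\<^esub> \<psi> x)" if "x \<in> carrier L" for x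
      using K.le_trans D(5)[OF that] y by (meson K.le_refl)
    then have "snd (bond_phi (B_obj L) (B_obj K) (B_arr L K (\<phi>, \<psi>)) (principal K y)) =
        snd (principal L (\<phi> y))"
      using py y D(3,4)
      by (auto simp: bond_phi_def case_prod_beta principal_eq B_arr_iff typ_deriv_def)
    then show "bond_phi (B_obj L) (B_obj K) (B_arr L K (\<phi>, \<psi>)) (principal K y) = principal L (\<phi> y)"
      using concept_eqI'[OF PiE_mem[OF bond_phi_mem[OF F] py] principal_mem[OF L D(4)[OF y]]] by blast
  }
qed

lemma B_arr_comp:
  assumes m: "(\<phi>, \<psi>) \<in> adjoint_pairs L K" and n: "(\<phi>', \<psi>') \<in> adjoint_pairs K M"
    and "complete_lattice L" "complete_lattice K"
  shows "B_arr L M (adj_comp L K M (\<phi>, \<psi>) (\<phi>', \<psi>')) =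
    bond_comp (B_obj L) (B_obj K) (B_obj M) (B_arr L K (\<phi>, \<psi>)) (B_arr K M (\<phi>', \<psi>'))"
proof -
  note D = adjoint_pairsD[OF m] and D' = adjoint_pairsD[OF n]
  interpret K: complete_lattice K by fact
  have key: "\<phi> (\<phi>' z) \<sqsubseteq>\<^bsub>L\<^esub> x \<longleftrightarrow>
    extent_of (B_obj K) {y. (z, y) \<in> B_arr K M (\<phi>', \<psi>')} \<subseteq> {y. (y, x) \<in> B_arr L K (\<phi>, \<psi>)}"
    (is "_ \<longleftrightarrow> ?E \<subseteq> ?F") if z: "z \<in> carrier M" and x: "x \<in> carrier L" for x z
  proof -
    \<comment> \<open>The row of z is the filter of \<open>\<phi>' z\<close>, and its extent is the
      ideal of \<open>\<phi>' z\<close>. Bond composition then compares two principal ideals, that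
      is, their generators.\<close>
    have "?E = {y \<in> carrier K. y \<sqsubseteq>\<^bsub>K\<^esub> \<phi>' z}"
      using D'(4)[OF z] z by (auto simp: inst_deriv_def B_arr_iff intro: K.le_trans)
    moreover have "?F = {y \<in> carrier K. y \<sqsubseteq>\<^bsub>K\<^esub> \<psi> x}"
      using D(3) x by (auto simp: B_arr_iff)
    moreover have "\<phi> (\<phi>' z) \<sqsubseteq>\<^bsub>L\<^esub> x \<longleftrightarrow> \<phi>' z \<sqsubseteq>\<^bsub>K\<^esub> \<psi> x"
      using D(3)[OF x D'(4)[OF z]] .
    ultimately show ?thesis
      using D'(4)[OF z] D(5)[OF x] by (auto intro: K.le_trans)
  qed
  have "(z, x) \<in> B_arr L M (adj_comp L K M (\<phi>, \<psi>) (\<phi>', \<psi>')) \<longleftrightarrow> (z, x) \<in>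
      bond_comp (B_obj L) (B_obj K) (B_obj M) (B_arr L K (\<phi>, \<psi>)) (B_arr K M (\<phi>', \<psi>'))" for z x
    using key[of z x]
    by (cases "z \<in> carrier M \<and> x \<in> carrier L")
       (auto simp only: adj_comp_def prod.case B_arr_iff[of z x] bond_comp_def compose_eq B_obj_simps
          mem_Collect_eq)
  then show ?thesis by auto
qed

lemma B_arr_id: "B_arr L L (adj_id L) = bond_id (B_obj L)"
  by (auto simp: B_arr_def adj_id_def bond_id_def)

lemma is_functor_B: "is_functor CompleteAdjoint Bond B_functor"
  unfolding is_functor_def Bond_def CompleteAdjoint_def B_functor_def
  by (auto simp: B_arr_mem B_arr_id is_classification_B_obj B_arr_comp)

text \<open>Every concept of \<open>B_obj L\<close> is principal, and at the concept of x both maps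
  give the principal concept of \<open>\<psi> x\<close>.\<close>

lemma B2_arr_mem:
  assumes "complete_lattice L" "complete_lattice K"
    and m: "(\<phi>, \<psi>) \<in> adjoint_pairs L K" "(\<psi>, \<theta>) \<in> adjoint_pairs K L"
  shows "(B_arr L K (\<phi>, \<psi>), B_arr K L (\<psi>, \<theta>)) \<in> bonding_pairs (B_obj L) (B_obj K)"
proof -
  note F = B_arr_mem[OF assms(1,2) m(1)] and G = B_arr_mem[OF assms(2,1) m(2)]
  have "bond_psi (B_obj L) (B_obj K) (B_arr L K (\<phi>, \<psi>)) =
      bond_phi (B_obj K) (B_obj L) (B_arr K L (\<psi>, \<theta>))"
  proof (rule extensional_eqI[OF bond_psi_mem[OF F] bond_phi_mem[OF G]])
    fix c assume "c \<in> concepts (B_obj L)"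
    then obtain x where "x \<in> carrier L" "c = principal L x"
      using order_iso_surj[OF order_iso_principal[OF assms(1)], of c] by auto
    then show "bond_psi (B_obj L) (B_obj K) (B_arr L K (\<phi>, \<psi>)) c =
        bond_phi (B_obj K) (B_obj L) (B_arr K L (\<psi>, \<theta>)) c"
      using bond_adj_B_arr_principal(1)[OF assms(1,2) m(1)]
        bond_adj_B_arr_principal(2)[OF assms(2,1) m(2)] by simp
  qed
  then show ?thesis using F G by (simp add: bonding_pairs_iff)
qed

lemma B2_functor_simps:
  "fobj B2_functor = B_obj"
  "\<lbrakk>complete_lattice L; complete_lattice K; (\<phi>, \<psi>) \<in> adjoint_pairs L K; (\<psi>, \<theta>) \<in> adjoint_pairs K L\<rbrakk>
    \<Longrightarrow> farr B2_functor L K \<psi> = (B_arr L K (\<phi>, \<psi>), B_arr K L (\<psi>, \<theta>))"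
  by (simp_all add: B2_functor_def left_adjoint_of_eq right_adjoint_of_eq)

lemma B2_functor_mem:
  assumes "complete_lattice L" "complete_lattice K" "\<psi> \<in> complete_homs L K"
  shows "farr B2_functor L K \<psi> \<in> bonding_pairs (B_obj L) (B_obj K)"
  using assms by (auto elim!: complete_homE simp: B2_functor_simps(2) B2_arr_mem)

lemma is_functor_B2: "is_functor CompleteLattice BondingPair B2_functor"
  unfolding is_functor_def
proof (intro conjI ballI)
  fix L :: "'a gorder" assume "L \<in> Obj CompleteLattice"
  then have L: "complete_lattice L" by (simp add: CompleteLattice_def)
  show "fobj B2_functor L \<in> Obj BondingPair"
    by (simp add: BondingPair_def B2_functor_simps is_classification_B_obj)
  \<comment> \<open>The identity is its own left and right adjoint, which resolves both definite
    descriptions.\<close>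
  have "(lat_id L, lat_id L) = adj_id L"
    by (simp add: lat_id_def adj_id_def)
  then show "farr B2_functor L L (Ident CompleteLattice L) = Ident BondingPair (fobj B2_functor L)"
    using adj_id_mem[of L] L B_arr_id[of L]
    by (simp add: CompleteLattice_def BondingPair_def B2_functor_simps(1) B2_functor_simps(2)[of L L "lat_id L" "lat_id L" "lat_id L"]
        bp_id_def bond_id_def)
next
  fix L K :: "'a gorder" and \<psi>
  assume "L \<in> Obj CompleteLattice" "K \<in> Obj CompleteLattice" "\<psi> \<in> Hom CompleteLattice L K"
  then show "farr B2_functor L K \<psi> \<in> Hom BondingPair (fobj B2_functor L) (fobj B2_functor K)"
    by (simp add: CompleteLattice_def BondingPair_def B2_functor_mem B2_functor_simps(1))
next
  fix L K M :: "'a gorder" and \<psi> \<psi>'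
  assume "L \<in> Obj CompleteLattice" "K \<in> Obj CompleteLattice" "M \<in> Obj CompleteLattice"
  then have L: "complete_lattice L" and K: "complete_lattice K" and M: "complete_lattice M"
    by (simp_all add: CompleteLattice_def)
  assume "\<psi> \<in> Hom CompleteLattice L K" "\<psi>' \<in> Hom CompleteLattice K M"
  then obtain \<phi> \<theta> \<phi>' \<theta>' where m: "(\<phi>, \<psi>) \<in> adjoint_pairs L K" "(\<psi>, \<theta>) \<in> adjoint_pairs K L"
    and n: "(\<phi>', \<psi>') \<in> adjoint_pairs K M" "(\<psi>', \<theta>') \<in> adjoint_pairs M K"
    using complete_homE L K M unfolding CompleteLattice_def cat.simps by metis
  \<comment> \<open>The adjoints of the composite are the composites of the adjoints in reversed
    order; this resolves the definite descriptions at the composite.\<close>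
  have "adj_comp L K M (\<phi>, \<psi>) (\<phi>', \<psi>') \<in> adjoint_pairs L M"
    "adj_comp M K L (\<psi>', \<theta>') (\<psi>, \<theta>) \<in> adjoint_pairs M L"
    using L K M m n by (auto intro: adj_comp_mem)
  then have "farr B2_functor L M (lat_comp L K M \<psi> \<psi>') =
      (B_arr L M (adj_comp L K M (\<phi>, \<psi>) (\<phi>', \<psi>')), B_arr M L (adj_comp M K L (\<psi>', \<theta>') (\<psi>, \<theta>)))"
    using L M by (simp add: adj_comp_def lat_comp_def B2_functor_simps(2))
  also have "\<dots> = bp_comp (B_obj L) (B_obj K) (B_obj M) (farr B2_functor L K \<psi>) (farr B2_functor K M \<psi>')"
    using L K M m n by (simp add: B2_functor_simps(2) bp_comp_def B_arr_comp)
  finally show "farr B2_functor L M (Comp CompleteLattice L K M \<psi> \<psi>') =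
      Comp BondingPair (fobj B2_functor L) (fobj B2_functor K) (fobj B2_functor M)
        (farr B2_functor L K \<psi>) (farr B2_functor K M \<psi>')"
    by (simp add: CompleteLattice_def BondingPair_def B2_functor_simps(1))
qed

subsection \<open>The isomorphism between a complete lattice and the concept lattice of its order\<close>

text \<open>The counit at L is the morphism from \<open>lattice_of (B_obj L)\<close> to L whose
  right adjoint \<open>counit_psi\<close> sends a principal concept to its generator; its left
  adjoint runs the other way.\<close>

abbreviation counit_phi :: "'l gorder \<Rightarrow> 'l \<Rightarrow> ('l, 'l) concept" where
  "counit_phi L \<equiv> iso_map L (lattice_of (B_obj L)) (principal L)"

abbreviation counit_psi :: "'l gorder \<Rightarrow> ('l, 'l) concept \<Rightarrow> 'l" where
  "counit_psi L \<equiv> iso_inv L (lattice_of (B_obj L)) (principal L)"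

text \<open>\<open>bond_adj_B_arr_principal\<close> is the required commutation at principal
  concepts; the right adjoints and the left adjoints each give one square.\<close>

lemma counit_natural:
  assumes L: "complete_lattice L" and K: "complete_lattice K"
    and m: "(\<phi>, \<psi>) \<in> adjoint_pairs L K"
  shows "compose (carrier (lattice_of (B_obj L))) (counit_psi K)
      (bond_psi (B_obj L) (B_obj K) (B_arr L K (\<phi>, \<psi>))) =
      compose (carrier (lattice_of (B_obj L))) \<psi> (counit_psi L)"
    and "compose (carrier K) (bond_phi (B_obj L) (B_obj K) (B_arr L K (\<phi>, \<psi>))) (counit_phi K) =
      compose (carrier K) (counit_phi L) \<phi>"
proof -
  note D = adjoint_pairsD[OF m] and eq = bond_adj_B_arr_principal[OF L K m]
  show "compose (carrier (lattice_of (B_obj L))) (counit_psi K)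
      (bond_psi (B_obj L) (B_obj K) (B_arr L K (\<phi>, \<psi>))) =
      compose (carrier (lattice_of (B_obj L))) \<psi> (counit_psi L)"
    by (rule iso_inv_natural[OF order_iso_principal[OF L] order_iso_principal[OF K]])
       (use D(2) eq(1) in auto)
  show "compose (carrier K) (bond_phi (B_obj L) (B_obj K) (B_arr L K (\<phi>, \<psi>))) (counit_phi K) =
      compose (carrier K) (counit_phi L) \<phi>"
    by (rule iso_map_natural) (use D(1) eq(2) in auto)
qed

lemma adj_iso_counit:
  "complete_lattice L \<Longrightarrow> adj_iso (lattice_of (B_obj L)) L (counit_phi L, counit_psi L)"
  by (intro adj_iso_of_order_iso order_iso_principal)

lemma adj_counit_natural:
  assumes "complete_lattice L" "complete_lattice K" "m \<in> adjoint_pairs L K"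
  shows "adj_comp (lattice_of (B_obj L)) (lattice_of (B_obj K)) K
      (bond_adj (B_obj L) (B_obj K) (B_arr L K m)) (counit_phi K, counit_psi K) =
    adj_comp (lattice_of (B_obj L)) L K (counit_phi L, counit_psi L) m"
  using counit_natural[OF assms(1,2), of "fst m" "snd m"] assms(3)
  by (cases m) (simp add: adj_comp_def)

lemma lat_iso_counit:
  "complete_lattice L \<Longrightarrow> lat_iso (lattice_of (B_obj L)) L (counit_psi L)"
  by (intro lat_iso_of_order_iso order_iso_principal) auto

lemma lat_counit_natural:
  assumes "complete_lattice L" "complete_lattice K" "\<psi> \<in> complete_homs L K"
  shows "lat_comp (lattice_of (B_obj L)) (lattice_of (B_obj K)) K
      (bp_hom (B_obj L) (B_obj K) (farr B2_functor L K \<psi>)) (counit_psi K) =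
    lat_comp (lattice_of (B_obj L)) L K (counit_psi L) \<psi>"
proof -
  obtain \<phi> \<theta> where "(\<phi>, \<psi>) \<in> adjoint_pairs L K" "(\<psi>, \<theta>) \<in> adjoint_pairs K L"
    using complete_homE[OF assms(3,1,2)] by metis
  then show ?thesis
    using counit_natural(1)[OF assms(1,2)] assms(1,2) by (simp add: lat_comp_def B2_functor_simps(2))
qed

lemma natural_iso_BA:
  "het_naturally_isomorphic adj_iso adj_comp adj_comp CompleteAdjoint (B_functor ;; A_functor) id_func"
  unfolding het_naturally_isomorphic_def
  by (intro exI[of _ "\<lambda>L. (counit_phi L, counit_psi L)"])
     (simp add: CompleteAdjoint_def func_comp_def A_functor_def B_functor_def id_func_def
        adj_iso_counit adj_counit_natural)

lemma natural_iso_B2A2: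
  "het_naturally_isomorphic lat_iso lat_comp lat_comp CompleteLattice (B2_functor ;; A2_functor) id_func"
  unfolding het_naturally_isomorphic_def
  by (intro exI[of _ counit_psi])
     (simp add: CompleteLattice_def func_comp_def A2_functor_def B2_functor_simps(1) id_func_def
        lat_iso_counit lat_counit_natural case_prod_beta)

text \<open>The unit of the equivalence at \<open>A\<close> is the preimage under \<open>bond_adj\<close> of the counit at the
  concept lattice of \<open>A\<close>; its naturality is reflected by faithfulness.\<close>

lemma natural_iso_AB:
  "het_naturally_isomorphic bond_iso bond_comp bond_comp
    (Bond :: (('i, 't) classification, _) cat) (A_functor ;; B_functor) id_func"
proof -
  have "\<forall>A\<in>(Collect is_classification :: ('i, 't) classification set). \<exists>\<eta>\<in>bonds (B_obj (lattice_of A)) A.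
      bond_adj (B_obj (lattice_of A)) A \<eta> = (counit_phi (lattice_of A), counit_psi (lattice_of A)) \<and>
      bond_iso (B_obj (lattice_of A)) A \<eta>"
    by (intro ballI bond_iso_lift) (simp_all add: adj_iso_counit is_classification_B_obj)
  then obtain \<eta> where \<eta>: "\<And>A :: ('i, 't) classification. is_classification A \<Longrightarrow> \<eta> A \<in> bonds (B_obj (lattice_of A)) A"
    "\<And>A. is_classification A \<Longrightarrow> bond_adj (B_obj (lattice_of A)) A (\<eta> A) =
      (counit_phi (lattice_of A), counit_psi (lattice_of A))"
    "\<And>A. is_classification A \<Longrightarrow> bond_iso (B_obj (lattice_of A)) A (\<eta> A)"
    by (metis mem_Collect_eq)
  have nat: "bond_comp (B_obj (lattice_of A)) (B_obj (lattice_of B)) B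
      (B_arr (lattice_of A) (lattice_of B) (bond_adj A B F)) (\<eta> B) =
      bond_comp (B_obj (lattice_of A)) A B (\<eta> A) F"
    if A: "is_classification A" and B: "is_classification B" and F: "F \<in> bonds A B"
    for A B and F
  proof -
    note AF = bond_adj_mem[OF F]
    note BAF = B_arr_mem[OF complete_lattice_lattice_of complete_lattice_lattice_of AF]
    show ?thesis
      by (rule bond_adj_inj[OF bond_comp_mem[OF BAF \<eta>(1)[OF B]] bond_comp_mem[OF \<eta>(1)[OF A] F]])
         (simp only: bond_adj_comp[OF BAF \<eta>(1)[OF B]] bond_adj_comp[OF \<eta>(1)[OF A] F]
            \<eta>(2)[OF A] \<eta>(2)[OF B] adj_counit_natural[OF complete_lattice_lattice_of complete_lattice_lattice_of AF])
  qed
  show ?thesis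
    unfolding het_naturally_isomorphic_def
    by (intro exI[of _ \<eta>])
       (simp add: Bond_def func_comp_def A_functor_def B_functor_def id_func_def \<eta>(3) nat)
qed

text \<open>The preceding construction with \<open>bp_hom\<close>: the counit at the concept lattice
  is lifted, and naturality is tested after applying \<open>bp_hom\<close>.\<close>

lemma natural_iso_A2B2:
  "het_naturally_isomorphic bp_iso bp_comp bp_comp
    (BondingPair :: (('i, 't) classification, _) cat) (A2_functor ;; B2_functor) id_func"
proof -
  have "\<forall>A\<in>(Collect is_classification :: ('i, 't) classification set). \<exists>\<eta>\<in>bonding_pairs (B_obj (lattice_of A)) A.
      bp_hom (B_obj (lattice_of A)) A \<eta> = counit_psi (lattice_of A) \<and>
      bp_iso (B_obj (lattice_of A)) A \<eta>"
    by (intro ballI bp_iso_lift) (simp_all add: lat_iso_counit is_classification_B_obj)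
  then obtain \<eta> where \<eta>: "\<And>A :: ('i, 't) classification. is_classification A \<Longrightarrow> \<eta> A \<in> bonding_pairs (B_obj (lattice_of A)) A"
    "\<And>A. is_classification A \<Longrightarrow> bp_hom (B_obj (lattice_of A)) A (\<eta> A) = counit_psi (lattice_of A)"
    "\<And>A. is_classification A \<Longrightarrow> bp_iso (B_obj (lattice_of A)) A (\<eta> A)"
    by (metis mem_Collect_eq)
  have nat: "bp_comp (B_obj (lattice_of A)) (B_obj (lattice_of B)) B
      (farr B2_functor (lattice_of A) (lattice_of B) (bp_hom A B m)) (\<eta> B) =
      bp_comp (B_obj (lattice_of A)) A B (\<eta> A) m"
    if A: "is_classification A" and B: "is_classification B" and m: "m \<in> bonding_pairs A B"
    for A B and m
  proof -
    note Am = bp_hom_mem[OF m]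
    note BAm = B2_functor_mem[OF complete_lattice_lattice_of complete_lattice_lattice_of Am]
    show ?thesis
      by (rule bp_hom_inj[OF bp_comp_mem[OF BAm \<eta>(1)[OF B]] bp_comp_mem[OF \<eta>(1)[OF A] m]])
         (simp only: bp_hom_comp[OF BAm \<eta>(1)[OF B]] bp_hom_comp[OF \<eta>(1)[OF A] m]
            \<eta>(2)[OF A] \<eta>(2)[OF B] lat_counit_natural[OF complete_lattice_lattice_of complete_lattice_lattice_of Am])
  qed
  show ?thesis
    unfolding het_naturally_isomorphic_def
    by (intro exI[of _ \<eta>])
       (simp add: BondingPair_def func_comp_def A2_functor_def B2_functor_simps(1) id_func_def
          \<eta>(3) nat case_prod_beta)
qed

section \<open>The equivalences inside one universe\<close>

lemma category_full_subcategory: "category C \<Longrightarrow> category (full_subcategory C P)"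
  unfolding category_def full_subcategory_def by simp

lemma is_functor_full_subcategory:
  "\<lbrakk>is_functor C D F; \<And>a. \<lbrakk>a \<in> Obj C; P a\<rbrakk> \<Longrightarrow> Q (fobj F a)\<rbrakk> \<Longrightarrow>
    is_functor (full_subcategory C P) (full_subcategory D Q) F"
  unfolding is_functor_def full_subcategory_def by simp

text \<open>Only the counit has to be given. The component at a of the other isomorphism is the lift
  along F of the counit at \<open>fobj F a\<close>; faithfulness reflects its inverse laws and its
  naturality from D.\<close>

lemma equivalence_via_fully_faithful:
  assumes C: "category C" and D: "category D"
    and F: "is_functor C D F" and G: "is_functor D C G"
    and inj: "\<And>a b f g. \<lbrakk>a \<in> Obj C; b \<in> Obj C; f \<in> Hom C a b; g \<in> Hom C a b;
      farr F a b f = farr F a b g\<rbrakk> \<Longrightarrow> f = g"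
    and surj: "\<And>a b h. \<lbrakk>a \<in> Obj C; b \<in> Obj C; h \<in> Hom D (fobj F a) (fobj F b)\<rbrakk> \<Longrightarrow>
      \<exists>f\<in>Hom C a b. farr F a b f = h"
    and counit: "naturally_isomorphic D D (G ;; F) id_func"
  shows "equivalence_via C D F G"
proof -
  have Fo: "fobj F a \<in> Obj D" if "a \<in> Obj C" for a
    using F that by (simp add: is_functor_def)
  have Go: "fobj G d \<in> Obj C" if "d \<in> Obj D" for d
    using G that by (simp add: is_functor_def)
  have Fa: "farr F a b f \<in> Hom D (fobj F a) (fobj F b)"
    if "a \<in> Obj C" "b \<in> Obj C" "f \<in> Hom C a b" for a b f
    using F that by (simp add: is_functor_def)
  have Ga: "farr G a b f \<in> Hom C (fobj G a) (fobj G b)"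
    if "a \<in> Obj D" "b \<in> Obj D" "f \<in> Hom D a b" for a b f
    using G that by (simp add: is_functor_def)
  have Fid: "farr F a a (Ident C a) = Ident D (fobj F a)" if "a \<in> Obj C" for a
    using F that by (simp add: is_functor_def)
  have Fcomp: "farr F a c (Comp C a b c f g) =
      Comp D (fobj F a) (fobj F b) (fobj F c) (farr F a b f) (farr F b c g)"
    if "a \<in> Obj C" "b \<in> Obj C" "c \<in> Obj C" "f \<in> Hom C a b" "g \<in> Hom C b c" for a b c f g
    using F that by (simp add: is_functor_def)
  have Cid: "Ident C a \<in> Hom C a a" if "a \<in> Obj C" for a
    using C that by (simp add: category_def)
  have Ccomp: "Comp C a b c f g \<in> Hom C a c"
    if "a \<in> Obj C" "b \<in> Obj C" "c \<in> Obj C" "f \<in> Hom C a b" "g \<in> Hom C b c" for a b c f g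
    using C that by (simp add: category_def)
  obtain \<epsilon> where iso: "\<And>d. d \<in> Obj D \<Longrightarrow> isomorphism D (fobj F (fobj G d)) d (\<epsilon> d)"
    and nat: "\<And>a b f. \<lbrakk>a \<in> Obj D; b \<in> Obj D; f \<in> Hom D a b\<rbrakk> \<Longrightarrow>
      Comp D (fobj F (fobj G a)) (fobj F (fobj G b)) b
        (farr F (fobj G a) (fobj G b) (farr G a b f)) (\<epsilon> b) =
      Comp D (fobj F (fobj G a)) a b (\<epsilon> a) f"
    using counit
    unfolding naturally_isomorphic_def het_naturally_isomorphic_def func_comp_def id_func_def func.simps
    by blast
  have "\<exists>\<eta>\<in>Hom C (fobj G (fobj F a)) a. farr F (fobj G (fobj F a)) a \<eta> = \<epsilon> (fobj F a) \<and>
      isomorphism C (fobj G (fobj F a)) a \<eta>" if a: "a \<in> Obj C" for a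
  proof -
    let ?c = "fobj G (fobj F a)"
    have c: "?c \<in> Obj C" using a Fo Go by blast
    obtain \<epsilon>' where \<epsilon>: "\<epsilon> (fobj F a) \<in> Hom D (fobj F ?c) (fobj F a)"
      "\<epsilon>' \<in> Hom D (fobj F a) (fobj F ?c)"
      "Comp D (fobj F ?c) (fobj F a) (fobj F ?c) (\<epsilon> (fobj F a)) \<epsilon>' = Ident D (fobj F ?c)"
      "Comp D (fobj F a) (fobj F ?c) (fobj F a) \<epsilon>' (\<epsilon> (fobj F a)) = Ident D (fobj F a)"
      using iso[OF Fo[OF a]] by (auto simp: isomorphism_def het_isomorphism_def)
    obtain m where m: "m \<in> Hom C ?c a" "farr F ?c a m = \<epsilon> (fobj F a)"
      using surj[OF c a \<epsilon>(1)] by blast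
    obtain n where n: "n \<in> Hom C a ?c" "farr F a ?c n = \<epsilon>'"
      using surj[OF a c \<epsilon>(2)] by blast
    have "Comp C ?c a ?c m n = Ident C ?c"
      by (rule inj[OF c c Ccomp[OF c a c m(1) n(1)] Cid[OF c]])
         (simp only: Fcomp[OF c a c m(1) n(1)] Fid[OF c] m(2) n(2) \<epsilon>)
    moreover have "Comp C a ?c a n m = Ident C a"
      by (rule inj[OF a a Ccomp[OF a c a n(1) m(1)] Cid[OF a]])
         (simp only: Fcomp[OF a c a n(1) m(1)] Fid[OF a] m(2) n(2) \<epsilon>)
    ultimately show ?thesis
      using m n(1) by (auto simp: isomorphism_def het_isomorphism_def)
  qed
  then obtain \<eta> where \<eta>: "\<And>a. a \<in> Obj C \<Longrightarrow> \<eta> a \<in> Hom C (fobj G (fobj F a)) a"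
    "\<And>a. a \<in> Obj C \<Longrightarrow> farr F (fobj G (fobj F a)) a (\<eta> a) = \<epsilon> (fobj F a)"
    "\<And>a. a \<in> Obj C \<Longrightarrow> isomorphism C (fobj G (fobj F a)) a (\<eta> a)"
    by metis
  have "Comp C (fobj G (fobj F a)) (fobj G (fobj F b)) b
      (farr G (fobj F a) (fobj F b) (farr F a b f)) (\<eta> b) =
      Comp C (fobj G (fobj F a)) a b (\<eta> a) f"
    if a: "a \<in> Obj C" and b: "b \<in> Obj C" and f: "f \<in> Hom C a b" for a b f
  proof -
    note a' = Go[OF Fo[OF a]] and b' = Go[OF Fo[OF b]]
    note GFf = Ga[OF Fo[OF a] Fo[OF b] Fa[OF a b f]]
    show ?thesis
      by (rule inj[OF a' b Ccomp[OF a' b' b GFf \<eta>(1)[OF b]] Ccomp[OF a' a b \<eta>(1)[OF a] f]])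
         (simp only: Fcomp[OF a' b' b GFf \<eta>(1)[OF b]] Fcomp[OF a' a b \<eta>(1)[OF a] f]
            \<eta>(2)[OF a] \<eta>(2)[OF b] nat[OF Fo[OF a] Fo[OF b] Fa[OF a b f]])
  qed
  then have "naturally_isomorphic C C (F ;; G) id_func"
    using \<eta>(3) unfolding naturally_isomorphic_def het_naturally_isomorphic_def
    by (intro exI[of _ \<eta>]) (simp add: func_comp_def id_func_def)
  then show ?thesis
    using assms by (simp add: equivalence_via_def)
qed

section \<open>Copies of concept lattices on members of \<open>S\<close>, and conjugation of maps by
  the encodings\<close>

lemma order_iso_comp:
  "\<lbrakk>order_iso L K h; order_iso K M k\<rbrakk> \<Longrightarrow> order_iso L M (k \<circ> h)"
  unfolding order_iso_def
  by (auto intro: bij_betw_trans simp: bij_betwE)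

text \<open>Every subset of the carrier of K is the image of one of L, and h carries its least upper
  and greatest lower bound across.\<close>

lemma order_iso_complete_lattice:
  assumes h: "order_iso L K h" and L: "complete_lattice L"
  shows "complete_lattice K"
proof -
  interpret L: complete_lattice L by fact
  interpret K: partial_order K using h by (simp add: order_iso_def)
  have le: "h x \<sqsubseteq>\<^bsub>K\<^esub> h y \<longleftrightarrow> x \<sqsubseteq>\<^bsub>L\<^esub> y" if "x \<in> carrier L" "y \<in> carrier L" for x y
    using h that by (simp add: order_iso_def)
  have hc: "h x \<in> carrier K" if "x \<in> carrier L" for x
    using h that by (auto simp: order_iso_def bij_betw_def)
  show ?thesis
  proof (rule K.complete_latticeI)
    fix S assume S: "S \<subseteq> carrier K"
    define S' where "S' = {x \<in> carrier L. h x \<in> S}"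
    have S': "S' \<subseteq> carrier L" "S = h ` S'"
      using S order_iso_surj[OF h] by (auto simp: S'_def)
    have "least K (h (\<Squnion>\<^bsub>L\<^esub>S')) (Upper K S)"
    proof (rule least_UpperI)
      fix x assume "x \<in> S"
      then show "x \<sqsubseteq>\<^bsub>K\<^esub> h (\<Squnion>\<^bsub>L\<^esub>S')"
        using S' le[of _ "\<Squnion>\<^bsub>L\<^esub>S'"] L.sup_upper[of S'] by auto
    next
      fix y assume "y \<in> Upper K S"
      then have y: "y \<in> carrier K" "\<And>x. x \<in> S \<Longrightarrow> x \<sqsubseteq>\<^bsub>K\<^esub> y"
        using S by (auto simp: Upper_def)
      then obtain z where z: "z \<in> carrier L" "y = h z"
        using order_iso_surj[OF h] by blast
      have "x \<sqsubseteq>\<^bsub>L\<^esub> z" if "x \<in> S'" for x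
        using y(2)[of "h x"] le[of x z] S' z that by auto
      then have "\<Squnion>\<^bsub>L\<^esub>S' \<sqsubseteq>\<^bsub>L\<^esub> z"
        using S'(1) z(1) by (intro L.sup_least)
      then show "h (\<Squnion>\<^bsub>L\<^esub>S') \<sqsubseteq>\<^bsub>K\<^esub> y"
        using le[of "\<Squnion>\<^bsub>L\<^esub>S'" z] z(1,2) S'(1) by simp
    qed (use S hc S' in auto)
    then show "\<exists>s. least K s (Upper K S)" ..
    have "greatest K (h (\<Sqinter>\<^bsub>L\<^esub>S')) (Lower K S)"
    proof (rule greatest_LowerI)
      fix x assume "x \<in> S"
      then show "h (\<Sqinter>\<^bsub>L\<^esub>S') \<sqsubseteq>\<^bsub>K\<^esub> x"
        using S' le[of "\<Sqinter>\<^bsub>L\<^esub>S'"] L.inf_lower[of S'] by auto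
    next
      fix y assume "y \<in> Lower K S"
      then have y: "y \<in> carrier K" "\<And>x. x \<in> S \<Longrightarrow> y \<sqsubseteq>\<^bsub>K\<^esub> x"
        using S by (auto simp: Lower_def)
      then obtain z where z: "z \<in> carrier L" "y = h z"
        using order_iso_surj[OF h] by blast
      have "z \<sqsubseteq>\<^bsub>L\<^esub> x" if "x \<in> S'" for x
        using y(2)[of "h x"] le[of z x] S' z that by auto
      then have "z \<sqsubseteq>\<^bsub>L\<^esub> \<Sqinter>\<^bsub>L\<^esub>S'"
        using S'(1) z(1) by (intro L.inf_greatest)
      then show "y \<sqsubseteq>\<^bsub>K\<^esub> h (\<Sqinter>\<^bsub>L\<^esub>S')"
        using le[of z "\<Sqinter>\<^bsub>L\<^esub>S'"] z(1,2) S'(1) by simp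
    qed (use S hc S' in auto)
    then show "\<exists>i. greatest K i (Lower K S)" ..
  qed
qed

text \<open>\<open>classification_in\<close> supplies the existence on which the choice in
  \<open>encoding\<close> depends.\<close>

lemma bij_betw_encoding:
  assumes "classification_in S A"
  shows "\<exists>X\<in>S. bij_betw (encoding S A) (concepts A) X"
proof -
  have "\<exists>h. \<exists>X\<in>S. bij_betw h (concepts A) X"
    using assms by (simp only: classification_in_def)
  from someI_ex[OF this] show ?thesis unfolding encoding_def .
qed

lemma decoding_encoding:
  "\<lbrakk>classification_in S A; c \<in> concepts A\<rbrakk> \<Longrightarrow> decoding S A (encoding S A c) = c"
  using bij_betw_encoding[of S A] by (auto simp: decoding_def bij_betw_def the_inv_into_f_f)

lemma lattice_of_in_simps [simp]:
  "carrier (lattice_of_in S A) = encoding S A ` concepts A"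
  "eq (lattice_of_in S A) = (=)"
  "x \<sqsubseteq>\<^bsub>lattice_of_in S A\<^esub> y \<longleftrightarrow> fst (decoding S A x) \<subseteq> fst (decoding S A y)"
  by (simp_all add: lattice_of_in_def)

lemma lattice_in_lattice_of_in: "classification_in S A \<Longrightarrow> lattice_in S (lattice_of_in S A)"
  using bij_betw_encoding[of S A] by (auto simp: lattice_in_def bij_betw_def)

text \<open>The order of the copy is defined by decoding, so it is enough that decoding inverts the
  encoding on concepts.\<close>

lemma order_iso_encoding:
  assumes A: "classification_in S A"
  shows "order_iso (lattice_of A) (lattice_of_in S A) (encoding S A)"
proof -
  note dec = decoding_encoding[OF A]
  have antisym: "encoding S A c = encoding S A d"
    if "c \<in> concepts A" "d \<in> concepts A" "fst c = fst d" for c d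
    using concept_eqI[OF that] by simp
  have "partial_order (lattice_of_in S A)"
    by unfold_locales (auto simp: dec intro: antisym)
  then show ?thesis
    using bij_betw_encoding[OF A] by (auto simp: order_iso_def bij_betw_def dec)
qed

lemma complete_lattice_lattice_of_in:
  "classification_in S A \<Longrightarrow> complete_lattice (lattice_of_in S A)"
  using order_iso_complete_lattice[OF order_iso_encoding] by blast

lemma map_in_encoding:
  "\<lbrakk>classification_in S A; c \<in> concepts A\<rbrakk> \<Longrightarrow> map_in S A B \<psi> (encoding S A c) = encoding S B (\<psi> c)"
  by (simp add: map_in_def decoding_encoding)

lemma map_in_mem:
  assumes "classification_in S A" "\<psi> \<in> concepts A \<rightarrow>\<^sub>E concepts B"
  shows "map_in S A B \<psi> \<in> carrier (lattice_of_in S A) \<rightarrow>\<^sub>E carrier (lattice_of_in S B)"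
  unfolding map_in_def
  by (rule restrict_PiE_iff[THEN iffD2]) (use assms in \<open>auto simp: decoding_encoding intro!: imageI\<close>)

lemma map_in_inj:
  assumes A: "classification_in S A" and B: "classification_in S B"
    and \<psi>: "\<psi> \<in> concepts A \<rightarrow>\<^sub>E concepts B" "\<psi>' \<in> concepts A \<rightarrow>\<^sub>E concepts B"
    and eq: "map_in S A B \<psi> = map_in S A B \<psi>'"
  shows "\<psi> = \<psi>'"
proof (rule extensional_eqI[OF \<psi>])
  fix c assume c: "c \<in> concepts A"
  then have "encoding S B (\<psi> c) = encoding S B (\<psi>' c)"
    using map_in_encoding[OF A c] eq by metis
  then show "\<psi> c = \<psi>' c"
    using decoding_encoding[OF B] PiE_mem[OF \<psi>(1) c] PiE_mem[OF \<psi>(2) c] by metis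
qed

text \<open>The preimage is \<chi> conjugated in the other direction. Together with
  \<open>map_in_inj\<close>, conjugation is a bijection of function spaces.\<close>

lemma map_in_surj:
  assumes A: "classification_in S A" and B: "classification_in S B"
    and \<chi>: "\<chi> \<in> carrier (lattice_of_in S A) \<rightarrow>\<^sub>E carrier (lattice_of_in S B)"
  shows "\<exists>\<psi>\<in>concepts A \<rightarrow>\<^sub>E concepts B. map_in S A B \<psi> = \<chi>"
proof
  let ?\<psi> = "\<lambda>c\<in>concepts A. decoding S B (\<chi> (encoding S A c))"
  have *: "decoding S B (\<chi> (encoding S A c)) \<in> concepts B"
    "encoding S B (decoding S B (\<chi> (encoding S A c))) = \<chi> (encoding S A c)" if "c \<in> concepts A" for c
    using PiE_mem[OF \<chi>, of "encoding S A c"] that by (auto simp: decoding_encoding[OF B])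
  show \<psi>: "?\<psi> \<in> concepts A \<rightarrow>\<^sub>E concepts B"
    by (rule restrict_PiE_iff[THEN iffD2]) (use * in auto)
  show "map_in S A B ?\<psi> = \<chi>"
    by (rule extensional_eqI[OF map_in_mem[OF A \<psi>] \<chi>]) (auto simp: map_in_encoding[OF A] *)
qed

text \<open>All elements of the copies are encodings, and at encodings the two inequalities of the
  adjunction are those for \<phi> and \<psi>.\<close>

lemma map_in_adjoint_iff:
  assumes A: "classification_in S A" and B: "classification_in S B"
    and \<psi>: "\<psi> \<in> concepts A \<rightarrow>\<^sub>E concepts B" and \<phi>: "\<phi> \<in> concepts B \<rightarrow>\<^sub>E concepts A"
  shows "(map_in S B A \<phi>, map_in S A B \<psi>) \<in> adjoint_pairs (lattice_of_in S A) (lattice_of_in S B) \<longleftrightarrow>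
    (\<phi>, \<psi>) \<in> adjoint_pairs (lattice_of A) (lattice_of B)" (is "?l \<longleftrightarrow> ?r")
proof
  have eq: "map_in S B A \<phi> (encoding S B q) \<sqsubseteq>\<^bsub>lattice_of_in S A\<^esub> encoding S A p \<longleftrightarrow> fst (\<phi> q) \<subseteq> fst p"
    "encoding S B q \<sqsubseteq>\<^bsub>lattice_of_in S B\<^esub> map_in S A B \<psi> (encoding S A p) \<longleftrightarrow> fst q \<subseteq> fst (\<psi> p)"
    if "p \<in> concepts A" "q \<in> concepts B" for p q
    using that PiE_mem[OF \<psi>] PiE_mem[OF \<phi>]
    by (simp_all add: map_in_encoding A B decoding_encoding)
  {
    assume ?l
    show ?r
    proof (rule adjoint_pairsI)
      fix p q assume "p \<in> carrier (lattice_of A)" "q \<in> carrier (lattice_of B)"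
      then show "\<phi> q \<sqsubseteq>\<^bsub>lattice_of A\<^esub> p \<longleftrightarrow> q \<sqsubseteq>\<^bsub>lattice_of B\<^esub> \<psi> p"
        using adjoint_pairsD(3)[OF \<open>?l\<close>, of "encoding S A p" "encoding S B q"] eq[of p q] by simp
    qed (use \<psi> \<phi> in simp_all)
  next
    assume ?r
    show ?l
    proof (rule adjoint_pairsI)
      fix x y assume "x \<in> carrier (lattice_of_in S A)" "y \<in> carrier (lattice_of_in S B)"
      then obtain p q where "p \<in> concepts A" "q \<in> concepts B" "x = encoding S A p" "y = encoding S B q"
        by auto
      then show "map_in S B A \<phi> y \<sqsubseteq>\<^bsub>lattice_of_in S A\<^esub> x \<longleftrightarrow> y \<sqsubseteq>\<^bsub>lattice_of_in S B\<^esub> map_in S A B \<psi> x"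
        using adjoint_pairsD(3)[OF \<open>?r\<close>, of p q] eq[of p q] by simp
    next
      show "partial_order (lattice_of_in S A)" "partial_order (lattice_of_in S B)"
        using order_iso_encoding A B by (auto simp: order_iso_def)
    qed (use map_in_mem[OF A \<psi>] map_in_mem[OF B \<phi>] in simp_all)
  }
qed

text \<open>Complete homomorphisms are the maps with both adjoints. By \<open>map_in_surj\<close>
  every candidate adjoint between the copies is a conjugate, so both existence statements
  transfer.\<close>

lemma map_in_complete_hom_iff:
  assumes A: "classification_in S A" and B: "classification_in S B"
    and \<psi>: "\<psi> \<in> concepts A \<rightarrow>\<^sub>E concepts B"
  shows "map_in S A B \<psi> \<in> complete_homs (lattice_of_in S A) (lattice_of_in S B) \<longleftrightarrow>
    \<psi> \<in> complete_homs (lattice_of A) (lattice_of B)"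
proof -
  note cl = complete_lattice_lattice_of_in[OF A] complete_lattice_lattice_of_in[OF B]
  have "(\<exists>\<phi>. (\<phi>, map_in S A B \<psi>) \<in> adjoint_pairs (lattice_of_in S A) (lattice_of_in S B)) \<longleftrightarrow>
      (\<exists>\<phi>. (\<phi>, \<psi>) \<in> adjoint_pairs (lattice_of A) (lattice_of B))"
    using map_in_adjoint_iff[OF A B \<psi>] map_in_surj[OF B A] adjoint_pairsD(1)
    by (metis lattice_of_simps(1))
  moreover have "(\<exists>\<theta>. (map_in S A B \<psi>, \<theta>) \<in> adjoint_pairs (lattice_of_in S B) (lattice_of_in S A)) \<longleftrightarrow>
      (\<exists>\<theta>. (\<psi>, \<theta>) \<in> adjoint_pairs (lattice_of B) (lattice_of A))"
    using map_in_adjoint_iff[OF B A _ \<psi>] map_in_surj[OF B A] adjoint_pairsD(2)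
    by (metis lattice_of_simps(1))
  ultimately show ?thesis
    using cl by (simp add: complete_homs_iff_adjoints)
qed

lemma map_in_id:
  "classification_in S A \<Longrightarrow>
    map_in S A A (\<lambda>c\<in>concepts A. c) = (\<lambda>x\<in>carrier (lattice_of_in S A). x)"
  unfolding map_in_def by (rule restrict_ext) (auto simp: decoding_encoding)

text \<open>The encoding into the copy for B and the decoding out of it cancel in the
  middle.\<close>

lemma map_in_compose:
  assumes "classification_in S A" "classification_in S B" "\<psi> \<in> concepts A \<rightarrow>\<^sub>E concepts B"
  shows "map_in S A C (compose (concepts A) \<chi> \<psi>) =
    compose (carrier (lattice_of_in S A)) (map_in S B C \<chi>) (map_in S A B \<psi>)"
  unfolding compose_def map_in_def[of S A C]
proof (rule restrict_ext)
  fix x assume "x \<in> carrier (lattice_of_in S A)"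
  then obtain c where c: "c \<in> concepts A" "x = encoding S A c" by auto
  then show "encoding S C ((\<lambda>c\<in>concepts A. \<chi> (\<psi> c)) (decoding S A x)) =
      map_in S B C \<chi> (map_in S A B \<psi> x)"
    using map_in_encoding[OF assms(2) PiE_mem[OF assms(3) c(1)]]
    by (simp add: decoding_encoding[OF assms(1)] map_in_encoding[OF assms(1)])
qed

section \<open>The functors, counits and equivalences on the copies\<close>

abbreviation bond_adj_in where
  "bond_adj_in S A B F \<equiv> (map_in S B A (bond_phi A B F), map_in S A B (bond_psi A B F))"

lemma bond_adj_in_mem:
  assumes "classification_in S A" "classification_in S B" "F \<in> bonds A B"
  shows "bond_adj_in S A B F \<in> adjoint_pairs (lattice_of_in S A) (lattice_of_in S B)"
  using assms by (simp add: map_in_adjoint_iff bond_psi_mem bond_phi_mem bond_adj_mem)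

lemma is_functor_A_in:
  "is_functor (full_subcategory Bond (classification_in S))
     (full_subcategory CompleteAdjoint (lattice_in S)) (A_functor_in S)"
  unfolding is_functor_def
proof (intro conjI ballI)
  fix A assume "A \<in> Obj (full_subcategory Bond (classification_in S))"
  then have A: "classification_in S A" by (simp add: full_subcategory_def)
  then show "fobj (A_functor_in S) A \<in> Obj (full_subcategory CompleteAdjoint (lattice_in S))"
    by (simp add: full_subcategory_def A_functor_in_def CompleteAdjoint_def
        complete_lattice_lattice_of_in lattice_in_lattice_of_in)
  show "farr (A_functor_in S) A A (Ident (full_subcategory Bond (classification_in S)) A) =
      Ident (full_subcategory CompleteAdjoint (lattice_in S)) (fobj (A_functor_in S) A)"
    using bond_adj_id[of A] map_in_id[OF A]
    by (simp add: full_subcategory_def A_functor_in_def CompleteAdjoint_def Bond_def adj_id_def)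
next
  fix A B F
  assume "A \<in> Obj (full_subcategory Bond (classification_in S))"
    "B \<in> Obj (full_subcategory Bond (classification_in S))"
    "F \<in> Hom (full_subcategory Bond (classification_in S)) A B"
  then show "farr (A_functor_in S) A B F \<in> Hom (full_subcategory CompleteAdjoint (lattice_in S))
      (fobj (A_functor_in S) A) (fobj (A_functor_in S) B)"
    by (simp add: full_subcategory_def A_functor_in_def CompleteAdjoint_def Bond_def bond_adj_in_mem)
next
  fix A B C F G
  assume "A \<in> Obj (full_subcategory Bond (classification_in S))"
    "B \<in> Obj (full_subcategory Bond (classification_in S))"
    "C \<in> Obj (full_subcategory Bond (classification_in S))"
    "F \<in> Hom (full_subcategory Bond (classification_in S)) A B"
    "G \<in> Hom (full_subcategory Bond (classification_in S)) B C"
  then have A: "classification_in S A" and B: "classification_in S B" and C: "classification_in S C"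
    and F: "F \<in> bonds A B" and G: "G \<in> bonds B C"
    by (simp_all add: full_subcategory_def Bond_def)
  show "farr (A_functor_in S) A C (Comp (full_subcategory Bond (classification_in S)) A B C F G) =
      Comp (full_subcategory CompleteAdjoint (lattice_in S)) (fobj (A_functor_in S) A)
        (fobj (A_functor_in S) B) (fobj (A_functor_in S) C)
        (farr (A_functor_in S) A B F) (farr (A_functor_in S) B C G)"
    using bond_adj_comp[OF F G] map_in_compose[OF A B bond_psi_mem[OF F]]
      map_in_compose[OF C B bond_phi_mem[OF G]]
    by (simp add: full_subcategory_def A_functor_in_def CompleteAdjoint_def Bond_def adj_comp_def)
qed

lemma is_functor_A2_in:
  "is_functor (full_subcategory BondingPair (classification_in S))
     (full_subcategory CompleteLattice (lattice_in S)) (A2_functor_in S)"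
  unfolding is_functor_def
proof (intro conjI ballI)
  fix A assume "A \<in> Obj (full_subcategory BondingPair (classification_in S))"
  then have A: "classification_in S A" by (simp add: full_subcategory_def)
  then show "fobj (A2_functor_in S) A \<in> Obj (full_subcategory CompleteLattice (lattice_in S))"
    by (simp add: full_subcategory_def A2_functor_in_def CompleteLattice_def
        complete_lattice_lattice_of_in lattice_in_lattice_of_in)
  show "farr (A2_functor_in S) A A (Ident (full_subcategory BondingPair (classification_in S)) A) =
      Ident (full_subcategory CompleteLattice (lattice_in S)) (fobj (A2_functor_in S) A)"
    using bp_hom_id[of A] map_in_id[OF A]
    by (simp add: full_subcategory_def A2_functor_in_def CompleteLattice_def BondingPair_def
        lat_id_def case_prod_beta)
next
  fix A B m
  assume "A \<in> Obj (full_subcategory BondingPair (classification_in S))"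
    "B \<in> Obj (full_subcategory BondingPair (classification_in S))"
    "m \<in> Hom (full_subcategory BondingPair (classification_in S)) A B"
  then have A: "classification_in S A" and B: "classification_in S B"
    and m: "bp_hom A B m \<in> complete_homs (lattice_of A) (lattice_of B)"
    by (simp_all add: full_subcategory_def BondingPair_def bp_hom_mem)
  then have "bp_hom A B m \<in> concepts A \<rightarrow>\<^sub>E concepts B"
    by (simp add: complete_homs_def)
  then show "farr (A2_functor_in S) A B m \<in> Hom (full_subcategory CompleteLattice (lattice_in S))
      (fobj (A2_functor_in S) A) (fobj (A2_functor_in S) B)"
    using m
    by (simp add: full_subcategory_def A2_functor_in_def CompleteLattice_def case_prod_beta
        map_in_complete_hom_iff[OF A B])
next
  fix A B C m n
  assume "A \<in> Obj (full_subcategory BondingPair (classification_in S))"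
    "B \<in> Obj (full_subcategory BondingPair (classification_in S))"
    "C \<in> Obj (full_subcategory BondingPair (classification_in S))"
    "m \<in> Hom (full_subcategory BondingPair (classification_in S)) A B"
    "n \<in> Hom (full_subcategory BondingPair (classification_in S)) B C"
  then have A: "classification_in S A" and B: "classification_in S B"
    and m: "m \<in> bonding_pairs A B" and n: "n \<in> bonding_pairs B C"
    by (simp_all add: full_subcategory_def BondingPair_def)
  have "bp_hom A B m \<in> concepts A \<rightarrow>\<^sub>E concepts B"
    using bp_hom_mem[OF m] by (simp add: complete_homs_def)
  then show "farr (A2_functor_in S) A C
      (Comp (full_subcategory BondingPair (classification_in S)) A B C m n) =
      Comp (full_subcategory CompleteLattice (lattice_in S)) (fobj (A2_functor_in S) A)
        (fobj (A2_functor_in S) B) (fobj (A2_functor_in S) C)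
        (farr (A2_functor_in S) A B m) (farr (A2_functor_in S) B C n)"
    using bp_hom_comp[OF m n] map_in_compose[OF A B]
    by (simp add: full_subcategory_def A2_functor_in_def CompleteLattice_def BondingPair_def
        lat_comp_def case_prod_beta)
qed

text \<open>The inverse of \<open>principal L\<close> is a bijection from the concepts of
  \<open>B_obj L\<close> onto the carrier of L, a member of \<open>S\<close>. So
  \<open>B_obj\<close> respects the size condition for every \<open>S\<close>.\<close>

lemma classification_in_B_obj:
  assumes "complete_lattice L" "lattice_in S L"
  shows "classification_in S (B_obj L)"
  using assms(2) bij_betw_the_inv_into[of "principal L" "carrier L" "concepts (B_obj L)"]
    order_iso_principal[OF assms(1)]
  by (auto simp: classification_in_def lattice_in_def order_iso_def)

abbreviation counit_iso_in :: "'u set set \<Rightarrow> 'u gorder \<Rightarrow> 'u \<Rightarrow> 'u" where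
  "counit_iso_in S L \<equiv> encoding S (B_obj L) \<circ> principal L"

abbreviation counit_phi_in :: "'u set set \<Rightarrow> 'u gorder \<Rightarrow> 'u \<Rightarrow> 'u" where
  "counit_phi_in S L \<equiv> iso_map L (lattice_of_in S (B_obj L)) (counit_iso_in S L)"

abbreviation counit_psi_in :: "'u set set \<Rightarrow> 'u gorder \<Rightarrow> 'u \<Rightarrow> 'u" where
  "counit_psi_in S L \<equiv> iso_inv L (lattice_of_in S (B_obj L)) (counit_iso_in S L)"

lemma order_iso_counit_iso_in:
  assumes "complete_lattice L" "lattice_in S L"
  shows "order_iso L (lattice_of_in S (B_obj L)) (counit_iso_in S L)"
  by (rule order_iso_comp[OF order_iso_principal[OF assms(1)]
        order_iso_encoding[OF classification_in_B_obj[OF assms]]])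

text \<open>Conjugation turns the action on principal concepts into the same action on their
  encodings; the two squares then arise as in \<open>counit_natural\<close>.\<close>

lemma counit_in_natural:
  assumes L: "complete_lattice L" "lattice_in S L" and K: "complete_lattice K" "lattice_in S K"
    and m: "(\<phi>, \<psi>) \<in> adjoint_pairs L K"
  shows "compose (carrier (lattice_of_in S (B_obj L))) (counit_psi_in S K)
      (map_in S (B_obj L) (B_obj K) (bond_psi (B_obj L) (B_obj K) (B_arr L K (\<phi>, \<psi>)))) =
      compose (carrier (lattice_of_in S (B_obj L))) \<psi> (counit_psi_in S L)"
    and "compose (carrier K)
      (map_in S (B_obj K) (B_obj L) (bond_phi (B_obj L) (B_obj K) (B_arr L K (\<phi>, \<psi>))))
      (counit_phi_in S K) = compose (carrier K) (counit_phi_in S L) \<phi>"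
proof -
  note D = adjoint_pairsD[OF m] and eq = bond_adj_B_arr_principal[OF L(1) K(1) m]
  note map = map_in_encoding[OF classification_in_B_obj[OF L] principal_mem[OF L(1)]]
    map_in_encoding[OF classification_in_B_obj[OF K] principal_mem[OF K(1)]]
  show "compose (carrier (lattice_of_in S (B_obj L))) (counit_psi_in S K)
      (map_in S (B_obj L) (B_obj K) (bond_psi (B_obj L) (B_obj K) (B_arr L K (\<phi>, \<psi>)))) =
      compose (carrier (lattice_of_in S (B_obj L))) \<psi> (counit_psi_in S L)"
    by (rule iso_inv_natural[OF order_iso_counit_iso_in[OF L] order_iso_counit_iso_in[OF K]])
       (use D(2) eq(1) map in auto)
  show "compose (carrier K)
      (map_in S (B_obj K) (B_obj L) (bond_phi (B_obj L) (B_obj K) (B_arr L K (\<phi>, \<psi>))))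
      (counit_phi_in S K) = compose (carrier K) (counit_phi_in S L) \<phi>"
    by (rule iso_map_natural) (use D(1) eq(2) map in auto)
qed

lemma natural_iso_BA_in:
  "naturally_isomorphic (full_subcategory CompleteAdjoint (lattice_in S))
     (full_subcategory CompleteAdjoint (lattice_in S)) (B_functor ;; A_functor_in S) id_func"
proof -
  have "adj_comp (lattice_of_in S (B_obj L)) (lattice_of_in S (B_obj K)) K
      (bond_adj_in S (B_obj L) (B_obj K) (B_arr L K m)) (counit_phi_in S K, counit_psi_in S K) =
    adj_comp (lattice_of_in S (B_obj L)) L K (counit_phi_in S L, counit_psi_in S L) m"
    if "complete_lattice L" "lattice_in S L" "complete_lattice K" "lattice_in S K"
      "m \<in> adjoint_pairs L K" for L K m
    using counit_in_natural[OF that(1-4), of "fst m" "snd m"] that(5)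
    by (cases m) (simp add: adj_comp_def)
  then show ?thesis
    unfolding naturally_isomorphic_def het_naturally_isomorphic_def
    by (intro exI[of _ "\<lambda>L. (counit_phi_in S L, counit_psi_in S L)"])
       (simp add: full_subcategory_def CompleteAdjoint_def func_comp_def A_functor_in_def
          B_functor_def id_func_def isomorphism_def adj_iso_of_order_iso order_iso_counit_iso_in)
qed

lemma natural_iso_B2A2_in:
  "naturally_isomorphic (full_subcategory CompleteLattice (lattice_in S))
     (full_subcategory CompleteLattice (lattice_in S)) (B2_functor ;; A2_functor_in S) id_func"
proof -
  have "lat_comp (lattice_of_in S (B_obj L)) (lattice_of_in S (B_obj K)) K
      (map_in S (B_obj L) (B_obj K) (bp_hom (B_obj L) (B_obj K) (farr B2_functor L K \<psi>)))
      (counit_psi_in S K) =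
    lat_comp (lattice_of_in S (B_obj L)) L K (counit_psi_in S L) \<psi>"
    if L: "complete_lattice L" "lattice_in S L" and K: "complete_lattice K" "lattice_in S K"
      and \<psi>: "\<psi> \<in> complete_homs L K" for L K \<psi>
  proof -
    obtain \<phi> \<theta> where "(\<phi>, \<psi>) \<in> adjoint_pairs L K" "(\<psi>, \<theta>) \<in> adjoint_pairs K L"
      using complete_homE[OF \<psi> L(1) K(1)] by metis
    then show ?thesis
      using counit_in_natural(1)[OF L K] L K by (simp add: lat_comp_def B2_functor_simps(2))
  qed
  moreover have "lat_iso (lattice_of_in S (B_obj L)) L (counit_psi_in S L)"
    if "complete_lattice L" "lattice_in S L" for L
    using that
    by (intro lat_iso_of_order_iso order_iso_counit_iso_in complete_lattice_lattice_of_in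
        classification_in_B_obj)
  ultimately show ?thesis
    unfolding naturally_isomorphic_def het_naturally_isomorphic_def
    by (intro exI[of _ "counit_psi_in S"])
       (simp add: full_subcategory_def CompleteLattice_def func_comp_def A2_functor_in_def
          B2_functor_simps(1) id_func_def isomorphism_def case_prod_beta)
qed

text \<open>Full faithfulness combines two bijections: bonds with adjoint pairs of concept lattices,
  and these with adjoint pairs of the copies.\<close>

lemma equivalence_Bond_in:
  "equivalence_via (full_subcategory Bond (classification_in S))
     (full_subcategory CompleteAdjoint (lattice_in S)) (A_functor_in S) B_functor"
proof (rule equivalence_via_fully_faithful)
  show "is_functor (full_subcategory CompleteAdjoint (lattice_in S))
      (full_subcategory Bond (classification_in S)) B_functor"
    by (rule is_functor_full_subcategory[OF is_functor_B])
       (simp add: CompleteAdjoint_def B_functor_def classification_in_B_obj)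
next
  fix A B F G
  assume "A \<in> Obj (full_subcategory Bond (classification_in S))"
    "B \<in> Obj (full_subcategory Bond (classification_in S))"
    "F \<in> Hom (full_subcategory Bond (classification_in S)) A B"
    "G \<in> Hom (full_subcategory Bond (classification_in S)) A B"
    "farr (A_functor_in S) A B F = farr (A_functor_in S) A B G"
  then have A: "classification_in S A" and B: "classification_in S B"
    and F: "F \<in> bonds A B" and G: "G \<in> bonds A B"
    and eq: "map_in S A B (bond_psi A B F) = map_in S A B (bond_psi A B G)"
    by (simp_all add: full_subcategory_def A_functor_in_def Bond_def)
  show "F = G"
    by (rule bond_psi_inj[OF F G map_in_inj[OF A B bond_psi_mem[OF F] bond_psi_mem[OF G] eq]])
next
  fix A B h
  assume "A \<in> Obj (full_subcategory Bond (classification_in S))"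
    "B \<in> Obj (full_subcategory Bond (classification_in S))"
    and "h \<in> Hom (full_subcategory CompleteAdjoint (lattice_in S))
      (fobj (A_functor_in S) A) (fobj (A_functor_in S) B)"
  then have A: "classification_in S A" and B: "classification_in S B"
    and h: "(fst h, snd h) \<in> adjoint_pairs (lattice_of_in S A) (lattice_of_in S B)"
    by (simp_all add: full_subcategory_def A_functor_in_def CompleteAdjoint_def)
  obtain \<phi> \<psi> where \<phi>: "\<phi> \<in> concepts B \<rightarrow>\<^sub>E concepts A" "map_in S B A \<phi> = fst h"
    and \<psi>: "\<psi> \<in> concepts A \<rightarrow>\<^sub>E concepts B" "map_in S A B \<psi> = snd h"
    using map_in_surj[OF A B adjoint_pairsD(2)[OF h]] map_in_surj[OF B A adjoint_pairsD(1)[OF h]]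
    by blast
  then have "(\<phi>, \<psi>) \<in> adjoint_pairs (lattice_of A) (lattice_of B)"
    using map_in_adjoint_iff[OF A B \<psi>(1) \<phi>(1)] h by simp
  from bond_adj_surj[OF this] show "\<exists>F\<in>Hom (full_subcategory Bond (classification_in S)) A B.
      farr (A_functor_in S) A B F = h"
    using \<phi>(2) \<psi>(2) by (auto simp: full_subcategory_def A_functor_in_def Bond_def prod_eq_iff)
qed (intro category_full_subcategory category_Bond category_CompleteAdjoint is_functor_A_in
    natural_iso_BA_in)+

text \<open>Here a single map is conjugated; \<open>bp_hom_inj\<close> and
  \<open>bp_hom_surj\<close> recover both bonds from it.\<close>

lemma equivalence_BondingPair_in:
  "equivalence_via (full_subcategory BondingPair (classification_in S))
     (full_subcategory CompleteLattice (lattice_in S)) (A2_functor_in S) B2_functor"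
proof (rule equivalence_via_fully_faithful)
  show "is_functor (full_subcategory CompleteLattice (lattice_in S))
      (full_subcategory BondingPair (classification_in S)) B2_functor"
    by (rule is_functor_full_subcategory[OF is_functor_B2])
       (simp add: CompleteLattice_def B2_functor_simps(1) classification_in_B_obj)
next
  fix A B m n
  assume "A \<in> Obj (full_subcategory BondingPair (classification_in S))"
    "B \<in> Obj (full_subcategory BondingPair (classification_in S))"
    "m \<in> Hom (full_subcategory BondingPair (classification_in S)) A B"
    "n \<in> Hom (full_subcategory BondingPair (classification_in S)) A B"
    "farr (A2_functor_in S) A B m = farr (A2_functor_in S) A B n"
  then have A: "classification_in S A" and B: "classification_in S B"
    and m: "m \<in> bonding_pairs A B" and n: "n \<in> bonding_pairs A B"
    and eq: "map_in S A B (bp_hom A B m) = map_in S A B (bp_hom A B n)"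
    by (simp_all add: full_subcategory_def A2_functor_in_def BondingPair_def case_prod_beta)
  have "bp_hom A B m = bp_hom A B n"
    using map_in_inj[OF A B _ _ eq] bp_hom_mem[OF m] bp_hom_mem[OF n] by (simp add: complete_homs_def)
  then show "m = n" by (rule bp_hom_inj[OF m n])
next
  fix A B h
  assume "A \<in> Obj (full_subcategory BondingPair (classification_in S))"
    "B \<in> Obj (full_subcategory BondingPair (classification_in S))"
    and "h \<in> Hom (full_subcategory CompleteLattice (lattice_in S))
      (fobj (A2_functor_in S) A) (fobj (A2_functor_in S) B)"
  then have A: "classification_in S A" and B: "classification_in S B"
    and h: "h \<in> complete_homs (lattice_of_in S A) (lattice_of_in S B)"
    by (simp_all add: full_subcategory_def A2_functor_in_def CompleteLattice_def)
  then have "h \<in> carrier (lattice_of_in S A) \<rightarrow>\<^sub>E carrier (lattice_of_in S B)"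
    by (simp add: complete_homs_def)
  from map_in_surj[OF A B this] obtain \<psi>
    where \<psi>: "\<psi> \<in> concepts A \<rightarrow>\<^sub>E concepts B" "map_in S A B \<psi> = h" by blast
  then have "\<psi> \<in> complete_homs (lattice_of A) (lattice_of B)"
    using map_in_complete_hom_iff[OF A B \<psi>(1)] h by simp
  from bp_hom_surj[OF this] show "\<exists>m\<in>Hom (full_subcategory BondingPair (classification_in S)) A B.
      farr (A2_functor_in S) A B m = h"
    using \<psi>(2) by (auto simp: full_subcategory_def A2_functor_in_def BondingPair_def case_prod_beta)
qed (intro category_full_subcategory category_BondingPair category_CompleteLattice is_functor_A2_in
    natural_iso_B2A2_in)+

section \<open>Classifications and concept lattices\<close>

lemma info_id_mem: "info_id A \<in> infomorphisms A A"
  by (auto simp: info_id_def infomorphisms_def)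

lemma info_comp_mem:
  assumes "m \<in> infomorphisms A B" "n \<in> infomorphisms B C"
  shows "info_comp A B C m n \<in> infomorphisms A C"
proof -
  obtain f g f' g' where mn: "m = (f, g)" "n = (f', g')" by (cases m, cases n)
  have m: "f \<in> Inst B \<rightarrow>\<^sub>E Inst A" "g \<in> Typ A \<rightarrow>\<^sub>E Typ B"
    "\<forall>b\<in>Inst B. \<forall>\<alpha>\<in>Typ A. (f b, \<alpha>) \<in> Sat A \<longleftrightarrow> (b, g \<alpha>) \<in> Sat B"
    and n: "f' \<in> Inst C \<rightarrow>\<^sub>E Inst B" "g' \<in> Typ B \<rightarrow>\<^sub>E Typ C"
    "\<forall>c\<in>Inst C. \<forall>\<beta>\<in>Typ B. (f' c, \<beta>) \<in> Sat B \<longleftrightarrow> (c, g' \<beta>) \<in> Sat C"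
    using assms by (simp_all add: mn infomorphisms_def)
  show ?thesis
    using m(3) n(3) PiE_mem[OF m(2)] PiE_mem[OF n(1)]
    by (simp add: mn info_comp_def infomorphisms_def compose_eq compose_mem[OF n(1) m(1)]
        compose_mem[OF m(2) n(2)])
qed

lemma info_comp_id:
  assumes "m \<in> infomorphisms A B"
  shows "info_comp A A B (info_id A) m = m" "info_comp A B B m (info_id B) = m"
  using assms by (auto simp: info_comp_def info_id_def infomorphisms_def compose_restrict_id)

lemma compose_compose:
  "f \<in> A \<rightarrow>\<^sub>E B \<Longrightarrow> compose A (compose B h g) f = compose A h (compose A g f)"
  by (rule compose_assoc[symmetric]) (simp add: PiE_def)

lemma info_comp_assoc:
  assumes "m \<in> infomorphisms A B" "n \<in> infomorphisms B C" "r \<in> infomorphisms C D"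
  shows "info_comp A C D (info_comp A B C m n) r = info_comp A B D m (info_comp B C D n r)"
  using assms by (auto simp: info_comp_def infomorphisms_def compose_compose)

lemma category_Classification: "category Classification"
  unfolding category_def Classification_def
  by (auto simp: info_id_mem info_comp_mem info_comp_id info_comp_assoc)

section \<open>Morphisms of concept lattices\<close>

lemma conlat_morphismsD:
  assumes "(\<phi>, \<psi>, f, g) \<in> conlat_morphisms L K"
  shows "f \<in> LInst K \<rightarrow>\<^sub>E LInst L" "g \<in> LTyp L \<rightarrow>\<^sub>E LTyp K"
    "(\<phi>, \<psi>) \<in> adjoint_pairs (Lat L) (Lat K)"
    "\<And>\<alpha>. \<alpha> \<in> LTyp L \<Longrightarrow> \<psi> (tau L \<alpha>) = tau K (g \<alpha>)"
    "\<And>b. b \<in> LInst K \<Longrightarrow> \<phi> (iota K b) = iota L (f b)"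
  using assms by (auto simp: conlat_morphisms_def)

lemma conlat_morphismsI:
  assumes "f \<in> LInst K \<rightarrow>\<^sub>E LInst L" "g \<in> LTyp L \<rightarrow>\<^sub>E LTyp K"
    "(\<phi>, \<psi>) \<in> adjoint_pairs (Lat L) (Lat K)"
    "\<And>\<alpha>. \<alpha> \<in> LTyp L \<Longrightarrow> \<psi> (tau L \<alpha>) = tau K (g \<alpha>)"
    "\<And>b. b \<in> LInst K \<Longrightarrow> \<phi> (iota K b) = iota L (f b)"
  shows "(\<phi>, \<psi>, f, g) \<in> conlat_morphisms L K"
  using assms by (auto simp: conlat_morphisms_def)

lemma conlat_id_mem:
  assumes "is_conlat L"
  shows "conlat_id L \<in> conlat_morphisms L L"
  unfolding conlat_id_def
  using adj_id_mem[of "Lat L"] is_conlatD[OF assms]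
  by (intro conlat_morphismsI) (auto simp: adj_id_def)

lemma conlat_comp_mem:
  assumes L: "is_conlat L" and K: "is_conlat K" and M: "is_conlat M"
    and m: "m \<in> conlat_morphisms L K" and n: "n \<in> conlat_morphisms K M"
  shows "conlat_comp L K M m n \<in> conlat_morphisms L M"
proof -
  obtain \<phi> \<psi> f g \<phi>' \<psi>' f' g' where mn: "m = (\<phi>, \<psi>, f, g)" "n = (\<phi>', \<psi>', f', g')"
    by (cases m, cases n)
  note D = conlat_morphismsD[OF m[unfolded mn]] and D' = conlat_morphismsD[OF n[unfolded mn]]
  have "adj_comp (Lat L) (Lat K) (Lat M) (\<phi>, \<psi>) (\<phi>', \<psi>') \<in> adjoint_pairs (Lat L) (Lat M)"
    using adj_comp_mem[OF _ _ D(3) D'(3)] is_conlatD(1)[OF L] is_conlatD(1)[OF M] by auto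
  then show ?thesis
    unfolding mn conlat_comp_def prod.case adj_comp_def
    using D(4,5) D'(4,5) is_conlatD(5)[OF L] is_conlatD(4)[OF M]
      PiE_mem[OF D(2)] PiE_mem[OF D'(1)]
    by (intro conlat_morphismsI compose_mem[OF D'(1) D(1)] compose_mem[OF D(2) D'(2)])
       (simp_all add: compose_eq)
qed

lemma conlat_comp_id:
  assumes "m \<in> conlat_morphisms L K"
  shows "conlat_comp L L K (conlat_id L) m = m" "conlat_comp L K K m (conlat_id K) = m"
  using assms
  by (auto simp: conlat_comp_def conlat_id_def conlat_morphisms_def adjoint_pairs_def compose_restrict_id)

lemma conlat_comp_assoc:
  assumes "m \<in> conlat_morphisms L K" "n \<in> conlat_morphisms K M" "r \<in> conlat_morphisms M N"
  shows "conlat_comp L M N (conlat_comp L K M m n) r = conlat_comp L K N m (conlat_comp K M N n r)"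
  using assms
  by (auto simp: conlat_comp_def conlat_morphisms_def adjoint_pairs_def compose_compose)

lemma category_ConceptLattice: "category ConceptLattice"
  unfolding category_def ConceptLattice_def
  by (auto simp: conlat_id_mem conlat_comp_mem conlat_comp_id conlat_comp_assoc)

text \<open>Since \<open>iota K b\<close> lies below \<open>\<psi> p\<close> iff \<open>iota L (f b)\<close> lies below \<open>p\<close>, join density makes
  \<open>f\<close> determine \<open>\<psi>\<close>.\<close>

lemma conlat_morphism_eqI:
  assumes L: "is_conlat L" and K: "is_conlat K"
    and m: "m \<in> conlat_morphisms L K" and n: "n \<in> conlat_morphisms L K"
    and eq: "snd (snd m) = snd (snd n)"
  shows "m = n"
proof -
  obtain \<phi> \<psi> f g \<phi>' \<psi>' where mn: "m = (\<phi>, \<psi>, f, g)" "n = (\<phi>', \<psi>', f, g)"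
    using eq by (cases m, cases n) auto
  note D = conlat_morphismsD[OF m[unfolded mn]] and D' = conlat_morphismsD[OF n[unfolded mn]]
  note A = adjoint_pairsD[OF D(3)] and A' = adjoint_pairsD[OF D'(3)]
  interpret K: complete_lattice "Lat K" using K by (rule is_conlatD)
  have "\<psi> = \<psi>'"
  proof (rule extensional_eqI[OF A(2) A'(2)])
    fix p assume p: "p \<in> carrier (Lat L)"
    have "iota K b \<sqsubseteq>\<^bsub>Lat K\<^esub> \<psi> p \<longleftrightarrow> iota K b \<sqsubseteq>\<^bsub>Lat K\<^esub> \<psi>' p" if b: "b \<in> LInst K" for b
      using A(3)[OF p is_conlatD(4)[OF K b]] A'(3)[OF p is_conlatD(4)[OF K b]] D(5)[OF b] D'(5)[OF b]
      by simp
    then show "\<psi> p = \<psi>' p"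
      using conlat_le_iff_iota[OF K A(5)[OF p] A'(5)[OF p]]
        conlat_le_iff_iota[OF K A'(5)[OF p] A(5)[OF p]] A(5)[OF p] A'(5)[OF p]
      by (intro K.le_antisym) auto
  qed
  then show ?thesis
    using left_adjoint_unique[OF _ D(3)] D'(3) is_conlatD(1)[OF L] by (auto simp: mn)
qed

section \<open>The functors L and C and their natural isomorphisms\<close>

lemma L_obj_simps [simp]:
  "Lat (L_obj A) = lattice_of A" "LInst (L_obj A) = Inst A" "LTyp (L_obj A) = Typ A"
  "iota (L_obj A) = iota_of A" "tau (L_obj A) = tau_of A"
  by (simp_all add: L_obj_def)

definition info_bond ::
    "('i, 't) classification \<Rightarrow> ('j, 's) classification \<Rightarrow> ('j \<Rightarrow> 'i) \<Rightarrow> ('j \<times> 't) set" where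
  "info_bond A B f = {(b, \<alpha>). b \<in> Inst B \<and> \<alpha> \<in> Typ A \<and> (f b, \<alpha>) \<in> Sat A}"

lemma infomorphismsD:
  assumes "(f, g) \<in> infomorphisms A B"
  shows "f \<in> Inst B \<rightarrow>\<^sub>E Inst A" "g \<in> Typ A \<rightarrow>\<^sub>E Typ B"
    "\<And>b. b \<in> Inst B \<Longrightarrow> f b \<in> Inst A" "\<And>\<alpha>. \<alpha> \<in> Typ A \<Longrightarrow> g \<alpha> \<in> Typ B"
    "\<And>b \<alpha>. \<lbrakk>b \<in> Inst B; \<alpha> \<in> Typ A\<rbrakk> \<Longrightarrow> (f b, \<alpha>) \<in> Sat A \<longleftrightarrow> (b, g \<alpha>) \<in> Sat B"
  using assms by (auto simp: infomorphisms_def)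

lemma info_bond_row: "b \<in> Inst B \<Longrightarrow> {\<alpha>. (b, \<alpha>) \<in> info_bond A B f} = intent_of A {f b}"
  by (auto simp: info_bond_def typ_deriv_def)

lemma info_bond_column:
  "\<lbrakk>(f, g) \<in> infomorphisms A B; \<alpha> \<in> Typ A\<rbrakk> \<Longrightarrow>
    {b. (b, \<alpha>) \<in> info_bond A B f} = extent_of B {g \<alpha>}"
  by (auto simp: info_bond_def inst_deriv_def infomorphismsD)

text \<open>The row of b is the intent of {f b}; by the infomorphism condition the column of
  \<alpha> is the extent of {g \<alpha>}.\<close>

lemma info_bond_mem:
  assumes m: "(f, g) \<in> infomorphisms A B"
  shows "info_bond A B f \<in> bonds A B"
  unfolding bonds_def
  using infomorphismsD[OF m] is_intent_intent_of[of "{_}" A] is_extent_extent_of[of "{_}" B]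
  by (simp add: info_bond_row info_bond_column[OF m]) (auto simp: info_bond_def)

text \<open>Deriving Y along the bond gives the g-preimage of its intent, and deriving \<Gamma>
  gives the f-preimage of its extent; at concepts these are the preimages of \<Delta> and X. So
  \<open>L_arr\<close> inherits adjointness from bonds.\<close>

lemma L_arr_eq_bond_adj:
  assumes m: "(f, g) \<in> infomorphisms A B"
  shows "L_arr A B (f, g) =
    (bond_phi A B (info_bond A B f), bond_psi A B (info_bond A B f), f, g)"
proof -
  note D = infomorphismsD[OF m]
  have "typ_deriv (Typ A) (info_bond A B f) Y = {\<alpha> \<in> Typ A. g \<alpha> \<in> \<Delta>}"
    if c: "(Y, \<Delta>) \<in> concepts B" for Y \<Delta>
  proof -
    have "typ_deriv (Typ A) (info_bond A B f) Y = {\<alpha> \<in> Typ A. g \<alpha> \<in> intent_of B Y}"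
      using D conceptsD(1)[OF c] by (auto simp: typ_deriv_def info_bond_def subset_iff)
    then show ?thesis by (simp only: conceptsD(4)[OF c])
  qed
  moreover have "inst_deriv (Inst B) (info_bond A B f) \<Gamma> = {b \<in> Inst B. f b \<in> X}"
    if c: "(X, \<Gamma>) \<in> concepts A" for X \<Gamma>
  proof -
    have "inst_deriv (Inst B) (info_bond A B f) \<Gamma> = {b \<in> Inst B. f b \<in> extent_of A \<Gamma>}"
      using D(3) conceptsD(2)[OF c] by (auto simp: inst_deriv_def info_bond_def subset_iff)
    then show ?thesis by (simp only: conceptsD(3)[OF c])
  qed
  ultimately show ?thesis
    unfolding L_arr_def bond_phi_def bond_psi_def
    by (auto intro!: restrict_ext)
qed

lemma L_arr_mem:
  assumes "m \<in> infomorphisms A B"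
  shows "L_arr A B m \<in> conlat_morphisms (L_obj A) (L_obj B)"
proof -
  obtain f g where m_eq: "m = (f, g)" by (cases m)
  note m = assms[unfolded m_eq] and D = infomorphismsD[OF assms[unfolded m_eq]]
  let ?F = "info_bond A B f"
  note F = info_bond_mem[OF m]
  show ?thesis
    unfolding m_eq L_arr_eq_bond_adj[OF m]
  proof (rule conlat_morphismsI)
    fix \<alpha> assume "\<alpha> \<in> LTyp (L_obj A)"
    then have \<alpha>: "\<alpha> \<in> Typ A" by simp
    have "bond_psi A B ?F (tau_of A \<alpha>) = tau_of B (g \<alpha>)"
    proof (rule concept_eqI)
      show "bond_psi A B ?F (tau_of A \<alpha>) \<in> concepts B"
        using PiE_mem[OF bond_psi_mem[OF F] PiE_mem[OF tau_of_mem \<alpha>]] .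
      show "tau_of B (g \<alpha>) \<in> concepts B" using PiE_mem[OF tau_of_mem D(4)[OF \<alpha>]] .
      show "fst (bond_psi A B ?F (tau_of A \<alpha>)) = fst (tau_of B (g \<alpha>))"
        using bond_psi_tau[OF F \<alpha>] info_bond_column[OF m \<alpha>] D(4)[OF \<alpha>] by (simp add: tau_of_def)
    qed
    then show "bond_psi A B ?F (tau (L_obj A) \<alpha>) = tau (L_obj B) (g \<alpha>)" by simp
  next
    fix b assume "b \<in> LInst (L_obj B)"
    then have b: "b \<in> Inst B" by simp
    note ib = PiE_mem[OF iota_of_mem b]
    have "bond_phi A B ?F (iota_of B b) = iota_of A (f b)"
    proof (rule concept_eqI')
      show "bond_phi A B ?F (iota_of B b) \<in> concepts A"
        using PiE_mem[OF bond_phi_mem[OF F] ib] .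
      show "iota_of A (f b) \<in> concepts A" using PiE_mem[OF iota_of_mem D(3)[OF b]] .
      \<comment> \<open>In the description of the left adjoint through g, the intent of {b} is
        simply pulled back along g, which gives the intent of {f b}.\<close>
      have "L_arr A B (f, g) = (bond_phi A B ?F, bond_psi A B ?F, f, g)"
        by (rule L_arr_eq_bond_adj[OF m])
      then have "bond_phi A B ?F = (\<lambda>(Y, \<Delta>)\<in>concepts B.
          (extent_of A {\<alpha> \<in> Typ A. g \<alpha> \<in> \<Delta>}, {\<alpha> \<in> Typ A. g \<alpha> \<in> \<Delta>}))"
        by (simp add: L_arr_def)
      then have "snd (bond_phi A B ?F (iota_of B b)) = {\<alpha> \<in> Typ A. g \<alpha> \<in> snd (iota_of B b)}"
        using ib by (simp add: case_prod_beta)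
      also have "\<dots> = snd (iota_of A (f b))"
        using b D by (auto simp: iota_of_def typ_deriv_def)
      finally show "snd (bond_phi A B ?F (iota_of B b)) = snd (iota_of A (f b))" .
    qed
    then show "bond_phi A B ?F (iota (L_obj B) b) = iota (L_obj A) (f b)" by simp
  qed (use D bond_adj_mem[OF F] in simp_all)
qed

lemma snd_snd_L_arr: "snd (snd (L_arr A B m)) = m"
  by (cases m) (simp add: L_arr_def)

text \<open>L keeps f and g, and these determine a morphism of concept lattices, so the functor laws
  are compared on these two components.\<close>

lemma is_functor_L: "is_functor Classification ConceptLattice L_functor"
  unfolding is_functor_def
proof (intro conjI ballI)
  fix A :: "('i, 't) classification"
  show "fobj L_functor A \<in> Obj ConceptLattice"
    by (simp add: L_functor_def ConceptLattice_def is_conlat_L_obj)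
  have "L_arr A A (info_id A) = conlat_id (L_obj A)"
    by (rule conlat_morphism_eqI[of "L_obj A" "L_obj A"])
       (simp_all add: L_arr_mem info_id_mem conlat_id_mem is_conlat_L_obj snd_snd_L_arr,
        simp add: info_id_def conlat_id_def)
  then show "farr L_functor A A (Ident Classification A) = Ident ConceptLattice (fobj L_functor A)"
    by (simp add: L_functor_def Classification_def ConceptLattice_def)
next
  fix A B :: "('i, 't) classification" and m
  assume "m \<in> Hom Classification A B"
  then show "farr L_functor A B m \<in> Hom ConceptLattice (fobj L_functor A) (fobj L_functor B)"
    by (simp add: L_functor_def Classification_def ConceptLattice_def L_arr_mem)
next
  fix A B C :: "('i, 't) classification" and m n
  assume "m \<in> Hom Classification A B" "n \<in> Hom Classification B C"
  then have m: "m \<in> infomorphisms A B" and n: "n \<in> infomorphisms B C"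
    by (simp_all add: Classification_def)
  have "L_arr A C (info_comp A B C m n) =
      conlat_comp (L_obj A) (L_obj B) (L_obj C) (L_arr A B m) (L_arr B C n)"
  proof (rule conlat_morphism_eqI[OF is_conlat_L_obj[of A] is_conlat_L_obj[of C]])
    show "snd (snd (L_arr A C (info_comp A B C m n))) =
        snd (snd (conlat_comp (L_obj A) (L_obj B) (L_obj C) (L_arr A B m) (L_arr B C n)))"
      by (cases m; cases n) (simp add: L_arr_def conlat_comp_def info_comp_def)
  qed (intro conlat_comp_mem L_arr_mem info_comp_mem is_conlat_L_obj m n)+
  then show "farr L_functor A C (Comp Classification A B C m n) =
      Comp ConceptLattice (fobj L_functor A) (fobj L_functor B) (fobj L_functor C)
        (farr L_functor A B m) (farr L_functor B C n)"
    by (simp add: L_functor_def Classification_def ConceptLattice_def)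
qed

text \<open>As \<open>iota L (f b)\<close> is \<open>\<phi> (iota K b)\<close> and
  \<open>tau K (g \<alpha>)\<close> is \<open>\<psi> (tau L \<alpha>)\<close>, the infomorphism
  condition is an instance of the adjunction.\<close>

lemma C_arr_mem:
  assumes L: "is_conlat L" and K: "is_conlat K" and m: "m \<in> conlat_morphisms L K"
  shows "C_arr L K m \<in> infomorphisms (C_obj L) (C_obj K)"
proof -
  obtain \<phi> \<psi> f g where m_eq: "m = (\<phi>, \<psi>, f, g)" by (cases m)
  note D = conlat_morphismsD[OF m[unfolded m_eq]]
  have "iota L (f b) \<sqsubseteq>\<^bsub>Lat L\<^esub> tau L \<alpha> \<longleftrightarrow> iota K b \<sqsubseteq>\<^bsub>Lat K\<^esub> tau K (g \<alpha>)"
    if b: "b \<in> LInst K" and \<alpha>: "\<alpha> \<in> LTyp L" for b \<alpha>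
    using adjoint_pairsD(3)[OF D(3) is_conlatD(5)[OF L \<alpha>] is_conlatD(4)[OF K b]]
    by (simp add: D(4)[OF \<alpha>] D(5)[OF b])
  then show ?thesis
    using PiE_mem[OF D(1)] PiE_mem[OF D(2)] D(1,2)
    by (simp add: m_eq C_arr_def infomorphisms_def)
qed

lemma is_classification_C_obj: "is_classification (C_obj L)"
  by (auto simp: is_classification_def)

lemma is_functor_C: "is_functor ConceptLattice Classification C_functor"
  unfolding is_functor_def Classification_def ConceptLattice_def C_functor_def
  by (simp add: C_arr_mem is_classification_C_obj)
     (auto simp: C_arr_def conlat_id_def info_id_def conlat_comp_def info_comp_def)

text \<open>\<open>iota_of_le_tau_of_iff\<close> recovers the incidence on the two sets, and
  \<open>is_classification\<close> excludes incidence outside them; hence an equality of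
  records.\<close>

lemma C_obj_L_obj:
  assumes "is_classification A"
  shows "C_obj (L_obj A) = A"
proof -
  have "Sat (C_obj (L_obj A)) = Sat A"
    using assms iota_of_le_tau_of_iff[of _ A] unfolding C_obj_def is_classification_def
    by (simp cong: conj_cong) blast
  then show ?thesis by (simp add: classification.equality)
qed

lemma LC_equal_id: "functors_equal_on Classification (L_functor ;; C_functor) id_func"
  unfolding functors_equal_on_def
  by (auto simp: func_comp_def id_func_def L_functor_def C_functor_def Classification_def
      C_obj_L_obj C_arr_def L_arr_def)

lemma concept_at_iota:
  assumes L: "is_conlat L" and b: "b \<in> LInst L"
  shows "concept_at L (iota L b) = iota_of (C_obj L) b"
proof (rule concept_eqI'[OF concept_at_mem[OF L is_conlatD(4)[OF L b]]])
  show "iota_of (C_obj L) b \<in> concepts (C_obj L)"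
    using b by (auto intro: PiE_mem[OF iota_of_mem])
  show "snd (concept_at L (iota L b)) = snd (iota_of (C_obj L) b)"
    using b by (auto simp: concept_at_def iota_of_def typ_deriv_def)
qed

lemma concept_at_tau:
  assumes L: "is_conlat L" and \<alpha>: "\<alpha> \<in> LTyp L"
  shows "concept_at L (tau L \<alpha>) = tau_of (C_obj L) \<alpha>"
proof (rule concept_eqI[OF concept_at_mem[OF L is_conlatD(5)[OF L \<alpha>]]])
  show "tau_of (C_obj L) \<alpha> \<in> concepts (C_obj L)"
    using \<alpha> by (auto intro: PiE_mem[OF tau_of_mem])
  show "fst (concept_at L (tau L \<alpha>)) = fst (tau_of (C_obj L) \<alpha>)"
    using \<alpha> by (auto simp: concept_at_def tau_of_def inst_deriv_def)
qed

text \<open>C and L leave instances and types alone, so the two functions are identities and the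
  content is in the adjoint pair.\<close>

definition conlat_counit where
  "conlat_counit L = (iso_map (Lat L) (lattice_of (C_obj L)) (concept_at L),
     iso_inv (Lat L) (lattice_of (C_obj L)) (concept_at L), \<lambda>a\<in>LInst L. a, \<lambda>\<alpha>\<in>LTyp L. \<alpha>)"

lemma conlat_iso_counit:
  assumes L: "is_conlat L"
  shows "conlat_iso (L_obj (C_obj L)) L (conlat_counit L)"
proof -
  note h = order_iso_concept_at[OF L]
  \<comment> \<open>The inverse morphism swaps the two maps; they remain an adjoint pair, since the
    inverse of an order isomorphism is adjoint to it on both sides.\<close>
  let ?n = "(iso_inv (Lat L) (lattice_of (C_obj L)) (concept_at L),
     iso_map (Lat L) (lattice_of (C_obj L)) (concept_at L), \<lambda>a\<in>LInst L. a, \<lambda>\<alpha>\<in>LTyp L. \<alpha>)"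
  have "conlat_counit L \<in> conlat_morphisms (L_obj (C_obj L)) L"
    unfolding conlat_counit_def
    by (rule conlat_morphismsI)
       (simp_all add: iso_inv_map_adjoint[OF h] iso_inv_eq[OF h] iso_map_eq is_conlatD(4,5)[OF L]
          concept_at_iota[OF L] concept_at_tau[OF L, symmetric])
  moreover have "?n \<in> conlat_morphisms L (L_obj (C_obj L))"
    by (rule conlat_morphismsI)
       (simp_all add: iso_inv_map_adjoint[OF h] iso_inv_eq[OF h] iso_map_eq is_conlatD(4,5)[OF L]
          concept_at_iota[OF L, symmetric] concept_at_tau[OF L])
  moreover have "conlat_comp (L_obj (C_obj L)) L (L_obj (C_obj L)) (conlat_counit L) ?n =
      conlat_id (L_obj (C_obj L))"
    "conlat_comp L (L_obj (C_obj L)) L ?n (conlat_counit L) = conlat_id L"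
    using iso_map_inv_compose[OF h]
    by (simp_all add: conlat_comp_def conlat_counit_def conlat_id_def)
       (auto simp: compose_def)
  ultimately show ?thesis
    unfolding het_isomorphism_def by blast
qed

lemma conlat_counit_mem:
  "is_conlat L \<Longrightarrow> conlat_counit L \<in> conlat_morphisms (L_obj (C_obj L)) L"
  using conlat_iso_counit by (auto simp: het_isomorphism_def)

text \<open>By \<open>conlat_morphism_eqI\<close> only f and g are compared, and there the counits
  contribute identities.\<close>

lemma conlat_counit_natural:
  assumes L: "is_conlat L" and K: "is_conlat K" and m: "m \<in> conlat_morphisms L K"
  shows "conlat_comp (L_obj (C_obj L)) (L_obj (C_obj K)) K
      (L_arr (C_obj L) (C_obj K) (C_arr L K m)) (conlat_counit K) =
    conlat_comp (L_obj (C_obj L)) L K (conlat_counit L) m"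
proof (rule conlat_morphism_eqI[OF is_conlat_L_obj[of "C_obj L"] K])
  show "snd (snd (conlat_comp (L_obj (C_obj L)) (L_obj (C_obj K)) K
      (L_arr (C_obj L) (C_obj K) (C_arr L K m)) (conlat_counit K))) =
    snd (snd (conlat_comp (L_obj (C_obj L)) L K (conlat_counit L) m))"
  proof (cases m)
    case (fields \<phi> \<psi> f g)
    note D = conlat_morphismsD[OF m[unfolded fields]]
    show ?thesis
      by (simp add: fields conlat_comp_def L_arr_def C_arr_def conlat_counit_def
          compose_restrict_id[OF D(1)] compose_restrict_id[OF D(2)])
  qed
qed (intro conlat_comp_mem conlat_counit_mem L_arr_mem C_arr_mem is_conlat_L_obj L K m)+

lemma natural_iso_CL:
  "het_naturally_isomorphic conlat_iso conlat_comp conlat_comp ConceptLattice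
     (C_functor ;; L_functor) id_func"
  unfolding het_naturally_isomorphic_def
  by (intro exI[of _ conlat_counit])
     (simp add: ConceptLattice_def func_comp_def L_functor_def C_functor_def id_func_def
        conlat_iso_counit conlat_counit_natural)

lemma naturally_isomorphic_of_equal:
  assumes C: "category C" and eq: "functors_equal_on C F id_func"
  shows "naturally_isomorphic C C F id_func"
  unfolding naturally_isomorphic_def het_naturally_isomorphic_def
proof (intro exI conjI ballI)
  fix a assume a: "a \<in> Obj C"
  then have "Ident C a \<in> Hom C a a" "Comp C a a a (Ident C a) (Ident C a) = Ident C a"
    using C by (auto simp: category_def)
  then show "isomorphism C (fobj F a) (fobj id_func a) (Ident C a)"
    using a eq by (auto simp: isomorphism_def het_isomorphism_def functors_equal_on_def id_func_def)
next
  fix a b f assume "a \<in> Obj C" "b \<in> Obj C" "f \<in> Hom C a b"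
  then show "Comp C (fobj F a) (fobj F b) (fobj id_func b) (farr F a b f) (Ident C b) =
      Comp C (fobj F a) (fobj id_func a) (fobj id_func b) (Ident C a) (farr id_func a b f)"
    using C eq by (simp add: category_def functors_equal_on_def id_func_def)
qed

text \<open>L and C change only the lattice. With \<open>('i, 't) concept\<close> as the type of its
  elements, C followed by L is an endofunctor of one category, and the heterogeneous isomorphisms
  are the ordinary ones.\<close>

lemma equivalence_Classification:
  "equivalence_via Classification
     (ConceptLattice :: ((('i, 't) concept, 'i, 't) conlat, _) cat) L_functor C_functor"
proof -
  have "isomorphism (ConceptLattice :: ((('i, 't) concept, 'i, 't) conlat, _) cat) = conlat_iso"
    by (simp add: isomorphism_def ConceptLattice_def)
  moreover have "Comp (ConceptLattice :: ((('i, 't) concept, 'i, 't) conlat, _) cat) = conlat_comp"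
    by (simp add: ConceptLattice_def)
  ultimately show ?thesis
    unfolding equivalence_via_def
    using naturally_isomorphic_of_equal[OF category_Classification LC_equal_id] natural_iso_CL
      category_Classification category_ConceptLattice is_functor_L is_functor_C
    by (simp add: naturally_isomorphic_def)
qed

theorem mainTheorem1:
  shows
    "(category (Classification :: (('i, 't) classification, _) cat) \<and>
      category (ConceptLattice :: (('l, 'i, 't) conlat, _) cat) \<and>
      is_functor (Classification :: (('i, 't) classification, _) cat) ConceptLattice L_functor \<and>
      is_functor (ConceptLattice :: (('l, 'i, 't) conlat, _) cat) Classification C_functor \<and>
      functors_equal_on (Classification :: (('i, 't) classification, _) cat)
        (L_functor ;; C_functor) id_func \<and>
      het_naturally_isomorphic conlat_iso conlat_comp conlat_comp
        (ConceptLattice :: (('l, 'i, 't) conlat, _) cat) (C_functor ;; L_functor) id_func \<and>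
      equivalence_via Classification
        (ConceptLattice :: ((('i, 't) concept, 'i, 't) conlat, _) cat) L_functor C_functor)
     \<and>
     (category (Bond :: (('i, 't) classification, _) cat) \<and>
      category (CompleteAdjoint :: ('l gorder, _) cat) \<and>
      is_functor (Bond :: (('i, 't) classification, _) cat) CompleteAdjoint A_functor \<and>
      is_functor (CompleteAdjoint :: ('l gorder, _) cat) Bond B_functor \<and>
      het_naturally_isomorphic bond_iso bond_comp bond_comp
        (Bond :: (('i, 't) classification, _) cat) (A_functor ;; B_functor) id_func \<and>
      het_naturally_isomorphic adj_iso adj_comp adj_comp
        (CompleteAdjoint :: ('l gorder, _) cat) (B_functor ;; A_functor) id_func \<and>
      (\<forall>S :: 'u set set. equivalence_via
        (full_subcategory Bond (classification_in S))
        (full_subcategory CompleteAdjoint (lattice_in S)) (A_functor_in S) B_functor))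
     \<and>
     (category (BondingPair :: (('i, 't) classification, _) cat) \<and>
      category (CompleteLattice :: ('l gorder, _) cat) \<and>
      is_functor (BondingPair :: (('i, 't) classification, _) cat) CompleteLattice A2_functor \<and>
      is_functor (CompleteLattice :: ('l gorder, _) cat) BondingPair B2_functor \<and>
      het_naturally_isomorphic bp_iso bp_comp bp_comp
        (BondingPair :: (('i, 't) classification, _) cat) (A2_functor ;; B2_functor) id_func \<and>
      het_naturally_isomorphic lat_iso lat_comp lat_comp
        (CompleteLattice :: ('l gorder, _) cat) (B2_functor ;; A2_functor) id_func \<and>
      (\<forall>S :: 'u set set. equivalence_via
        (full_subcategory BondingPair (classification_in S))
        (full_subcategory CompleteLattice (lattice_in S)) (A2_functor_in S) B2_functor))"
  using category_Classification category_ConceptLattice is_functor_L is_functor_C LC_equal_id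
    natural_iso_CL equivalence_Classification
    category_Bond category_CompleteAdjoint is_functor_A is_functor_B
    natural_iso_AB natural_iso_BA equivalence_Bond_in
    category_BondingPair category_CompleteLattice is_functor_A2 is_functor_B2
    natural_iso_A2B2 natural_iso_B2A2 equivalence_BondingPair_in
  by (intro conjI allI)

end
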